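(* There are universal constants $C, c_1, c_2, C'>0$ such that the following holds. Let $k,d_1,\dots,d_k$ be positive integers, $D=\prod_{a=1}^k d_a$, $d_{\max}=\max_a d_a$, $d_{\min}=\min_a d_a$, and let $\Theta=\Theta_1\otimes\cdots\otimes\Theta_k$ with each $\Theta_a$ a real symmetric positive definite $d_a\times d_a$ matrix, the factors being normalized so that $(\det\Theta_a)^{1/d_a}$ is the same for all $a\in[k]$. Suppose that $t\ge 1$ and $$ n \ge C k^2 \frac{d_{\max}^3}{D}\, t^2 . $$ Then, with probability at least $$ 1 - k e^{-c_1 t^2 d_{\max}} - k^2\left(\frac{\sqrt{nD}}{k\, d_{\max}}\right)^{-c_2 d_{\min}}, $$ the maximum likelihood estimator $\widehat\Theta=\widehat\Theta_1\otimes\cdots\otimes\widehat\Theta_k$ for $n$ independent samples from $\mathcal N(0,\Theta^{-1})$ is unique and satisfies $$ d_{\mathrm{FR}}(\widehat\Theta,\Theta)\le C'\,\frac{\sqrt k\, d_{\max}}{\sqrt n}\,t \qquad\text{and}\qquad d_{\mathrm{FR}}(\widehat\Theta_a,\Theta_a)\le C'\,\frac{\sqrt{k d_a}\, d_{\max}}{\sqrt{nD}}\,t\quad\text{for all }a\in[k]. $$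
   Context: $[k]=\{1,\dots,k\}$; $\mathrm{PD}(d)$ is the set of real symmetric positive definite $d\times d$ matrices. The parameter space is $\mathbb P=\{\Theta_1\otimes\cdots\otimes\Theta_k : \Theta_a\in \mathrm{PD}(d_a)\}\subset \mathrm{PD}(D)$ (Kronecker products). For $\Theta\in\mathbb P$ the factors $\Theta_a$ are fixed by requiring that $(\det\Theta_a)^{1/d_a}$ is the same for all $a\in[k]$; the same convention defines $\widehat\Theta_a$ from $\widehat\Theta$. For samples $x=(x_1,\dots,x_n)$, $x_i\in\mathbb R^D$, let $f_x:\mathbb P\to\mathbb R$, $f_x(\Theta)=\frac1{nD}\sum_{i=1}^n x_i^T\Theta x_i-\frac1D\log\det\Theta$ (proportional to the negative log-likelihood). The maximum likelihood estimator (MLE) is $\widehat\Theta=\arg\min_{\Theta\in\mathbb P} f_x(\Theta)$, whenever the minimizer exists and is unique. The Fisher-Rao distance on positive definite matrices is $d_{\mathrm{FR}}(A,B)=\frac1{\sqrt2}\|\log(B^{-1/2}AB^{-1/2})\|_F$, with $\|\cdot\|_F$ the Frobenius norm. *)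

theory Defs
  imports
    "HOL-Probability.Probability"
    "Jordan_Normal_Form.Gauss_Jordan_Elimination"
    "Jordan_Normal_Form.Determinant"
begin

text \<open>Matrix dimensions vary inside the main statement, so matrices are those of
  \<^theory>\<open>Jordan_Normal_Form.Matrix\<close>, with explicit carriers. The library
  theories on \<open>real ^ 'n\<close> clash with its notation.\<close>

no_notation inner (infix "\<bullet>" 70)
no_notation vec_nth (infixl "$" 90)

section \<open>Positive definite matrices and Kronecker products\<close>

definition PD :: "nat \<Rightarrow> real mat set" where
  "PD d = {A \<in> carrier_mat d d. transpose_mat A = A \<and>
     (\<forall>v \<in> carrier_vec d. v \<noteq> 0\<^sub>v d \<longrightarrow> 0 < v \<bullet> (A *\<^sub>v v))}"

definition kron :: "real mat \<Rightarrow> real mat \<Rightarrow> real mat" where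
  "kron A B = mat (dim_row A * dim_row B) (dim_col A * dim_col B)
     (\<lambda>(i, j). A $$ (i div dim_row B, j div dim_col B) * B $$ (i mod dim_row B, j mod dim_col B))"

fun kron_list :: "real mat list \<Rightarrow> real mat" where
  "kron_list [] = 1\<^sub>m 1"
| "kron_list (A # As) = kron A (kron_list As)"

text \<open>The dimensions \<open>d\<^sub>1, \<dots>, d\<^sub>k\<close> are the list \<open>ds\<close>; the indices \<open>a = 1, \<dots>, k\<close> of the
  mathematical text become \<open>a < length ds\<close>.\<close>

definition PD_tuples :: "nat list \<Rightarrow> real mat list set" where
  "PD_tuples ds = {As. length As = length ds \<and> (\<forall>a < length ds. As ! a \<in> PD (ds ! a))}"

definition param_space :: "nat list \<Rightarrow> real mat set" where
  "param_space ds = kron_list ` PD_tuples ds"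

text \<open>The normalization that singles out one factorization of each element of the
  parameter space.\<close>

definition normalized_factors :: "nat list \<Rightarrow> real mat list \<Rightarrow> bool" where
  "normalized_factors ds As \<longleftrightarrow>
     (\<forall>a < length ds. \<forall>b < length ds.
        det (As ! a) powr (1 / real (ds ! a)) = det (As ! b) powr (1 / real (ds ! b)))"

section \<open>Fisher-Rao distance\<close>

text \<open>\<open>f(A) = U diag(f(l\<^sub>1), \<dots>, f(l\<^sub>n)) U\<^sup>T\<close> for symmetric \<open>A = U diag(l\<^sub>1, \<dots>, l\<^sub>n) U\<^sup>T\<close> with
  \<open>U\<close> orthogonal; the value does not depend on the diagonalization, see
  \<open>spectral_fun_eq\<close> below.\<close>

definition spectral_fun :: "(real \<Rightarrow> real) \<Rightarrow> real mat \<Rightarrow> real mat" where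
  "spectral_fun f A = (let n = dim_row A in
     THE M. \<exists>U l. U \<in> carrier_mat n n \<and> transpose_mat U * U = 1\<^sub>m n \<and>
       A = U * mat_diag n l * transpose_mat U \<and>
       M = U * mat_diag n (\<lambda>i. f (l i)) * transpose_mat U)"

lemma spectral_fun_unique:
  assumes U: "U \<in> carrier_mat n n" "transpose_mat U * U = 1\<^sub>m n"
    and V: "V \<in> carrier_mat n n" "transpose_mat V * V = 1\<^sub>m n"
    and eq: "U * mat_diag n l * transpose_mat U = V * mat_diag n m * transpose_mat V"
  shows "U * mat_diag n (\<lambda>i. f (l i)) * transpose_mat U =
         V * mat_diag n (\<lambda>i. f (m i)) * transpose_mat (V :: real mat)"
proof -
  define W where "W = transpose_mat V * U"
  have W: "W \<in> carrier_mat n n" using U V by (auto simp: W_def)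
  have UT: "transpose_mat U \<in> carrier_mat n n" and VT: "transpose_mat V \<in> carrier_mat n n"
    using U V by auto
  have UU: "U * transpose_mat U = 1\<^sub>m n"
    using mat_mult_left_right_inverse[OF UT U(1) U(2)] .
  have VV: "V * transpose_mat V = 1\<^sub>m n"
    using mat_mult_left_right_inverse[OF VT V(1) V(2)] .
  note assoc = assoc_mult_mat[where n\<^sub>1 = n and n\<^sub>2 = n and n\<^sub>3 = n and n\<^sub>4 = n]
  have D [intro]: "mat_diag n g \<in> carrier_mat n n" for g :: "nat \<Rightarrow> real" by simp
  have mult [intro]: "A * B \<in> carrier_mat n n"
    if "A \<in> carrier_mat n n" "B \<in> carrier_mat n n" for A B :: "real mat"
    using that by simp
  note carr = U(1) V(1) UT VT W D
  have VW: "V * W = U"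
  proof -
    have "V * W = (V * transpose_mat V) * U" unfolding W_def by (rule assoc[symmetric]) (intro carr)+
    thus ?thesis using VV U(1) by simp
  qed
  have WU: "W * transpose_mat U = transpose_mat V"
  proof -
    have "W * transpose_mat U = transpose_mat V * (U * transpose_mat U)"
      unfolding W_def by (rule assoc) (intro carr)+
    thus ?thesis using UU VT by simp
  qed
  have diag: "X * mat_diag n g * transpose_mat X * X = X * mat_diag n g"
    if X: "X \<in> carrier_mat n n" "transpose_mat X * X = 1\<^sub>m n" for X :: "real mat" and g
  proof -
    have XT: "transpose_mat X \<in> carrier_mat n n" using X by simp
    have "X * mat_diag n g * transpose_mat X * X = X * mat_diag n g * (transpose_mat X * X)"
      by (rule assoc) (intro mult X XT D)+
    thus ?thesis using X right_mult_one_mat[OF mult[OF X(1) D[of g]]] by simp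
  qed
  have comm: "W * mat_diag n l = mat_diag n m * W"
  proof -
    have "W * mat_diag n l = transpose_mat V * (U * mat_diag n l)"
      unfolding W_def by (rule assoc) (intro carr)+
    also have "\<dots> = transpose_mat V * (V * mat_diag n m * transpose_mat V * U)"
      using diag[OF U, of l] eq by simp
    also have "V * mat_diag n m * transpose_mat V * U = V * mat_diag n m * W"
      unfolding W_def by (rule assoc) (intro mult carr)+
    also have "\<dots> = V * (mat_diag n m * W)"
      by (rule assoc) (intro mult carr)+
    also have "transpose_mat V * (V * (mat_diag n m * W)) = (transpose_mat V * V) * (mat_diag n m * W)"
      by (rule assoc[symmetric]) (intro mult carr)+
    also have "\<dots> = mat_diag n m * W"
      unfolding V(2) by (rule left_mult_one_mat[OF mult[OF D W]])
    finally show ?thesis .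
  qed
  have entry: "W $$ (i, j) * l j = m i * W $$ (i, j)" if "i < n" "j < n" for i j
  proof -
    have "(W * mat_diag n l) $$ (i, j) = (mat_diag n m * W) $$ (i, j)" using comm by simp
    thus ?thesis using that
      by (simp add: mat_diag_mult_right[OF W] mat_diag_mult_left[OF W])
  qed
  have "W * mat_diag n (\<lambda>i. f (l i)) = mat_diag n (\<lambda>i. f (m i)) * W"
  proof (rule eq_matI)
    fix i j assume "i < dim_row (mat_diag n (\<lambda>i. f (m i)) * W)"
      "j < dim_col (mat_diag n (\<lambda>i. f (m i)) * W)"
    hence ij: "i < n" "j < n" using W by (auto simp: mat_diag_def)
    have "W $$ (i, j) = 0 \<or> l j = m i" using entry[OF ij] by auto
    thus "(W * mat_diag n (\<lambda>i. f (l i))) $$ (i, j) = (mat_diag n (\<lambda>i. f (m i)) * W) $$ (i, j)"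
      using ij by (auto simp: mat_diag_mult_right[OF W] mat_diag_mult_left[OF W])
  qed (use W in \<open>auto simp: mat_diag_def\<close>)
  hence *: "V * (W * mat_diag n (\<lambda>i. f (l i))) * transpose_mat U =
         V * (mat_diag n (\<lambda>i. f (m i)) * W) * transpose_mat U" by simp
  have "V * (W * mat_diag n (\<lambda>i. f (l i))) = (V * W) * mat_diag n (\<lambda>i. f (l i))"
    by (rule assoc[symmetric]) (intro mult carr)+
  moreover have "V * (mat_diag n (\<lambda>i. f (m i)) * W) = V * mat_diag n (\<lambda>i. f (m i)) * W"
    by (rule assoc[symmetric]) (intro mult carr)+
  moreover have "V * mat_diag n (\<lambda>i. f (m i)) * W * transpose_mat U =
      V * mat_diag n (\<lambda>i. f (m i)) * (W * transpose_mat U)"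
    by (rule assoc) (intro mult carr)+
  ultimately show ?thesis using * VW WU by simp
qed

lemma spectral_fun_eq:
  assumes "U \<in> carrier_mat n n" "transpose_mat U * U = 1\<^sub>m n"
    and "A = U * mat_diag n l * transpose_mat U"
  shows "spectral_fun f A = U * mat_diag n (\<lambda>i. f (l i)) * transpose_mat U"
proof -
  have n: "dim_row A = n" using assms by simp
  show ?thesis unfolding spectral_fun_def Let_def n
  proof (rule the_equality)
    show "\<exists>U' l'. U' \<in> carrier_mat n n \<and> transpose_mat U' * U' = 1\<^sub>m n \<and>
      A = U' * mat_diag n l' * transpose_mat U' \<and>
      U * mat_diag n (\<lambda>i. f (l i)) * transpose_mat U =
      U' * mat_diag n (\<lambda>i. f (l' i)) * transpose_mat U'"
      using assms by blast
  qed (use assms spectral_fun_unique in metis)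
qed

definition frobenius_norm :: "real mat \<Rightarrow> real" where
  "frobenius_norm A = sqrt (\<Sum>i < dim_row A. \<Sum>j < dim_col A. (A $$ (i, j))\<^sup>2)"

definition fisher_rao :: "real mat \<Rightarrow> real mat \<Rightarrow> real" where
  "fisher_rao A B = (let R = spectral_fun (\<lambda>x. x powr (- 1 / 2)) B in
     1 / sqrt 2 * frobenius_norm (spectral_fun ln (R * A * R)))"

section \<open>Gaussian samples and maximum likelihood\<close>

definition inv_mat :: "real mat \<Rightarrow> real mat" where
  "inv_mat A = the (mat_inverse A)"

text \<open>\<open>N(0, S)\<close> for positive definite covariance \<open>S\<close>, through its Lebesgue density. A vector of
  \<open>\<real>\<^sup>d\<close> is a function on \<open>{..<d}\<close>, read as a \<^typ>\<open>real vec\<close> through \<^term>\<open>vec d\<close>.\<close>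

definition multivariate_normal :: "nat \<Rightarrow> real mat \<Rightarrow> (nat \<Rightarrow> real) measure" where
  "multivariate_normal d S = density (PiM {..<d} (\<lambda>_. lborel))
     (\<lambda>x. ennreal (exp (- (vec d x \<bullet> (inv_mat S *\<^sub>v vec d x)) / 2) /
                   sqrt ((2 * pi) ^ d * det S)))"

definition iid_samples :: "nat \<Rightarrow> (nat \<Rightarrow> real) measure \<Rightarrow> (nat \<Rightarrow> nat \<Rightarrow> real) measure" where
  "iid_samples n M = PiM {..<n} (\<lambda>_. M)"

definition neg_log_lik :: "nat list \<Rightarrow> nat \<Rightarrow> (nat \<Rightarrow> nat \<Rightarrow> real) \<Rightarrow> real mat \<Rightarrow> real" where
  "neg_log_lik ds n x T = (let D = prod_list ds in
     1 / (real n * real D) * (\<Sum>i < n. vec D (x i) \<bullet> (T *\<^sub>v vec D (x i)))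
       - 1 / real D * ln (det T))"

definition is_MLE :: "nat list \<Rightarrow> nat \<Rightarrow> (nat \<Rightarrow> nat \<Rightarrow> real) \<Rightarrow> real mat \<Rightarrow> bool" where
  "is_MLE ds n x T \<longleftrightarrow> T \<in> param_space ds \<and>
     (\<forall>T' \<in> param_space ds. neg_log_lik ds n x T \<le> neg_log_lik ds n x T')"

definition is_unique_MLE :: "nat list \<Rightarrow> nat \<Rightarrow> (nat \<Rightarrow> nat \<Rightarrow> real) \<Rightarrow> real mat \<Rightarrow> bool" where
  "is_unique_MLE ds n x T \<longleftrightarrow> is_MLE ds n x T \<and> (\<forall>T'. is_MLE ds n x T' \<longrightarrow> T' = T)"

text \<open>Event of probability at least \<open>p\<close>, in the sense of inner measure; for a
  measurable event this is \<open>p \<le> measure M {x \<in> space M. P x}\<close>.\<close>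

definition holds_with_prob_ge :: "'a measure \<Rightarrow> ('a \<Rightarrow> bool) \<Rightarrow> real \<Rightarrow> bool" where
  "holds_with_prob_ge M P p \<longleftrightarrow> (\<exists>E \<in> sets M. (\<forall>x \<in> E. P x) \<and> p \<le> measure M E)"

end

theory Submission
  imports Defs "Jordan_Normal_Form.Char_Poly"
begin

text \<open>After the substitution \<open>y = sqrt \<Theta> x\<close> the true parameter is the identity. Along
  \<open>s \<mapsto> exp (s L)\<close>, where \<open>L\<close> is the Kronecker sum of symmetric matrices \<open>H\<^sub>a\<close>, the objective is
  \<open>\<Sum>j. w\<^sub>j exp (s \<lambda>\<^sub>j) - s tr L / D\<close> with \<open>w\<^sub>j \<ge> 0\<close>, hence convex. Both its slope and its second
  derivative at \<open>s = 0\<close> are quadratic forms in the samples, so Chernoff bounds over a net of the space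
  of all Kronecker sums, which has dimension at most \<open>2 k dmax\<^sup>2\<close>, bound them for all \<open>L\<close> at once.
  The sample size makes \<open>\<bar>\<lambda>\<^sub>j\<bar> \<le> 1\<close> on the sphere of radius about \<open>sqrt k dmax t / sqrt (n D)\<close>, and
  there \<open>exp z \<ge> 1 + z + z\<^sup>2 / 4\<close> shows that the objective exceeds its value at the identity; by convexity
  along rays every minimizer lies inside. The second-order bound is proved for nonsymmetric blocks as
  well, which yields uniqueness: if \<open>K\<close> and \<open>K' = sqrt K exp L sqrt K\<close> both minimize, then the
  Kronecker sum \<open>(sqrt K)\<inverse> L sqrt K\<close> annihilates every sample and therefore vanishes.\<close>

section \<open>Spectral theorem\<close>

text \<open>Two competing demands fix the rate and the sample size. The net has exponentially many
  points in \<open>k * dmax\<^sup>2\<close>, so the union bound needs a relative slope error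
  \<open>e\<close> with \<open>e\<^sup>2 * n * D\<close> of order
  \<open>k * dmax\<^sup>2 * t\<^sup>2\<close>; the radius, measured in
  \<open>sqrt (frob2 L / D)\<close>, is a multiple of \<open>e\<close>. On the other side, a
  Kronecker sum of that size \<open>\<rho>\<close> has eigenvalues controlled only by
  \<open>sqrt (2 * k * dmax) * \<rho>\<close>, and asking for this to be at most 1 is the hypothesis
  on \<open>n\<close>. The quantitative second-order bound holds at the identity only, so uniqueness
  is not read off from a Hessian at the minimizer. The bound serves there as an injectivity
  statement: no nonzero Kronecker sum kills all samples. Conjugation by a Kronecker product
  preserves Kronecker sums but not symmetry, hence the interest in nonsymmetric blocks. Scalar parts
  of the blocks matter only through their sum. Equalizing them is at once the normalization of the
  factors, the way to a compact search domain, and the reason why a bound on the whole generator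
  bounds each factor.\<close>

lemmas square_assoc = assoc_mult_mat[where n\<^sub>1 = n and n\<^sub>2 = n and n\<^sub>3 = n and n\<^sub>4 = n for n]
lemmas square_transpose = transpose_mult[where nr = n and n = n and nc = n for n]

definition orth_mat :: "nat \<Rightarrow> real mat \<Rightarrow> bool" where
  "orth_mat n U \<longleftrightarrow> U \<in> carrier_mat n n \<and> transpose_mat U * U = 1\<^sub>m n"

lemma orth_mat_carrier [simp]: "orth_mat n U \<Longrightarrow> U \<in> carrier_mat n n"
  by (simp add: orth_mat_def)

lemma orth_mat_left: "orth_mat n U \<Longrightarrow> transpose_mat U * U = 1\<^sub>m n"
  by (simp add: orth_mat_def)

lemma orth_mat_right: "orth_mat n U \<Longrightarrow> U * transpose_mat U = 1\<^sub>m n"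
  unfolding orth_mat_def by (rule mat_mult_left_right_inverse[of _ n]) auto

lemma orth_mat_cancel_left:
  assumes "orth_mat n U" "X \<in> carrier_mat n m"
  shows "transpose_mat U * (U * X) = X"
proof -
  have c: "U \<in> carrier_mat n n" "transpose_mat U \<in> carrier_mat n n" using assms by auto
  have "transpose_mat U * (U * X) = transpose_mat U * U * X"
    by (rule assoc_mult_mat[symmetric, OF c(2) c(1) assms(2)])
  then show ?thesis using orth_mat_left[OF assms(1)] assms(2) by simp
qed

lemma orth_mat_one: "orth_mat n (1\<^sub>m n)"
  by (simp add: orth_mat_def)

lemma orth_mat_mult:
  assumes "orth_mat n U" "orth_mat n V"
  shows "orth_mat n (U * V)"
proof -
  have c: "U \<in> carrier_mat n n" "V \<in> carrier_mat n n" "transpose_mat U \<in> carrier_mat n n"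
    "transpose_mat V \<in> carrier_mat n n" using assms by auto
  have "transpose_mat (U * V) * (U * V) = transpose_mat V * (transpose_mat U * (U * V))"
    using c by (simp add: transpose_mult square_assoc[where n = n])
  then show ?thesis using orth_mat_cancel_left[OF assms(1) c(2)] assms c by (simp add: orth_mat_def)
qed

lemma scalar_prod_self_pos:
  fixes v :: "real vec"
  assumes "v \<in> carrier_vec n" "v \<noteq> 0\<^sub>v n"
  shows "0 < v \<bullet> v"
proof -
  obtain i where "i < n" "v $ i \<noteq> 0" using assms by (metis carrier_vecD eq_vecI index_zero_vec)
  then have "0 < (\<Sum>i<n. v $ i * v $ i)"
    by (intro sum_pos2[where i = i]) (auto simp: zero_less_mult_iff linorder_neq_iff)
  then show ?thesis using assms by (simp add: scalar_prod_def atLeast0LessThan)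
qed

text \<open>The complex characteristic polynomial has a root \<open>z\<close> with eigenvector
  \<open>w\<close>. Symmetry makes the Hermitian form \<open>Q = z * S\<close> real, and
  \<open>S\<close> is the positive squared norm of \<open>w\<close>, so \<open>z\<close> is real.
  The real and imaginary parts of \<open>w\<close> then satisfy the same equation, and one of them
  is nonzero.\<close>

lemma symmetric_eigenvector:
  fixes A :: "real mat"
  assumes A: "A \<in> carrier_mat n n" and sym: "transpose_mat A = A" and n: "0 < n"
  obtains e v where "v \<in> carrier_vec n" "v \<bullet> v = 1" "A *\<^sub>v v = e \<cdot>\<^sub>v v"
proof -
  define C where "C = map_mat complex_of_real A"
  have C: "C \<in> carrier_mat n n" using A by (simp add: C_def)
  have sA: "A $$ (i, j) = A $$ (j, i)" if "i < n" "j < n" for i j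
    using sym A that by (metis carrier_matD index_transpose_mat(1))
  have "degree (char_poly C) = n" using degree_monic_char_poly[OF C] by simp
  then have "\<not> constant (poly (char_poly C))" using n by (simp add: constant_degree)
  then obtain z where "poly (char_poly C) z = 0" using fundamental_theorem_of_algebra by blast
  then have "eigenvalue C z" using eigenvalue_root_char_poly[OF C] by simp
  then obtain w where w: "w \<in> carrier_vec n" "w \<noteq> 0\<^sub>v n" "C *\<^sub>v w = z \<cdot>\<^sub>v w"
    unfolding eigenvalue_def eigenvector_def using C by auto
  have ev: "(\<Sum>j<n. complex_of_real (A $$ (i, j)) * w $ j) = z * w $ i" if "i < n" for i
  proof -
    have "(C *\<^sub>v w) $ i = (z \<cdot>\<^sub>v w) $ i" using w by simp
    then show ?thesis using that C A w(1)
      by (auto simp: C_def scalar_prod_def atLeast0LessThan)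
  qed
  define S where "S = (\<Sum>i<n. cnj (w $ i) * w $ i)"
  define Q where "Q = (\<Sum>i<n. cnj (w $ i) * (\<Sum>j<n. complex_of_real (A $$ (i, j)) * w $ j))"
  have "Q = z * S" unfolding Q_def S_def using ev by (simp add: sum_distrib_left mult.left_commute)
  moreover have "cnj Q = Q"
  proof -
    have "cnj Q = (\<Sum>i<n. \<Sum>j<n. w $ i * (complex_of_real (A $$ (i, j)) * cnj (w $ j)))"
      by (simp add: Q_def sum_distrib_left)
    also have "\<dots> = (\<Sum>j<n. \<Sum>i<n. w $ i * (complex_of_real (A $$ (i, j)) * cnj (w $ j)))"
      by (rule sum.swap)
    also have "\<dots> = Q" unfolding Q_def sum_distrib_left
      by (intro sum.cong refl) (auto simp: sA mult_ac)
    finally show ?thesis .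
  qed
  moreover have Sr: "S = complex_of_real (\<Sum>i<n. (cmod (w $ i))\<^sup>2)"
    unfolding S_def by (simp add: complex_norm_square mult.commute del: of_real_power)
  have "S \<noteq> 0"
  proof
    assume "S = 0"
    then have "(\<Sum>i<n. (cmod (w $ i))\<^sup>2) = 0" using Sr by (metis of_real_eq_0_iff)
    then have "\<forall>i<n. w $ i = 0" by (subst (asm) sum_nonneg_eq_0_iff) auto
    then show False using w by auto
  qed
  ultimately have "cnj z = z" using Sr by auto
  then obtain r where zr: "z = complex_of_real r" by (metis Reals_cnj_iff of_real_Re)
  have ex: "\<exists>u. u \<in> carrier_vec n \<and> u \<noteq> 0\<^sub>v n \<and> A *\<^sub>v u = r \<cdot>\<^sub>v u"
  proof -
    have ri: "(\<Sum>j<n. A $$ (i, j) * Re (w $ j)) = r * Re (w $ i)"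
      "(\<Sum>j<n. A $$ (i, j) * Im (w $ j)) = r * Im (w $ i)" if "i < n" for i
      using arg_cong[OF ev[OF that], of Re] arg_cong[OF ev[OF that], of Im]
      unfolding zr by simp_all
    have "A *\<^sub>v map_vec Re w = r \<cdot>\<^sub>v map_vec Re w" "A *\<^sub>v map_vec Im w = r \<cdot>\<^sub>v map_vec Im w"
      using A w(1) ri by (auto intro!: eq_vecI simp: scalar_prod_def atLeast0LessThan)
    moreover have "map_vec Re w \<noteq> 0\<^sub>v n \<or> map_vec Im w \<noteq> 0\<^sub>v n"
    proof (rule ccontr)
      assume a: "\<not> ?thesis"
      have "Re (w $ i) = 0 \<and> Im (w $ i) = 0" if "i < n" for i
        using a that w(1) by (metis carrier_vecD index_map_vec(1) index_zero_vec(1))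
      then show False using w by (auto simp: complex_eq_iff)
    qed
    ultimately show ?thesis using w(1) by (metis map_carrier_vec)
  qed
  then obtain u where u: "u \<in> carrier_vec n" "u \<noteq> 0\<^sub>v n" "A *\<^sub>v u = r \<cdot>\<^sub>v u" by blast
  define c where "c = sqrt (u \<bullet> u)"
  have "u \<bullet> u > 0" using u(1,2) by (rule scalar_prod_self_pos)
  then have c: "c \<noteq> 0" "u \<bullet> u = c * c" by (auto simp: c_def)
  show ?thesis
  proof
    show "inverse c \<cdot>\<^sub>v u \<in> carrier_vec n" using u by simp
    show "(inverse c \<cdot>\<^sub>v u) \<bullet> (inverse c \<cdot>\<^sub>v u) = 1" using u(1) c by (simp add: field_simps)
    show "A *\<^sub>v (inverse c \<cdot>\<^sub>v u) = r \<cdot>\<^sub>v (inverse c \<cdot>\<^sub>v u)"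
    proof -
      have "A *\<^sub>v (inverse c \<cdot>\<^sub>v u) = inverse c \<cdot>\<^sub>v (A *\<^sub>v u)" using A u(1) by (rule mult_mat_vec)
      then show ?thesis unfolding u(3) by (simp only: smult_smult_assoc mult.commute[of r])
    qed
  qed
qed

text \<open>The Householder reflection exchanging \<open>u\<close> and the first unit vector.\<close>

lemma orth_mat_first_column:
  fixes u :: "real vec"
  assumes u: "u \<in> carrier_vec (Suc n)" "u \<bullet> u = 1"
  obtains Q where "orth_mat (Suc n) Q" "\<And>i. i < Suc n \<Longrightarrow> Q $$ (i, 0) = u $ i"
\<comment> \<open>If \<open>u $ 0 = 1\<close>, then \<open>u\<close> is the first unit vector, the
  mirror vector \<open>w\<close> would vanish, and the identity matrix does the job.\<close>
proof (cases "u $ 0 = 1")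
  case True
  have "(\<Sum>i<Suc n. (u $ i)\<^sup>2) = 1"
    using u by (simp add: scalar_prod_def atLeast0LessThan power2_eq_square)
  then have "(\<Sum>i<n. (u $ Suc i)\<^sup>2) = 0" using True by (subst (asm) sum.lessThan_Suc_shift) auto
  then have "\<forall>i<n. u $ Suc i = 0" by (subst (asm) sum_nonneg_eq_0_iff) auto
  then have "(1\<^sub>m (Suc n)) $$ (i, 0) = u $ i" if "i < Suc n" for i
    using that True by (cases i) auto
  then show ?thesis using that[OF orth_mat_one] by blast
next
  case False
  define w where "w i = u $ i - (if i = 0 then 1 else 0)" for i
  \<comment> \<open>The reflection is the identity minus \<open>c\<close> times the outer product of
    \<open>w\<close> with itself, \<open>c\<close> being 2 over the squared norm of
    \<open>w\<close>; that squared norm is \<open>2 - 2 * u $ 0\<close> because \<open>u\<close> is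
    a unit vector.\<close>
  define c where "c = 2 / (2 - 2 * u $ 0)"
  have s1: "(\<Sum>i<Suc n. u $ i * u $ i) = 1"
    using u by (simp add: scalar_prod_def atLeast0LessThan)
  have ww: "(\<Sum>i<Suc n. w i * w i) = 2 - 2 * u $ 0"
  proof -
    have "w i * w i = u $ i * u $ i + (if i = 0 then 1 - 2 * u $ 0 else 0)" for i
      by (auto simp: w_def algebra_simps)
    then have "(\<Sum>i<Suc n. w i * w i) = (\<Sum>i<Suc n. u $ i * u $ i) + (\<Sum>i<Suc n. if i = 0 then 1 - 2 * u $ 0 else 0)"
      by (simp only: sum.distrib)
    also have "(\<Sum>i<Suc n. if i = 0 then 1 - 2 * u $ 0 else 0) = 1 - 2 * u $ 0"
      by (subst sum.delta) auto
    finally show ?thesis using s1 by simp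
  qed
  have "2 - 2 * u $ 0 \<noteq> 0" using False by simp
  then have c: "c * (2 - 2 * u $ 0) = 2" unfolding c_def by (metis nonzero_mult_div_cancel_right times_divide_eq_left)
  define Q where "Q = mat (Suc n) (Suc n) (\<lambda>(i, j). (if i = j then 1 else 0) - c * w i * w j)"
  have "orth_mat (Suc n) Q" unfolding orth_mat_def
  proof
    show "transpose_mat Q * Q = 1\<^sub>m (Suc n)"
    proof (rule eq_matI)
      fix i j assume "i < dim_row (1\<^sub>m (Suc n) :: real mat)" "j < dim_col (1\<^sub>m (Suc n) :: real mat)"
      then have ij: "i < Suc n" "j < Suc n" by auto
      have "(transpose_mat Q * Q) $$ (i, j) =
        (\<Sum>k<Suc n. ((if k = i then 1 else 0) - c * w k * w i) * ((if k = j then 1 else 0) - c * w k * w j))"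
        using ij by (simp add: Q_def scalar_prod_def atLeast0LessThan)
      also have "\<dots> = (\<Sum>k<Suc n. (if k = i then (if i = j then 1 else 0) else 0)
         - (if k = i then c * w i * w j else 0) - (if k = j then c * w i * w j else 0)
         + c * c * w i * w j * (w k * w k))"
        by (intro sum.cong refl) (auto simp: algebra_simps)
      also have "\<dots> = (if i = j then 1 else 0) - c * w i * w j - c * w i * w j
         + c * c * w i * w j * (2 - 2 * u $ 0)"
        unfolding sum.distrib sum_subtractf sum_distrib_left[symmetric] ww
        using ij by (simp add: sum.delta del: sum.lessThan_Suc)
      also have "c * c * w i * w j * (2 - 2 * u $ 0) = 2 * (c * w i * w j)"
        using arg_cong[OF c, of "\<lambda>t. t * (c * w i * w j)"] by (simp add: algebra_simps)
      finally show "(transpose_mat Q * Q) $$ (i, j) = 1\<^sub>m (Suc n) $$ (i, j)" using ij by simp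
    qed (auto simp: Q_def)
  qed (simp add: Q_def)
  moreover have "Q $$ (i, 0) = u $ i" if "i < Suc n" for i
  proof -
    have "c * w 0 = -1" using c by (simp add: w_def algebra_simps)
    moreover have "c * w i * w 0 = (c * w 0) * w i" by simp
    ultimately show ?thesis using that by (auto simp: Q_def w_def)
  qed
  ultimately show ?thesis using that by blast
qed

text \<open>Deflation: conjugating by an orthogonal matrix whose first column is a unit eigenvector
  splits off a one-by-one block, and the induction hypothesis diagonalizes the rest. The induction
  runs on the form \<open>transpose_mat U * A * U\<close>, which composes under products of
  orthogonal matrices.\<close>

theorem spectral_theorem:
  fixes A :: "real mat"
  assumes "A \<in> carrier_mat n n" "transpose_mat A = A"
  obtains U l where "orth_mat n U" "A = U * mat_diag n l * transpose_mat U"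
proof -
  have "\<exists>U l. orth_mat n U \<and> transpose_mat U * A * U = mat_diag n l"
    using assms
  proof (induction n arbitrary: A)
    case 0
    then show ?case by (intro exI[of _ "1\<^sub>m 0"] exI[of _ "\<lambda>_. 0"]) (auto simp: orth_mat_one mat_diag_def)
  next
    case (Suc n)
    note c = \<open>A \<in> carrier_mat (Suc n) (Suc n)\<close>
    obtain e v where v: "v \<in> carrier_vec (Suc n)" "v \<bullet> v = 1" "A *\<^sub>v v = e \<cdot>\<^sub>v v"
      using symmetric_eigenvector[OF Suc.prems] by blast
    obtain Q where Q: "orth_mat (Suc n) Q" "\<And>i. i < Suc n \<Longrightarrow> Q $$ (i, 0) = v $ i"
      using orth_mat_first_column[OF v(1,2)] by metis
    have Qc: "Q \<in> carrier_mat (Suc n) (Suc n)" using Q by simp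
    have Q0: "col Q 0 = v" using Qc Q(2) v(1) by (intro eq_vecI) auto
    define B where "B = transpose_mat Q * A * Q"
    have Bc: "B \<in> carrier_mat (Suc n) (Suc n)" using Qc c by (simp add: B_def)
    have Bs: "transpose_mat B = B"
      unfolding B_def using Qc c Suc.prems(2)
      by (simp add: square_transpose[where n = "Suc n"] square_assoc[where n = "Suc n"])
    have B0: "B $$ (i, 0) = (if i = 0 then e else 0)" if i: "i < Suc n" for i
    proof -
      have "col (A * Q) 0 = e \<cdot>\<^sub>v v" using Q0 v(3) c Qc by (metis carrier_matD(2) col_mult2 zero_less_Suc)
      moreover have "B = transpose_mat Q * (A * Q)" unfolding B_def
        by (rule assoc_mult_mat) (use Qc c in auto)
      ultimately have "B $$ (i, 0) = col Q i \<bullet> (e \<cdot>\<^sub>v v)"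
        using i Qc c by simp
      also have "\<dots> = e * (transpose_mat Q * Q) $$ (i, 0)" using i Qc Q0 v(1) by simp
      finally show ?thesis using orth_mat_left[OF Q(1)] i by simp
    qed
    define B' where "B' = mat n n (\<lambda>(i, j). B $$ (Suc i, Suc j))"
    have sB: "B $$ (i, j) = B $$ (j, i)" if "i < Suc n" "j < Suc n" for i j
      using Bs Bc that by (metis carrier_matD index_transpose_mat(1))
    have "transpose_mat B' = B'" "B' \<in> carrier_mat n n"
      unfolding B'_def by (auto intro!: eq_matI sB)
    then obtain V l where V: "orth_mat n V" "transpose_mat V * B' * V = mat_diag n l"
      using Suc.IH by blast
    have Vc: "V \<in> carrier_mat n n" using V by simp
    have Bblock: "B = four_block_mat (mat 1 1 (\<lambda>_. e)) (0\<^sub>m 1 n) (0\<^sub>m n 1) B'"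
    proof (rule eq_matI)
      fix i j assume "i < dim_row (four_block_mat (mat 1 1 (\<lambda>_. e)) (0\<^sub>m 1 n) (0\<^sub>m n 1) B')"
        "j < dim_col (four_block_mat (mat 1 1 (\<lambda>_. e)) (0\<^sub>m 1 n) (0\<^sub>m n 1) B')"
      then have "i < Suc n" "j < Suc n" by (auto simp: B'_def)
      then show "B $$ (i, j) = four_block_mat (mat 1 1 (\<lambda>_. e)) (0\<^sub>m 1 n) (0\<^sub>m n 1) B' $$ (i, j)"
        using B0[of i] B0[of j] sB[of 0 j] by (auto simp: B'_def)
    qed (use Bc in \<open>auto simp: B'_def\<close>)
    define W where "W = four_block_mat (1\<^sub>m 1) (0\<^sub>m 1 n) (0\<^sub>m n 1) V"
    have WT: "transpose_mat W = four_block_mat (1\<^sub>m 1) (0\<^sub>m 1 n) (0\<^sub>m n 1) (transpose_mat V)"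
      unfolding W_def using Vc by (subst transpose_four_block_mat[of _ 1 1 _ n _ n]) auto
    have Wc: "W \<in> carrier_mat (Suc n) (Suc n)" unfolding W_def using Vc by auto
    have "transpose_mat W * W = four_block_mat (1\<^sub>m 1) (0\<^sub>m 1 n) (0\<^sub>m n 1) (1\<^sub>m n)"
      unfolding WT unfolding W_def using Vc orth_mat_left[OF V(1)]
      by (subst mult_four_block_mat[of _ 1 1 _ n _ n _ _ 1 _ n]) auto
    then have Wo: "orth_mat (Suc n) W" using Wc by (auto simp: orth_mat_def)
    have "transpose_mat W * B * W = four_block_mat (mat 1 1 (\<lambda>_. e)) (0\<^sub>m 1 n) (0\<^sub>m n 1) (mat_diag n l)"
      unfolding WT Bblock unfolding W_def using Vc V(2) \<open>B' \<in> carrier_mat n n\<close>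
      by (simp add: mult_four_block_mat[of _ 1 1 _ n _ n _ _ 1 _ n])
    also have "\<dots> = mat_diag (Suc n) (\<lambda>i. if i = 0 then e else l (i - 1))"
      by (rule eq_matI) (auto simp: mat_diag_def)
    finally have "transpose_mat W * B * W = mat_diag (Suc n) (\<lambda>i. if i = 0 then e else l (i - 1))" .
    moreover have "transpose_mat W * B * W = transpose_mat (Q * W) * A * (Q * W)"
      unfolding B_def using Qc c Wc
      by (simp add: square_transpose[where n = "Suc n"] square_assoc[where n = "Suc n"])
    ultimately show ?case using orth_mat_mult[OF Q(1) Wo] by metis
  qed
  then obtain U l where U: "orth_mat n U" "transpose_mat U * A * U = mat_diag n l" by blast
  have c: "U \<in> carrier_mat n n" "transpose_mat U \<in> carrier_mat n n" using U by auto
  have "U * mat_diag n l * transpose_mat U = (U * transpose_mat U) * A * (U * transpose_mat U)"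
    unfolding U(2)[symmetric] using c assms(1)
    by (simp add: square_assoc[where n = n])
  then have "A = U * mat_diag n l * transpose_mat U"
    using assms(1) orth_mat_right[OF U(1)] by simp
  then show ?thesis using that U(1) by blast
qed

section \<open>Kronecker products and Kronecker sums\<close>

lemma square_mult_carrier [simp]:
  "A \<in> carrier_mat n n \<Longrightarrow> B \<in> carrier_mat n n \<Longrightarrow> A * B \<in> carrier_mat n n"
  by (rule mult_carrier_mat)

text \<open>A Kronecker index \<open>i\<close> stands for the pair
  \<open>(i div n, i mod n)\<close>; this turns sums over such indices into double sums.\<close>

lemma sum_div_mod:
  fixes f :: "nat \<Rightarrow> nat \<Rightarrow> 'a::comm_monoid_add"
  shows "(\<Sum>i<m * n. f (i div n) (i mod n)) = (\<Sum>i<m. \<Sum>j<n. f i j)"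
proof -
  {
    fix i
    have "(\<Sum>j = i * n..<i * n + n. f (j div n) (j mod n)) = (\<Sum>j = 0..<n. f ((j + i * n) div n) ((j + i * n) mod n))"
      using sum.shift_bounds_nat_ivl[of "\<lambda>j. f (j div n) (j mod n)" 0 "i * n" n] by (simp add: add.commute)
    then have "(\<Sum>j = i * n..<i * n + n. f (j div n) (j mod n)) = (\<Sum>j<n. f i j)" by (simp add: atLeast0LessThan)
  } note block = this
  show ?thesis unfolding sum.nat_group[symmetric] block ..
qed

lemma kron_carrier [simp]:
  "A \<in> carrier_mat m n \<Longrightarrow> B \<in> carrier_mat p q \<Longrightarrow> kron A B \<in> carrier_mat (m * p) (n * q)"
  by (simp add: kron_def)

lemma kron_index:
  assumes "A \<in> carrier_mat m n" "B \<in> carrier_mat p q" "i < m * p" "j < n * q"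
  shows "kron A B $$ (i, j) = A $$ (i div p, j div q) * B $$ (i mod p, j mod q)"
  using assms by (simp add: kron_def)

lemma div_mod_less:
  fixes i m n :: nat
  assumes "i < m * n"
  shows "i div n < m" "i mod n < n"
  using assms by (simp add: less_mult_imp_div_less) (cases "n = 0", use assms in auto)

text \<open>The mixed-product rule. It is what lets square roots, inverses and diagonalizations of
  Kronecker products be taken factor by factor.\<close>

lemma kron_mult:
  assumes "A \<in> carrier_mat m n" "B \<in> carrier_mat p q" "C \<in> carrier_mat n r" "D \<in> carrier_mat q s"
  shows "kron A B * kron C D = kron (A * C) (B * D)"
proof (rule eq_matI)
  fix i j assume "i < dim_row (kron (A * C) (B * D))" "j < dim_col (kron (A * C) (B * D))"
  then have ij: "i < m * p" "j < r * s" using assms by (auto simp: kron_def)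
  note d = div_mod_less[OF ij(1)] div_mod_less[OF ij(2)]
  have "(kron A B * kron C D) $$ (i, j) = (\<Sum>k<n * q. kron A B $$ (i, k) * kron C D $$ (k, j))"
    using ij assms by (simp add: scalar_prod_def atLeast0LessThan kron_def)
  also have "\<dots> = (\<Sum>k<n * q. (\<lambda>k1 k2. A $$ (i div p, k1) * B $$ (i mod p, k2) * (C $$ (k1, j div s) * D $$ (k2, j mod s))) (k div q) (k mod q))"
    using ij assms by (intro sum.cong refl) (simp add: kron_index[where m = m and n = n and p = p and q = q] kron_index[where m = n and n = r and p = q and q = s])
  also have "\<dots> = (\<Sum>k1<n. \<Sum>k2<q. A $$ (i div p, k1) * B $$ (i mod p, k2) * (C $$ (k1, j div s) * D $$ (k2, j mod s)))"
    by (rule sum_div_mod)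
  also have "\<dots> = (\<Sum>k1<n. A $$ (i div p, k1) * C $$ (k1, j div s)) * (\<Sum>k2<q. B $$ (i mod p, k2) * D $$ (k2, j mod s))"
    by (simp add: sum_product mult_ac)
  also have "\<dots> = (A * C) $$ (i div p, j div s) * (B * D) $$ (i mod p, j mod s)"
    using d assms by (simp add: scalar_prod_def atLeast0LessThan)
  also have "\<dots> = kron (A * C) (B * D) $$ (i, j)"
    using ij assms by (subst kron_index[where m = m and n = r and p = p and q = s]) auto
  finally show "(kron A B * kron C D) $$ (i, j) = kron (A * C) (B * D) $$ (i, j)" .
qed (use assms in \<open>auto simp: kron_def\<close>)

lemma kron_transpose: "transpose_mat (kron A B) = kron (transpose_mat A) (transpose_mat B)"
  by (rule eq_matI) (auto simp: kron_def div_mod_less)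

lemma kron_diag: "kron (mat_diag m f) (mat_diag n g) = mat_diag (m * n) (\<lambda>i. f (i div n) * g (i mod n))"
proof (rule eq_matI)
  fix i j assume "i < dim_row (mat_diag (m * n) (\<lambda>i. f (i div n) * g (i mod n)))"
    "j < dim_col (mat_diag (m * n) (\<lambda>i. f (i div n) * g (i mod n)))"
  then have ij: "i < m * n" "j < m * n" by (auto simp: mat_diag_def)
  have "i = j \<longleftrightarrow> i div n = j div n \<and> i mod n = j mod n" by (metis div_mult_mod_eq)
  then show "kron (mat_diag m f) (mat_diag n g) $$ (i, j) = mat_diag (m * n) (\<lambda>i. f (i div n) * g (i mod n)) $$ (i, j)"
    using ij by (auto simp: kron_def mat_diag_def div_mod_less)
qed (auto simp: kron_def mat_diag_def)

lemma kron_one: "kron (1\<^sub>m m) (1\<^sub>m n) = 1\<^sub>m (m * n)"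
  using kron_diag[of m "\<lambda>_. 1" n "\<lambda>_. 1"] by simp

lemma kron_add_left:
  assumes "A \<in> carrier_mat m n" "B \<in> carrier_mat m n"
  shows "kron (A + B) C = kron A C + kron B C"
  using assms by (intro eq_matI) (auto simp: kron_def div_mod_less distrib_right)

lemma kron_add_right:
  assumes "A \<in> carrier_mat m n" "B \<in> carrier_mat m n"
  shows "kron C (A + B) = kron C A + kron C B"
  using assms by (intro eq_matI) (auto simp: kron_def div_mod_less distrib_left)

lemma kron_smult_left: "kron (c \<cdot>\<^sub>m A) B = c \<cdot>\<^sub>m kron A B"
  by (intro eq_matI) (auto simp: kron_def div_mod_less)

lemma kron_smult_right: "kron A (c \<cdot>\<^sub>m B) = c \<cdot>\<^sub>m kron A B"
  by (intro eq_matI) (auto simp: kron_def div_mod_less)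

section \<open>Trace and squared Frobenius norm\<close>

definition tr :: "real mat \<Rightarrow> real" where
  "tr A = (\<Sum>i<dim_row A. A $$ (i, i))"

definition frob2 :: "real mat \<Rightarrow> real" where
  "frob2 A = (\<Sum>i<dim_row A. \<Sum>j<dim_col A. (A $$ (i, j))\<^sup>2)"

lemma frob2_nonneg [simp]: "0 \<le> frob2 A"
  by (auto simp: frob2_def intro!: sum_nonneg)

lemma frobenius_norm_frob2: "frobenius_norm A = sqrt (frob2 A)"
  by (simp add: frobenius_norm_def frob2_def)

lemma tr_diag: "tr (mat_diag n l) = (\<Sum>i<n. l i)"
  by (simp add: tr_def mat_diag_def)

lemma frob2_diag: "frob2 (mat_diag n l) = (\<Sum>i<n. (l i)\<^sup>2)"
proof -
  have "(\<Sum>j<n. (if i = j then l j else 0)\<^sup>2) = (l i)\<^sup>2" if "i < n" for i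
  proof -
    have "(\<Sum>j<n. (if i = j then l j else 0)\<^sup>2) = (\<Sum>j<n. if j = i then (l i)\<^sup>2 else 0)"
      by (intro sum.cong) auto
    then show ?thesis using that by simp
  qed
  then show ?thesis by (simp add: frob2_def mat_diag_def)
qed

lemma tr_add: "A \<in> carrier_mat n n \<Longrightarrow> B \<in> carrier_mat n n \<Longrightarrow> tr (A + B) = tr A + tr B"
  by (simp add: tr_def sum.distrib)

lemma tr_smult: "A \<in> carrier_mat n n \<Longrightarrow> tr (c \<cdot>\<^sub>m A) = c * tr A"
  by (simp add: tr_def sum_distrib_left)

lemma tr_one: "tr (1\<^sub>m n) = real n"
  by (simp add: tr_def)

lemma tr_mult_comm:
  assumes "A \<in> carrier_mat n m" "B \<in> carrier_mat m n"
  shows "tr (A * B) = tr (B * A)"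
proof -
  have "tr (A * B) = (\<Sum>i<n. \<Sum>j<m. A $$ (i, j) * B $$ (j, i))"
    using assms by (simp add: tr_def scalar_prod_def atLeast0LessThan)
  also have "\<dots> = (\<Sum>j<m. \<Sum>i<n. A $$ (i, j) * B $$ (j, i))" by (rule sum.swap)
  also have "\<dots> = tr (B * A)"
    using assms by (simp add: tr_def scalar_prod_def atLeast0LessThan mult.commute)
  finally show ?thesis .
qed

lemma frob2_tr:
  assumes "A \<in> carrier_mat n m"
  shows "frob2 A = tr (transpose_mat A * A)"
proof -
  have "frob2 A = (\<Sum>j<m. \<Sum>i<n. (A $$ (i, j))\<^sup>2)"
    using assms by (simp add: frob2_def) (rule sum.swap)
  also have "\<dots> = tr (transpose_mat A * A)"
    using assms by (simp add: tr_def scalar_prod_def atLeast0LessThan power2_eq_square)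
  finally show ?thesis .
qed

lemma tr_orth_conj:
  assumes "orth_mat n U" "A \<in> carrier_mat n n"
  shows "tr (U * A * transpose_mat U) = tr A"
proof -
  have c: "U \<in> carrier_mat n n" "transpose_mat U \<in> carrier_mat n n" using assms by auto
  have "tr (U * A * transpose_mat U) = tr (transpose_mat U * (U * A))"
    using c assms(2) by (intro tr_mult_comm[of _ n n]) auto
  then show ?thesis using orth_mat_cancel_left[OF assms] by simp
qed

lemma frob2_orth_conj:
  assumes "orth_mat n U" "A \<in> carrier_mat n n"
  shows "frob2 (U * A * transpose_mat U) = frob2 A"
proof -
  have c: "U \<in> carrier_mat n n" "transpose_mat U \<in> carrier_mat n n" using assms by auto
  have "transpose_mat (U * A * transpose_mat U) * (U * A * transpose_mat U)
      = U * transpose_mat A * (transpose_mat U * (U * (A * transpose_mat U)))"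
    using c assms(2) by (simp add: square_transpose[where n = n] square_assoc[where n = n])
  also have "\<dots> = U * transpose_mat A * (A * transpose_mat U)"
    using c assms by (subst orth_mat_cancel_left[where n = n and m = n]) auto
  also have "\<dots> = U * (transpose_mat A * A) * transpose_mat U"
    using c assms(2) by (simp add: square_assoc[where n = n])
  finally have e: "transpose_mat (U * A * transpose_mat U) * (U * A * transpose_mat U) = U * (transpose_mat A * A) * transpose_mat U" .
  have "frob2 (U * A * transpose_mat U) = tr (U * (transpose_mat A * A) * transpose_mat U)"
    unfolding e[symmetric] by (rule frob2_tr[where n = n and m = n]) (use c assms in auto)
  also have "\<dots> = frob2 A"
    using assms by (subst tr_orth_conj[OF assms(1)]) (auto simp: frob2_tr[of A n n])
  finally show ?thesis .
qed

lemma tr_kron: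
  assumes "A \<in> carrier_mat m m" "B \<in> carrier_mat n n"
  shows "tr (kron A B) = tr A * tr B"
proof -
  show ?thesis using assms sum_div_mod[where f = "\<lambda>x y. A $$ (x, x) * B $$ (y, y)" and m = m and n = n]
    by (simp add: tr_def kron_def sum_product)
qed

lemma sum_delta_mult:
  fixes f :: "nat \<Rightarrow> real"
  assumes "i < n"
  shows "(\<Sum>j<n. (if i = j then 1 else 0) * f j) = f i" "(\<Sum>j<n. (if j = i then 1 else 0) * f j) = f i"
proof -
  have "(\<Sum>j<n. (if i = j then 1 else 0) * f j) = (\<Sum>j<n. if j = i then f i else 0)"
    by (intro sum.cong) auto
  then show "(\<Sum>j<n. (if i = j then 1 else 0) * f j) = f i" using assms by simp
  have "(\<Sum>j<n. (if j = i then 1 else 0) * f j) = (\<Sum>j<n. if j = i then f i else 0)"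
    by (intro sum.cong) auto
  then show "(\<Sum>j<n. (if j = i then 1 else 0) * f j) = f i" using assms by simp
qed

text \<open>In the expanded square each entry of \<open>A\<close> recurs \<open>n\<close> times and
  each entry of \<open>B\<close> recurs \<open>m\<close> times. The cross term carries both
  Kronecker deltas, so it survives only for pairs of diagonal entries and gives the product of
  traces.\<close>

lemma frob2_kron_sum:
  assumes A: "A \<in> carrier_mat m m" and B: "B \<in> carrier_mat n n"
  shows "frob2 (kron A (1\<^sub>m n) + kron (1\<^sub>m m) B) = n * frob2 A + m * frob2 B + 2 * tr A * tr B"
proof -
  define \<delta> where "\<delta> = (\<lambda>i j::nat. if i = j then 1 else 0 :: real)"
  have ss: "\<delta> i j * \<delta> i j = \<delta> i j" for i j by (simp add: \<delta>_def)
  have "frob2 (kron A (1\<^sub>m n) + kron (1\<^sub>m m) B) =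
    (\<Sum>i<m * n. \<Sum>j<m * n. (A $$ (i div n, j div n) * \<delta> (i mod n) (j mod n) + \<delta> (i div n) (j div n) * B $$ (i mod n, j mod n))\<^sup>2)"
    using A B by (simp add: frob2_def kron_def div_mod_less \<delta>_def)
  also have "\<dots> = (\<Sum>i1<m. \<Sum>i2<n. \<Sum>j1<m. \<Sum>j2<n. (A $$ (i1, j1) * \<delta> i2 j2 + \<delta> i1 j1 * B $$ (i2, j2))\<^sup>2)"
    using sum_div_mod[where f = "\<lambda>i1 i2. \<Sum>j<m * n. (A $$ (i1, j div n) * \<delta> i2 (j mod n) + \<delta> i1 (j div n) * B $$ (i2, j mod n))\<^sup>2"]
      sum_div_mod[where f = "\<lambda>j1 j2. (A $$ (_, j1) * \<delta> _ j2 + \<delta> _ j1 * B $$ (_, j2))\<^sup>2"] by simp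
  also have "\<dots> = (\<Sum>i1<m. \<Sum>i2<n. \<Sum>j1<m. \<Sum>j2<n. \<delta> i2 j2 * (A $$ (i1, j1))\<^sup>2 + \<delta> i1 j1 * (B $$ (i2, j2))\<^sup>2
      + 2 * (\<delta> i2 j2 * (\<delta> i1 j1 * (A $$ (i1, j1) * B $$ (i2, j2)))))"
  proof -
    have "(a * \<delta> i2 j2 + \<delta> i1 j1 * b)\<^sup>2 = \<delta> i2 j2 * a\<^sup>2 + \<delta> i1 j1 * b\<^sup>2 + 2 * (\<delta> i2 j2 * (\<delta> i1 j1 * (a * b)))" for a b i1 j1 i2 j2
    proof -
      have "(a * \<delta> i2 j2 + \<delta> i1 j1 * b)\<^sup>2 = (\<delta> i2 j2 * \<delta> i2 j2) * a\<^sup>2 + (\<delta> i1 j1 * \<delta> i1 j1) * b\<^sup>2 + 2 * (\<delta> i2 j2 * (\<delta> i1 j1 * (a * b)))"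
        by (simp add: power2_eq_square algebra_simps)
      then show ?thesis unfolding ss .
    qed
    then show ?thesis by simp
  qed
  also have "\<dots> = (\<Sum>i1<m. \<Sum>i2<n. \<Sum>j1<m. (A $$ (i1, j1))\<^sup>2) + (\<Sum>i1<m. \<Sum>i2<n. \<Sum>j2<n. (B $$ (i2, j2))\<^sup>2)
      + 2 * (\<Sum>i1<m. \<Sum>i2<n. A $$ (i1, i1) * B $$ (i2, i2))"
  proof -
    have 1: "(\<Sum>j1<m. \<Sum>j2<n. \<delta> i2 j2 * (A $$ (i1, j1))\<^sup>2) = (\<Sum>j1<m. (A $$ (i1, j1))\<^sup>2)" if "i2 < n" for i1 i2
      unfolding \<delta>_def using that by (simp add: sum_delta_mult)
    have 2: "(\<Sum>j1<m. \<Sum>j2<n. \<delta> i1 j1 * (B $$ (i2, j2))\<^sup>2) = (\<Sum>j2<n. (B $$ (i2, j2))\<^sup>2)" if "i1 < m" for i1 i2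
      unfolding \<delta>_def sum_distrib_left[symmetric] using that by (simp add: sum_delta_mult)
    have 3: "(\<Sum>j1<m. \<Sum>j2<n. \<delta> i2 j2 * (\<delta> i1 j1 * (A $$ (i1, j1) * B $$ (i2, j2)))) = A $$ (i1, i1) * B $$ (i2, i2)"
      if "i1 < m" "i2 < n" for i1 i2
      unfolding \<delta>_def using that by (simp add: sum_delta_mult)
    have "(\<Sum>j1<m. \<Sum>j2<n. \<delta> i2 j2 * (A $$ (i1, j1))\<^sup>2 + \<delta> i1 j1 * (B $$ (i2, j2))\<^sup>2
      + 2 * (\<delta> i2 j2 * (\<delta> i1 j1 * (A $$ (i1, j1) * B $$ (i2, j2))))) =
      (\<Sum>j1<m. (A $$ (i1, j1))\<^sup>2) + (\<Sum>j2<n. (B $$ (i2, j2))\<^sup>2) + 2 * (A $$ (i1, i1) * B $$ (i2, i2))"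
      if "i1 < m" "i2 < n" for i1 i2
      unfolding 1[OF that(2), symmetric] 2[OF that(1), symmetric] 3[OF that, symmetric]
      by (simp add: sum.distrib sum_distrib_left)
    then show ?thesis by (simp add: sum.distrib sum_distrib_left)
  qed
  also have "\<dots> = n * frob2 A + m * frob2 B + 2 * tr A * tr B"
    using A B by (simp add: frob2_def tr_def sum_product mult.assoc sum_distrib_left[of "real n"])
  finally show ?thesis .
qed

section \<open>Kronecker sums over a list of blocks and their eigenvalues\<close>

abbreviation pdim :: "('i \<Rightarrow> nat) \<Rightarrow> 'i list \<Rightarrow> nat" where
  "pdim d xs \<equiv> prod_list (map d xs)"

text \<open>The sum over \<open>a\<close> of the blocks \<open>G a\<close> acting on the tensor
  factor \<open>a\<close> alone: the tangent space at the identity of the Kronecker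
  products.\<close>

fun ksum :: "('i \<Rightarrow> nat) \<Rightarrow> ('i \<Rightarrow> real mat) \<Rightarrow> 'i list \<Rightarrow> real mat" where
  "ksum d G [] = 0\<^sub>m 1 1"
| "ksum d G (a # xs) = kron (G a) (1\<^sub>m (pdim d xs)) + kron (1\<^sub>m (d a)) (ksum d G xs)"

text \<open>The eigenvalue with index \<open>i\<close> of a Kronecker sum of diagonal blocks:
  \<open>i\<close> is read in mixed radix, and each digit selects one eigenvalue of its
  block.\<close>

fun lam :: "('i \<Rightarrow> nat) \<Rightarrow> ('i \<Rightarrow> nat \<Rightarrow> real) \<Rightarrow> 'i list \<Rightarrow> nat \<Rightarrow> real" where
  "lam d l [] i = 0"
| "lam d l (a # xs) i = l a (i div pdim d xs) + lam d l xs (i mod pdim d xs)"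

lemma kron_list_carrier:
  "(\<And>a. a \<in> set xs \<Longrightarrow> A a \<in> carrier_mat (d a) (d a)) \<Longrightarrow> kron_list (map A xs) \<in> carrier_mat (pdim d xs) (pdim d xs)"
  by (induction xs) auto

lemma kron_list_mult:
  assumes "\<And>a. a \<in> set xs \<Longrightarrow> A a \<in> carrier_mat (d a) (d a)" "\<And>a. a \<in> set xs \<Longrightarrow> B a \<in> carrier_mat (d a) (d a)"
  shows "kron_list (map A xs) * kron_list (map B xs) = kron_list (map (\<lambda>a. A a * B a) xs)"
  using assms
proof (induction xs)
  case (Cons a xs)
  then show ?case
    using kron_mult[of "A a" "d a" "d a" "kron_list (map A xs)" "pdim d xs" "pdim d xs" "B a" "d a" "kron_list (map B xs)" "pdim d xs"]
      kron_list_carrier[of xs A d] kron_list_carrier[of xs B d] by simp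
qed simp

lemma kron_list_transpose: "transpose_mat (kron_list (map A xs)) = kron_list (map (\<lambda>a. transpose_mat (A a)) xs)"
  by (induction xs) (auto simp: kron_transpose)

lemma kron_list_one: "kron_list (map (\<lambda>a. 1\<^sub>m (d a)) xs) = 1\<^sub>m (pdim d xs)"
  by (induction xs) (auto simp: kron_one)

text \<open>The exponential of a Kronecker sum is the Kronecker product of the exponentials, here
  for diagonal blocks.\<close>

lemma kron_list_diag_exp:
  "kron_list (map (\<lambda>a. mat_diag (d a) (\<lambda>i. exp (l a i))) xs) = mat_diag (pdim d xs) (\<lambda>i. exp (lam d l xs i))"
  by (induction xs) (auto simp: kron_diag exp_add)

lemma kron_list_orth:
  assumes "\<And>a. a \<in> set xs \<Longrightarrow> orth_mat (d a) (U a)"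
  shows "orth_mat (pdim d xs) (kron_list (map U xs))"
proof -
  have "transpose_mat (kron_list (map U xs)) * kron_list (map U xs) = kron_list (map (\<lambda>a. transpose_mat (U a) * U a) xs)"
    unfolding kron_list_transpose by (rule kron_list_mult[where d = d]) (use assms in auto)
  also have "map (\<lambda>a. transpose_mat (U a) * U a) xs = map (\<lambda>a. 1\<^sub>m (d a)) xs"
    using assms by (auto simp: orth_mat_left)
  finally show ?thesis
    unfolding orth_mat_def kron_list_one using kron_list_carrier[of xs U d] assms by auto
qed

lemma kron_list_mult3:
  assumes "\<And>a. a \<in> set xs \<Longrightarrow> A a \<in> carrier_mat (d a) (d a)" "\<And>a. a \<in> set xs \<Longrightarrow> B a \<in> carrier_mat (d a) (d a)"
    "\<And>a. a \<in> set xs \<Longrightarrow> C a \<in> carrier_mat (d a) (d a)"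
  shows "kron_list (map A xs) * kron_list (map B xs) * kron_list (map C xs) = kron_list (map (\<lambda>a. A a * B a * C a) xs)"
  using assms by (simp add: kron_list_mult[where d = d])

lemma kron_list_spectral_exp:
  assumes "\<And>a. a \<in> set xs \<Longrightarrow> orth_mat (d a) (U a)"
  shows "kron_list (map (\<lambda>a. U a * mat_diag (d a) (\<lambda>i. exp (l a i)) * transpose_mat (U a)) xs) =
    kron_list (map U xs) * mat_diag (pdim d xs) (\<lambda>i. exp (lam d l xs i)) * transpose_mat (kron_list (map U xs))"
  unfolding kron_list_diag_exp[symmetric] kron_list_transpose
  by (rule kron_list_mult3[where d = d, symmetric]) (use assms in auto)

lemma ksum_carrier:
  "(\<And>a. a \<in> set xs \<Longrightarrow> G a \<in> carrier_mat (d a) (d a)) \<Longrightarrow> ksum d G xs \<in> carrier_mat (pdim d xs) (pdim d xs)"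
  by (induction xs) auto

lemma ksum_cong:
  "(\<And>a. a \<in> set xs \<Longrightarrow> G a = H a) \<Longrightarrow> ksum d G xs = ksum d H xs"
  by (induction xs) auto

lemma kron_diag_left_one: "kron (mat_diag m f) (1\<^sub>m n) = mat_diag (m * n) (\<lambda>i. f (i div n))"
  using kron_diag[of m f n "\<lambda>_. 1"] by simp

lemma kron_diag_right_one: "kron (1\<^sub>m m) (mat_diag n g) = mat_diag (m * n) (\<lambda>i. g (i mod n))"
  using kron_diag[of m "\<lambda>_. 1" n g] by simp

lemma mat_diag_add: "mat_diag n f + mat_diag n g = mat_diag n (\<lambda>i. f i + g i :: real)"
  by (rule eq_matI) (auto simp: mat_diag_def)

lemma ksum_diag: "ksum d (\<lambda>a. mat_diag (d a) (l a)) xs = mat_diag (pdim d xs) (lam d l xs)"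
proof (induction xs)
  case Nil
  show ?case by (rule eq_matI) (auto simp: mat_diag_def)
next
  case (Cons a xs)
  have "lam d l (a # xs) = (\<lambda>i. l a (i div pdim d xs) + lam d l xs (i mod pdim d xs))" by auto
  then show ?case by (simp add: Cons kron_diag_left_one kron_diag_right_one mat_diag_add)
qed

text \<open>Where the conjugators act on an identity factor they cancel by
  \<open>B a * A a = 1\<close>. No orthogonality is asked for, since the uniqueness proof conjugates
  by the square root of a minimizer, besides the orthogonal case of
  \<open>ksum_spectral\<close>.\<close>

lemma ksum_conj:
  assumes "\<And>a. a \<in> set xs \<Longrightarrow> G a \<in> carrier_mat (d a) (d a)" "\<And>a. a \<in> set xs \<Longrightarrow> A a \<in> carrier_mat (d a) (d a)"
    "\<And>a. a \<in> set xs \<Longrightarrow> B a \<in> carrier_mat (d a) (d a)" "\<And>a. a \<in> set xs \<Longrightarrow> B a * A a = 1\<^sub>m (d a)"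
  shows "kron_list (map B xs) * ksum d G xs * kron_list (map A xs) = ksum d (\<lambda>a. B a * G a * A a) xs"
  using assms
proof (induction xs)
  case Nil
  show ?case by (rule eq_matI) (auto simp: scalar_prod_def)
next
  case (Cons a xs)
  let ?P = "pdim d xs" and ?KA = "kron_list (map A xs)" and ?KB = "kron_list (map B xs)"
  have c: "G a \<in> carrier_mat (d a) (d a)" "A a \<in> carrier_mat (d a) (d a)" "B a \<in> carrier_mat (d a) (d a)"
    using Cons.prems by auto
  have K: "?KA \<in> carrier_mat ?P ?P" "?KB \<in> carrier_mat ?P ?P" "ksum d G xs \<in> carrier_mat ?P ?P"
    using Cons.prems by (auto intro!: kron_list_carrier ksum_carrier)
  have KK: "?KB * ?KA = 1\<^sub>m ?P"
  proof -
    have "?KB * ?KA = kron_list (map (\<lambda>a. B a * A a) xs)"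
      using Cons.prems by (intro kron_list_mult[where d = d]) auto
    also have "map (\<lambda>a. B a * A a) xs = map (\<lambda>a. 1\<^sub>m (d a)) xs" using Cons.prems by auto
    finally show ?thesis by (simp add: kron_list_one)
  qed
  note km = kron_mult[where m = "d a" and n = "d a" and p = ?P and q = ?P and r = "d a" and s = ?P]
  have k1: "kron (G a) (1\<^sub>m ?P) \<in> carrier_mat (d a * ?P) (d a * ?P)" "kron (1\<^sub>m (d a)) (ksum d G xs) \<in> carrier_mat (d a * ?P) (d a * ?P)"
    "kron (A a) ?KA \<in> carrier_mat (d a * ?P) (d a * ?P)" "kron (B a) ?KB \<in> carrier_mat (d a * ?P) (d a * ?P)"
    using c K by auto
  have e1: "kron (B a) ?KB * kron (G a) (1\<^sub>m ?P) = kron (B a * G a) ?KB"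
    "kron (B a) ?KB * kron (1\<^sub>m (d a)) (ksum d G xs) = kron (B a) (?KB * ksum d G xs)"
    using c K by (simp_all add: km)
  have e2: "kron (B a * G a) ?KB * kron (A a) ?KA = kron (B a * G a * A a) (1\<^sub>m ?P)"
    "kron (B a) (?KB * ksum d G xs) * kron (A a) ?KA = kron (1\<^sub>m (d a)) (?KB * ksum d G xs * ?KA)"
    using c K Cons.prems(4)[of a] by (simp_all add: km KK)
  have "kron (B a) ?KB * (kron (G a) (1\<^sub>m ?P) + kron (1\<^sub>m (d a)) (ksum d G xs)) * kron (A a) ?KA
    = (kron (B a) ?KB * kron (G a) (1\<^sub>m ?P) + kron (B a) ?KB * kron (1\<^sub>m (d a)) (ksum d G xs)) * kron (A a) ?KA"
    using k1 by (subst mult_add_distrib_mat) auto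
  also have "\<dots> = kron (B a) ?KB * kron (G a) (1\<^sub>m ?P) * kron (A a) ?KA + kron (B a) ?KB * kron (1\<^sub>m (d a)) (ksum d G xs) * kron (A a) ?KA"
    by (rule add_mult_distrib_mat) (use k1 in auto)
  finally show ?case using Cons by (simp add: e1 e2)
qed

lemma ksum_spectral:
  assumes "\<And>a. a \<in> set xs \<Longrightarrow> orth_mat (d a) (U a)"
  shows "ksum d (\<lambda>a. U a * mat_diag (d a) (l a) * transpose_mat (U a)) xs =
    kron_list (map U xs) * mat_diag (pdim d xs) (lam d l xs) * transpose_mat (kron_list (map U xs))"
  unfolding ksum_diag[symmetric] kron_list_transpose
  by (rule ksum_conj[symmetric]) (use assms in \<open>auto simp: orth_mat_right\<close>)

lemma mat_add_ac4:
  fixes A B C D :: "real mat"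
  assumes "A \<in> carrier_mat m n" "B \<in> carrier_mat m n" "C \<in> carrier_mat m n" "D \<in> carrier_mat m n"
  shows "(A + B) + (C + D) = (A + C) + (B + D)"
  using assms by (intro eq_matI) auto

lemma ksum_add:
  assumes "\<And>a. a \<in> set xs \<Longrightarrow> G a \<in> carrier_mat (d a) (d a)" "\<And>a. a \<in> set xs \<Longrightarrow> H a \<in> carrier_mat (d a) (d a)"
  shows "ksum d (\<lambda>a. G a + H a) xs = ksum d G xs + ksum d H xs"
  using assms
proof (induction xs)
  case (Cons a xs)
  have "ksum d G xs \<in> carrier_mat (pdim d xs) (pdim d xs)" "ksum d H xs \<in> carrier_mat (pdim d xs) (pdim d xs)"
    using Cons.prems by (auto intro!: ksum_carrier)
  then show ?case
    using Cons by (simp add: kron_add_left[of _ "d a" "d a"] kron_add_right[of _ "pdim d xs" "pdim d xs"])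
      (rule mat_add_ac4[where m = "d a * pdim d xs" and n = "d a * pdim d xs"], auto)
qed (auto intro!: eq_matI)

lemma ksum_smult:
  assumes "\<And>a. a \<in> set xs \<Longrightarrow> G a \<in> carrier_mat (d a) (d a)"
  shows "ksum d (\<lambda>a. c \<cdot>\<^sub>m G a) xs = c \<cdot>\<^sub>m ksum d G xs"
  using assms
proof (induction xs)
  case (Cons a xs)
  have "ksum d G xs \<in> carrier_mat (pdim d xs) (pdim d xs)"
    using Cons.prems by (auto intro!: ksum_carrier)
  then show ?case
    using Cons by (simp add: kron_smult_left kron_smult_right add_smult_distrib_left_mat[of _ "d a * pdim d xs" "d a * pdim d xs"])
qed (auto intro!: eq_matI)

text \<open>Scalar parts enter only through their sum. This is the redundancy of the factorization,
  seen on generators.\<close>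

lemma ksum_scalar: "ksum d (\<lambda>a. c a \<cdot>\<^sub>m 1\<^sub>m (d a)) xs = (\<Sum>a\<leftarrow>xs. c a) \<cdot>\<^sub>m 1\<^sub>m (pdim d xs)"
  by (induction xs) (auto simp: kron_smult_left kron_smult_right kron_one add_smult_distrib_right_mat intro!: eq_matI)

lemma tr_ksum:
  assumes "\<And>a. a \<in> set xs \<Longrightarrow> G a \<in> carrier_mat (d a) (d a)" "\<And>a. a \<in> set xs \<Longrightarrow> 0 < d a"
  shows "tr (ksum d G xs) / pdim d xs = (\<Sum>a\<leftarrow>xs. tr (G a) / d a)"
  using assms
proof (induction xs)
  case (Cons a xs)
  have c: "ksum d G xs \<in> carrier_mat (pdim d xs) (pdim d xs)" "G a \<in> carrier_mat (d a) (d a)"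
    using Cons.prems by (auto intro!: ksum_carrier)
  have "0 < pdim d xs" "0 < d a" using Cons.prems by (induction xs) auto
  then have "(tr (G a) * pdim d xs + d a * tr (ksum d G xs)) / (real (d a) * real (pdim d xs)) =
    tr (G a) / d a + tr (ksum d G xs) / pdim d xs"
    by (simp add: add_divide_distrib del: prod_list_zero_iff)
  then show ?case
    using Cons.prems c Cons.IH
    by (simp add: tr_add[of _ "d a * pdim d xs"] tr_kron[where m = "d a" and n = "pdim d xs"] tr_one)
qed (simp add: tr_def)

text \<open>For diagonal blocks this is a second moment: an eigenvalue at a uniformly random index
  is a sum of independent terms, so its second moment is the sum of the variances plus the square of
  the sum of the means.\<close>

lemma frob2_ksum:
  assumes "\<And>a. a \<in> set xs \<Longrightarrow> G a \<in> carrier_mat (d a) (d a)" "\<And>a. a \<in> set xs \<Longrightarrow> 0 < d a"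
  shows "frob2 (ksum d G xs) / pdim d xs =
    (\<Sum>a\<leftarrow>xs. frob2 (G a) / d a - (tr (G a) / d a)\<^sup>2) + (\<Sum>a\<leftarrow>xs. tr (G a) / d a)\<^sup>2"
  using assms
proof (induction xs)
  case (Cons a xs)
  let ?P = "pdim d xs"
  have c: "ksum d G xs \<in> carrier_mat ?P ?P" "G a \<in> carrier_mat (d a) (d a)"
    using Cons.prems by (auto intro!: ksum_carrier)
  have P: "0 < pdim d xs" using Cons.prems by (induction xs) auto
  have da: "0 < d a" using Cons.prems by auto
  have "frob2 (ksum d G (a # xs)) / pdim d (a # xs) =
    (?P * frob2 (G a) + d a * frob2 (ksum d G xs) + 2 * tr (G a) * tr (ksum d G xs)) / (real (d a) * ?P)"
    by (simp add: frob2_kron_sum[OF c(2,1)])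
  also have "\<dots> = frob2 (G a) / d a + frob2 (ksum d G xs) / ?P + 2 * (tr (G a) / d a) * (tr (ksum d G xs) / ?P)"
    using P da by (simp add: add_divide_distrib del: prod_list_zero_iff)
  also have "\<dots> = (\<Sum>a\<leftarrow>a # xs. frob2 (G a) / d a - (tr (G a) / d a)\<^sup>2) + (\<Sum>a\<leftarrow>a # xs. tr (G a) / d a)\<^sup>2"
    using Cons by (simp add: tr_ksum power2_eq_square algebra_simps)
  finally show ?case .
qed (simp add: frob2_def)

section \<open>Euclidean norm and bounds on operator norms\<close>

definition nrm :: "real vec \<Rightarrow> real" where
  "nrm v = L2_set (\<lambda>i. v $ i) {..<dim_vec v}"

lemma nrm_nonneg [simp]: "0 \<le> nrm v"
  by (simp add: nrm_def)

lemma nrm_sq: "(nrm v)\<^sup>2 = v \<bullet> v"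
  by (simp add: nrm_def L2_set_def scalar_prod_def power2_eq_square atLeast0LessThan sum_nonneg)

lemma nrm_sq_sum: "v \<in> carrier_vec n \<Longrightarrow> (nrm v)\<^sup>2 = (\<Sum>i<n. (v $ i)\<^sup>2)"
  by (auto simp: nrm_def L2_set_def sum_nonneg)

lemma nrm_triangle: "v \<in> carrier_vec n \<Longrightarrow> w \<in> carrier_vec n \<Longrightarrow> nrm (v + w) \<le> nrm v + nrm w"
  using L2_set_triangle_ineq[of "\<lambda>i. v $ i" "\<lambda>i. w $ i" "{..<n}"]
  by (auto simp: nrm_def L2_set_def)

lemma nrm_smult: "nrm (c \<cdot>\<^sub>v v) = \<bar>c\<bar> * nrm v"
  by (rule power2_eq_imp_eq) (auto simp: power_mult_distrib nrm_sq_sum[where n = "dim_vec v"] sum_distrib_left)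

text \<open>An upper bound on the operator norm, as a relation, so that no supremum has to be
  handled.\<close>

definition opb :: "nat \<Rightarrow> real mat \<Rightarrow> real \<Rightarrow> bool" where
  "opb n A b \<longleftrightarrow> (\<forall>v \<in> carrier_vec n. nrm (A *\<^sub>v v) \<le> b * nrm v)"

lemma opb_add:
  assumes "A \<in> carrier_mat n n" "B \<in> carrier_mat n n" "opb n A a" "opb n B b"
  shows "opb n (A + B) (a + b)"
  unfolding opb_def
proof
  fix v :: "real vec" assume v: "v \<in> carrier_vec n"
  have "nrm ((A + B) *\<^sub>v v) \<le> nrm (A *\<^sub>v v) + nrm (B *\<^sub>v v)"
    using v assms by (simp add: add_mult_distrib_mat_vec[of _ n n] nrm_triangle[of _ n])
  also have "\<dots> \<le> (a + b) * nrm v" using assms v by (auto simp: opb_def distrib_right intro: add_mono)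
  finally show "nrm ((A + B) *\<^sub>v v) \<le> (a + b) * nrm v" .
qed

lemma opb_scalar: "opb n (c \<cdot>\<^sub>m 1\<^sub>m n) \<bar>c\<bar>"
  unfolding opb_def
proof
  fix v :: "real vec" assume v: "v \<in> carrier_vec n"
  have "(c \<cdot>\<^sub>m 1\<^sub>m n) *\<^sub>v v = c \<cdot>\<^sub>v v" using v by (intro eq_vecI) auto
  then show "nrm ((c \<cdot>\<^sub>m 1\<^sub>m n) *\<^sub>v v) \<le> \<bar>c\<bar> * nrm v" by (simp add: nrm_smult)
qed

lemma opb_frob:
  assumes A: "A \<in> carrier_mat n n"
  shows "opb n A (sqrt (frob2 A))"
  unfolding opb_def
proof
  fix v :: "real vec" assume v: "v \<in> carrier_vec n"
  have "(nrm (A *\<^sub>v v))\<^sup>2 = (\<Sum>i<n. (\<Sum>j<n. A $$ (i, j) * v $ j)\<^sup>2)"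
    using A v by (subst nrm_sq_sum[of _ n]) (auto simp: scalar_prod_def atLeast0LessThan)
  also have "\<dots> \<le> (\<Sum>i<n. (\<Sum>j<n. (A $$ (i, j))\<^sup>2) * (\<Sum>j<n. (v $ j)\<^sup>2))"
    by (intro sum_mono Cauchy_Schwarz_ineq_sum)
  also have "\<dots> = (sqrt (frob2 A) * nrm v)\<^sup>2"
    using A v by (simp add: power_mult_distrib nrm_sq_sum[of v n] sum_distrib_right frob2_def sum_nonneg)
  finally show "nrm (A *\<^sub>v v) \<le> sqrt (frob2 A) * nrm v" by (rule power2_le_imp_le) auto
qed

lemma opb_sq:
  assumes "opb n A b" "0 \<le> b" "A \<in> carrier_mat n n"
  shows "(\<Sum>i<n. (\<Sum>j<n. A $$ (i, j) * f j)\<^sup>2) \<le> b\<^sup>2 * (\<Sum>j<n. (f j)\<^sup>2)"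
proof -
  let ?v = "vec n f"
  have "nrm (A *\<^sub>v ?v) \<le> b * nrm ?v" using assms by (auto simp: opb_def)
  then have "(nrm (A *\<^sub>v ?v))\<^sup>2 \<le> (b * nrm ?v)\<^sup>2" by (intro power_mono) auto
  then show ?thesis using assms(3)
    by (simp add: nrm_sq_sum[of _ n] power_mult_distrib scalar_prod_def atLeast0LessThan)
qed

lemma mult_add_less:
  fixes i j m n :: nat
  assumes "i < m" "j < n"
  shows "i * n + j < m * n"
proof -
  have "i * n + j < Suc i * n" using assms by simp
  also have "\<dots> \<le> m * n" using assms by (intro mult_right_mono) auto
  finally show ?thesis .
qed

lemma kron_mult_vec:
  assumes "A \<in> carrier_mat m m" "B \<in> carrier_mat n n" "v \<in> carrier_vec (m * n)" "i < m" "k < n"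
  shows "(kron A B *\<^sub>v v) $ (i * n + k) = (\<Sum>j<m. \<Sum>l<n. A $$ (i, j) * B $$ (k, l) * v $ (j * n + l))"
proof -
  have ik: "i * n + k < m * n" using assms(4,5) by (rule mult_add_less)
  have "(kron A B *\<^sub>v v) $ (i * n + k) = (\<Sum>j<m * n. A $$ (i, j div n) * B $$ (k, j mod n) * v $ ((j div n) * n + j mod n))"
    using assms ik by (simp add: scalar_prod_def atLeast0LessThan kron_def)
  then show ?thesis using sum_div_mod[where f = "\<lambda>j l. A $$ (i, j) * B $$ (k, l) * v $ (j * n + l)" and m = m and n = n]
    by simp
qed

lemma nrm_sq_double:
  assumes "v \<in> carrier_vec (m * n)"
  shows "(nrm v)\<^sup>2 = (\<Sum>i<m. \<Sum>k<n. (v $ (i * n + k))\<^sup>2)"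
  using sum_div_mod[where f = "\<lambda>i k. (v $ (i * n + k))\<^sup>2" and m = m and n = n] assms
  by (simp add: nrm_sq_sum)

text \<open>The matrix acts separately on the \<open>n\<close> slices of \<open>v\<close> formed by
  the indices \<open>j * n + k\<close> with fixed \<open>k\<close>, so the squared bounds of the
  slices add up.\<close>

lemma opb_kron_left:
  assumes A: "A \<in> carrier_mat m m" and b: "opb m A b" "0 \<le> b"
  shows "opb (m * n) (kron A (1\<^sub>m n)) b"
  unfolding opb_def
proof
  fix v :: "real vec" assume v: "v \<in> carrier_vec (m * n)"
  have c: "kron A (1\<^sub>m n) *\<^sub>v v \<in> carrier_vec (m * n)" using A by (auto intro!: mult_mat_vec_carrier[where n = "m * n"] v)
  have "(nrm (kron A (1\<^sub>m n) *\<^sub>v v))\<^sup>2 = (\<Sum>i<m. \<Sum>k<n. (\<Sum>j<m. A $$ (i, j) * v $ (j * n + k))\<^sup>2)"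
    unfolding nrm_sq_double[OF c]
  proof (intro sum.cong refl)
    fix i k assume ik: "i \<in> {..<m}" "k \<in> {..<n}"
    have "(\<Sum>l<n. A $$ (i, j) * 1\<^sub>m n $$ (k, l) * v $ (j * n + l)) = A $$ (i, j) * v $ (j * n + k)" for j
      using ik by (simp add: mult.assoc sum_distrib_left[symmetric] sum_delta_mult)
    then show "((kron A (1\<^sub>m n) *\<^sub>v v) $ (i * n + k))\<^sup>2 = (\<Sum>j<m. A $$ (i, j) * v $ (j * n + k))\<^sup>2"
      using ik kron_mult_vec[OF A one_carrier_mat v, of i k] by simp
  qed
  also have "\<dots> = (\<Sum>k<n. \<Sum>i<m. (\<Sum>j<m. A $$ (i, j) * v $ (j * n + k))\<^sup>2)" by (rule sum.swap)
  also have "\<dots> \<le> (\<Sum>k<n. b\<^sup>2 * (\<Sum>j<m. (v $ (j * n + k))\<^sup>2))"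
    by (intro sum_mono opb_sq b A)
  also have "\<dots> = (b * nrm v)\<^sup>2"
    unfolding power_mult_distrib nrm_sq_double[OF v] sum_distrib_left[symmetric] by (subst sum.swap) simp
  finally show "nrm (kron A (1\<^sub>m n) *\<^sub>v v) \<le> b * nrm v" by (rule power2_le_imp_le) (use b in auto)
qed

lemma opb_kron_right:
  assumes B: "B \<in> carrier_mat n n" and b: "opb n B b" "0 \<le> b"
  shows "opb (m * n) (kron (1\<^sub>m m) B) b"
  unfolding opb_def
proof
  fix v :: "real vec" assume v: "v \<in> carrier_vec (m * n)"
  have c: "kron (1\<^sub>m m) B *\<^sub>v v \<in> carrier_vec (m * n)" using B by (auto intro!: mult_mat_vec_carrier[where n = "m * n"] v)
  have "(nrm (kron (1\<^sub>m m) B *\<^sub>v v))\<^sup>2 = (\<Sum>i<m. \<Sum>k<n. (\<Sum>l<n. B $$ (k, l) * v $ (i * n + l))\<^sup>2)"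
    unfolding nrm_sq_double[OF c]
  proof (intro sum.cong refl)
    fix i k assume ik: "i \<in> {..<m}" "k \<in> {..<n}"
    have "(\<Sum>j<m. \<Sum>l<n. 1\<^sub>m m $$ (i, j) * B $$ (k, l) * v $ (j * n + l)) = (\<Sum>l<n. B $$ (k, l) * v $ (i * n + l))"
      using ik by (simp add: mult.assoc sum_distrib_left[symmetric] sum_delta_mult)
    then show "((kron (1\<^sub>m m) B *\<^sub>v v) $ (i * n + k))\<^sup>2 = (\<Sum>l<n. B $$ (k, l) * v $ (i * n + l))\<^sup>2"
      using ik kron_mult_vec[OF one_carrier_mat B v, of i k] by simp
  qed
  also have "\<dots> \<le> (\<Sum>i<m. b\<^sup>2 * (\<Sum>l<n. (v $ (i * n + l))\<^sup>2))"
    by (intro sum_mono opb_sq b B)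
  also have "\<dots> = (b * nrm v)\<^sup>2"
    unfolding power_mult_distrib nrm_sq_double[OF v] sum_distrib_left[symmetric] by simp
  finally show "nrm (kron (1\<^sub>m m) B *\<^sub>v v) \<le> b * nrm v" by (rule power2_le_imp_le) (use b in auto)
qed

lemma opb_ksum:
  assumes "\<And>a. a \<in> set xs \<Longrightarrow> G a \<in> carrier_mat (d a) (d a)" "\<And>a. a \<in> set xs \<Longrightarrow> opb (d a) (G a) (b a)"
    "\<And>a. a \<in> set xs \<Longrightarrow> 0 \<le> b a"
  shows "opb (pdim d xs) (ksum d G xs) (\<Sum>a\<leftarrow>xs. b a)"
  using assms
proof (induction xs)
  case Nil
  show ?case by (auto simp: opb_def nrm_def scalar_prod_def L2_set_def)
next
  case (Cons a xs)
  have c: "ksum d G xs \<in> carrier_mat (pdim d xs) (pdim d xs)" "G a \<in> carrier_mat (d a) (d a)"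
    using Cons.prems by (auto intro!: ksum_carrier)
  have "0 \<le> (\<Sum>a\<leftarrow>xs. b a)" using Cons.prems by (auto intro!: sum_list_nonneg)
  then have "opb (d a * pdim d xs) (kron (G a) (1\<^sub>m (pdim d xs))) (b a)"
    "opb (d a * pdim d xs) (kron (1\<^sub>m (d a)) (ksum d G xs)) (\<Sum>a\<leftarrow>xs. b a)"
    using c Cons by (auto intro!: opb_kron_left opb_kron_right)
  then show ?case using c by (auto intro!: opb_add)
qed

section \<open>Positive definite matrices in spectral form\<close>

abbreviation spec :: "nat \<Rightarrow> real mat \<Rightarrow> (nat \<Rightarrow> real) \<Rightarrow> real mat" where
  "spec n U l \<equiv> U * mat_diag n l * transpose_mat U"

lemma spec_carrier [simp]: "orth_mat n U \<Longrightarrow> spec n U l \<in> carrier_mat n n"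
  using orth_mat_carrier[of n U] square_mult_carrier[of "U * mat_diag n l" n "transpose_mat U"] square_mult_carrier[of U n "mat_diag n l"]
  by (metis mat_diag_dim transpose_carrier_mat)

lemma spec_transpose: "orth_mat n U \<Longrightarrow> transpose_mat (spec n U l) = spec n U l"
proof -
  assume o: "orth_mat n U"
  have "transpose_mat (mat_diag n l) = mat_diag n l" by (rule eq_matI) (auto simp: mat_diag_def)
  then show ?thesis using o
    by (simp add: square_transpose[where n = n] square_assoc[where n = n])
qed

lemma spec_mult:
  assumes o: "orth_mat n U"
  shows "spec n U l * spec n U m = spec n U (\<lambda>i. l i * m i)"
proof -
  have c: "U \<in> carrier_mat n n" "transpose_mat U \<in> carrier_mat n n" using o by auto
  have "spec n U l * spec n U m = U * mat_diag n l * (transpose_mat U * (U * (mat_diag n m * transpose_mat U)))"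
    using c by (simp add: square_assoc[where n = n])
  also have "\<dots> = U * mat_diag n l * (mat_diag n m * transpose_mat U)"
    using c o by (subst orth_mat_cancel_left[where n = n and m = n]) auto
  also have "\<dots> = U * (mat_diag n l * mat_diag n m) * transpose_mat U"
    using c by (simp add: square_assoc[where n = n] del: mat_diag_diag)
  finally show ?thesis by simp
qed

lemma spec_one: "orth_mat n U \<Longrightarrow> spec n U (\<lambda>_. 1) = 1\<^sub>m n"
  using orth_mat_right[of n U] orth_mat_carrier[of n U] by (simp add: right_mult_one_mat[of U n n])

lemma det_orth_sq:
  assumes "orth_mat n U"
  shows "det U * det U = 1"
proof -
  have c: "U \<in> carrier_mat n n" using assms by auto
  have "det (transpose_mat U * U) = det U * det U"
    using c by (simp add: det_mult[of _ n] det_transpose[of _ n])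
  then show ?thesis using orth_mat_left[OF assms] by simp
qed

lemma det_mat_diag: "det (mat_diag n l) = (\<Prod>i<n. l i :: real)"
  by (subst det_upper_triangular[where n = n]) (auto simp: mat_diag_def upper_triangular_def prod_list_diag_prod atLeast0LessThan)

lemma det_spec:
  assumes "orth_mat n U"
  shows "det (spec n U l) = (\<Prod>i<n. l i)"
proof -
  have c: "U \<in> carrier_mat n n" "transpose_mat U \<in> carrier_mat n n" using assms by auto
  have "det (spec n U l) = (det U * det U) * det (mat_diag n l)"
    using c by (simp add: det_mult[of _ n] det_transpose[of _ n])
  then show ?thesis by (simp add: det_mat_diag det_orth_sq[OF assms])
qed

lemma det_spec_exp: "orth_mat n U \<Longrightarrow> det (spec n U (\<lambda>i. exp (l i))) = exp (\<Sum>i<n. l i)"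
  by (simp add: det_spec exp_sum)

lemma tr_spec: "orth_mat n U \<Longrightarrow> tr (spec n U l) = (\<Sum>i<n. l i)"
  by (simp add: tr_orth_conj tr_diag)

lemma frob2_spec: "orth_mat n U \<Longrightarrow> frob2 (spec n U l) = (\<Sum>i<n. (l i)\<^sup>2)"
  by (simp add: frob2_orth_conj frob2_diag)

lemma scalar_prod_transpose:
  fixes A :: "real mat"
  assumes "A \<in> carrier_mat n m" "v \<in> carrier_vec n" "w \<in> carrier_vec m"
  shows "v \<bullet> (A *\<^sub>v w) = (transpose_mat A *\<^sub>v v) \<bullet> w"
proof -
  have "v \<bullet> (A *\<^sub>v w) = (\<Sum>i<n. \<Sum>j<m. v $ i * A $$ (i, j) * w $ j)"
    using assms by (auto simp: scalar_prod_def atLeast0LessThan sum_distrib_left mult.assoc)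
  also have "\<dots> = (\<Sum>j<m. \<Sum>i<n. v $ i * A $$ (i, j) * w $ j)" by (rule sum.swap)
  also have "\<dots> = (transpose_mat A *\<^sub>v v) \<bullet> w"
    using assms by (auto simp: scalar_prod_def atLeast0LessThan sum_distrib_left mult_ac)
  finally show ?thesis .
qed

lemma quad_spec:
  assumes o: "orth_mat n U" and v: "v \<in> carrier_vec n"
  shows "v \<bullet> (spec n U l *\<^sub>v v) = (\<Sum>i<n. l i * ((transpose_mat U *\<^sub>v v) $ i)\<^sup>2)"
proof -
  have c: "U \<in> carrier_mat n n" "transpose_mat U \<in> carrier_mat n n" using o by auto
  define w where "w = transpose_mat U *\<^sub>v v"
  have w: "w \<in> carrier_vec n" using c v by (auto simp: w_def)
  have "spec n U l *\<^sub>v v = U *\<^sub>v (mat_diag n l *\<^sub>v w)"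
    unfolding w_def using c v by (simp add: assoc_mult_mat_vec[of _ n n _ n])
  then have "v \<bullet> (spec n U l *\<^sub>v v) = w \<bullet> (mat_diag n l *\<^sub>v w)"
    using scalar_prod_transpose[OF c(1) v, of "mat_diag n l *\<^sub>v w"] w
    by (simp add: w_def mult_mat_vec_carrier[where n = n and nr = n])
  also have "\<dots> = (\<Sum>i<n. w $ i * (\<Sum>j<n. (if i = j then 1 else 0) * (l j * w $ j)))"
    using w by (auto simp: scalar_prod_def atLeast0LessThan mat_diag_def intro!: sum.cong)
  also have "\<dots> = (\<Sum>i<n. l i * (w $ i)\<^sup>2)"
    by (intro sum.cong refl) (simp add: sum_delta_mult power2_eq_square)
  finally show ?thesis by (simp add: w_def)
qed

lemma orth_nrm:
  assumes o: "orth_mat n U" and v: "v \<in> carrier_vec n"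
  shows "(\<Sum>i<n. ((transpose_mat U *\<^sub>v v) $ i)\<^sup>2) = (nrm v)\<^sup>2"
  using quad_spec[OF assms, of "\<lambda>_. 1"] v spec_one[OF o] by (simp add: nrm_sq)

lemma orth_transpose_mult_ne:
  assumes o: "orth_mat n U" and v: "v \<in> carrier_vec n" "v \<noteq> 0\<^sub>v n"
  shows "\<exists>i<n. (transpose_mat U *\<^sub>v v) $ i \<noteq> 0"
proof (rule ccontr)
  assume "\<not> ?thesis"
  then have "(nrm v)\<^sup>2 = 0" using orth_nrm[OF o v(1)] by simp
  then show False using scalar_prod_self_pos[OF v] by (simp add: nrm_sq)
qed

lemma mult_mat_vec_closed [simp]:
  "A \<in> carrier_mat n n \<Longrightarrow> v \<in> carrier_vec n \<Longrightarrow> A *\<^sub>v v \<in> carrier_vec n"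
  by (rule mult_mat_vec_carrier)

text \<open>Column \<open>j\<close> of \<open>W\<close> is the witness. It does not depend on
  \<open>\<mu>\<close>, so a bound on a quadratic form becomes a bound on eigenvalues.\<close>

lemma spec_quad_eigenvector:
  assumes W: "orth_mat n W" and j: "j < n"
  obtains v where "v \<in> carrier_vec n" "v \<bullet> v = 1" "\<And>\<mu>. v \<bullet> (spec n W \<mu> *\<^sub>v v) = \<mu> j"
proof
  let ?v = "W *\<^sub>v unit_vec n j"
  have c: "W \<in> carrier_mat n n" "transpose_mat W \<in> carrier_mat n n" using W by auto
  show v: "?v \<in> carrier_vec n" using c by simp
  have "transpose_mat W *\<^sub>v ?v = (transpose_mat W * W) *\<^sub>v unit_vec n j"
    by (rule assoc_mult_mat_vec[symmetric, of _ n n _ n]) (use c in auto)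
  then have w: "transpose_mat W *\<^sub>v ?v = unit_vec n j" using orth_mat_left[OF W] by simp
  have sq: "(unit_vec n j $ i)\<^sup>2 = (if i = j then 1 else 0 :: real)" if "i < n" for i
    using that j by (simp add: unit_vec_def)
  show quad: "?v \<bullet> (spec n W \<mu> *\<^sub>v ?v) = \<mu> j" for \<mu>
  proof -
    have "?v \<bullet> (spec n W \<mu> *\<^sub>v ?v) = (\<Sum>i<n. if i = j then \<mu> j else 0)"
      unfolding quad_spec[OF W v] w by (intro sum.cong refl) (simp add: sq)
    then show ?thesis using j by simp
  qed
  show "?v \<bullet> ?v = 1" using quad[of "\<lambda>_. 1"] v unfolding spec_one[OF W] by simp
qed

lemma nrm_spec:
  assumes W: "orth_mat n W" and v: "v \<in> carrier_vec n"
  shows "(nrm (spec n W l *\<^sub>v v))\<^sup>2 = v \<bullet> (spec n W (\<lambda>j. (l j)\<^sup>2) *\<^sub>v v)"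
  using scalar_prod_transpose[OF spec_carrier[OF W, of l] v, of "spec n W l *\<^sub>v v"] v spec_carrier[OF W, of l]
  unfolding spec_transpose[OF W] nrm_sq
  by (simp add: assoc_mult_mat_vec[of _ n n _ n, symmetric] spec_mult[OF W] power2_eq_square)

lemma PD_spec:
  assumes o: "orth_mat n U"
  shows "spec n U (\<lambda>i. exp (l i)) \<in> PD n"
  unfolding PD_def
proof (intro CollectI conjI ballI impI)
  fix v :: "real vec" assume v: "v \<in> carrier_vec n" "v \<noteq> 0\<^sub>v n"
  obtain i where "i < n" "(transpose_mat U *\<^sub>v v) $ i \<noteq> 0" using orth_transpose_mult_ne[OF o v] by blast
  then show "0 < v \<bullet> (spec n U (\<lambda>i. exp (l i)) *\<^sub>v v)"
    unfolding quad_spec[OF o v(1)] by (intro sum_pos2[where i = i]) auto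
qed (use o spec_transpose in auto)

text \<open>Eigenvalues are written as exponentials, which makes their logarithms unconstrained real
  coordinates and the natural ones for the Fisher-Rao distance.\<close>

lemma PD_spectral:
  assumes "A \<in> PD n"
  obtains U l where "orth_mat n U" "A = spec n U (\<lambda>i. exp (l i))"
proof -
  obtain U m where U: "orth_mat n U" "A = spec n U m"
    using assms by (auto simp: PD_def elim: spectral_theorem[of A n])
  have "0 < m i" if i: "i < n" for i
  proof -
    obtain v where v: "v \<in> carrier_vec n" "v \<bullet> v = 1" "v \<bullet> (A *\<^sub>v v) = m i"
      using spec_quad_eigenvector[OF U(1) i] unfolding U(2) by metis
    have "v \<noteq> 0\<^sub>v n" using v(2) by auto
    then show ?thesis using assms v by (auto simp: PD_def)
  qed
  then have "mat_diag n m = mat_diag n (\<lambda>i. exp (ln (m i)))"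
    by (intro eq_matI) (auto simp: mat_diag_def)
  then show ?thesis using that[OF U(1), of "\<lambda>i. ln (m i)"] U(2) by simp
qed

lemma PD_carrier: "A \<in> PD n \<Longrightarrow> A \<in> carrier_mat n n"
  by (simp add: PD_def)

lemma PD_det_pos: "A \<in> PD n \<Longrightarrow> 0 < det A"
  by (erule PD_spectral) (simp add: det_spec_exp)

lemma PD_congruence:
  assumes K: "K \<in> PD n" and B: "B \<in> carrier_mat n n" "C \<in> carrier_mat n n" "C * B = 1\<^sub>m n"
  shows "transpose_mat B * K * B \<in> PD n"
  unfolding PD_def
proof (intro CollectI conjI ballI impI)
  have Kc: "K \<in> carrier_mat n n" "transpose_mat K = K" using K by (auto simp: PD_def)
  show "transpose_mat B * K * B \<in> carrier_mat n n" using Kc B by auto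
  show "transpose_mat (transpose_mat B * K * B) = transpose_mat B * K * B"
    using Kc B by (simp add: square_transpose[where n = n] square_assoc[where n = n])
  fix v :: "real vec" assume v: "v \<in> carrier_vec n" "v \<noteq> 0\<^sub>v n"
  have w: "B *\<^sub>v v \<in> carrier_vec n" using B v by (auto intro!: mult_mat_vec_carrier[where n = n])
  have "C *\<^sub>v (B *\<^sub>v v) = v"
    using assoc_mult_mat_vec[OF B(2,1) v(1)] B v by simp
  then have "B *\<^sub>v v \<noteq> 0\<^sub>v n"
    using v B(2) by (auto intro!: eq_vecI)
  then have "0 < (B *\<^sub>v v) \<bullet> (K *\<^sub>v (B *\<^sub>v v))" using K w by (auto simp: PD_def)
  also have "\<dots> = v \<bullet> (transpose_mat B * K * B *\<^sub>v v)"
    using scalar_prod_transpose[of "transpose_mat B" n n v "K *\<^sub>v (B *\<^sub>v v)"] Kc B v w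
    by (simp add: assoc_mult_mat_vec[of _ n n _ n] square_assoc[where n = n] mult_mat_vec_carrier[where n = n and nr = n])
  finally show "0 < v \<bullet> (transpose_mat B * K * B *\<^sub>v v)" .
qed

text \<open>Here \<open>R\<close> is the inverse square root of the second argument. The distance
  sees only the logarithmic eigenvalues \<open>m\<close> after whitening by \<open>R\<close>, so
  bounds on them are bounds on the distance.\<close>

lemma fisher_rao_spec:
  assumes U: "orth_mat n U" and W: "orth_mat n W"
    and R: "R = spec n U (\<lambda>i. exp (- l i / 2))" and RAR: "R * A * R = spec n W (\<lambda>i. exp (m i))"
  shows "fisher_rao A (spec n U (\<lambda>i. exp (l i))) = 1 / sqrt 2 * sqrt (\<Sum>i<n. (m i)\<^sup>2)"
proof -
  have "spectral_fun (\<lambda>x. x powr (- 1 / 2)) (spec n U (\<lambda>i. exp (l i))) = spec n U (\<lambda>i. exp (l i) powr (- 1 / 2))"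
    by (rule spectral_fun_eq) (use U in \<open>auto simp: orth_mat_def\<close>)
  also have "\<dots> = R" unfolding R by (simp add: powr_def)
  finally have 1: "spectral_fun (\<lambda>x. x powr (- 1 / 2)) (spec n U (\<lambda>i. exp (l i))) = R" .
  have 2: "spectral_fun ln (R * A * R) = spec n W (\<lambda>i. ln (exp (m i)))"
    by (rule spectral_fun_eq) (use W RAR in \<open>auto simp: orth_mat_def\<close>)
  show ?thesis unfolding fisher_rao_def Let_def 1 2 frobenius_norm_frob2
    by (simp add: frob2_spec[OF W])
qed

lemma inv_mat_eq:
  assumes A: "A \<in> carrier_mat n n" and B: "B \<in> carrier_mat n n" "A * B = 1\<^sub>m n"
  shows "inv_mat A = B"
proof (cases "mat_inverse A")
  case None
  have "B * A = 1\<^sub>m n" using mat_mult_left_right_inverse[OF A B] .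
  then have "A \<in> Units (ring_mat TYPE(real) n ())"
    using A B by (auto simp: Units_def ring_mat_def intro!: bexI[of _ B])
  then show ?thesis using mat_inverse(1)[OF A None, of "()"] by simp
next
  case (Some C)
  then have C: "C * A = 1\<^sub>m n" "C \<in> carrier_mat n n" using mat_inverse(2)[OF A] by auto
  have "C = C * (A * B)" using B C by simp
  also have "\<dots> = (C * A) * B" by (rule assoc_mult_mat[symmetric, OF C(2) A B(1)])
  finally have "C = B" using C B by simp
  then show ?thesis using Some by (simp add: inv_mat_def)
qed

lemma inv_mat_spec:
  assumes "orth_mat n U"
  shows "inv_mat (spec n U (\<lambda>i. exp (l i))) = spec n U (\<lambda>i. exp (- l i))"
  by (rule inv_mat_eq[where n = n]) (use assms spec_one[OF assms] in \<open>simp_all add: spec_mult exp_minus\<close>)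

section \<open>Gaussian integrals and quadratic forms\<close>

lemma quad_sum_measurable:
  fixes D d :: nat
  assumes "D \<le> d"
  shows "(\<lambda>x. \<Sum>i<D. \<Sum>j<D. A i j * x i * x j) \<in> borel_measurable (PiM {..<d} (\<lambda>_. lborel :: real measure))"
proof -
  have "(\<lambda>x. x i) \<in> borel_measurable (PiM {..<d} (\<lambda>_. lborel :: real measure))" if "i < D" for i
    using that assms by (subst measurable_lborel1[symmetric], intro measurable_component_singleton) auto
  then show ?thesis by (intro borel_measurable_sum borel_measurable_times) auto
qed

lemma nn_integral_gaussian_1d:
  assumes "0 < \<alpha>"
  shows "(\<integral>\<^sup>+y. ennreal (exp (- \<alpha> * (y - m)\<^sup>2 / 2)) \<partial>lborel) = ennreal (sqrt (2 * pi / \<alpha>))"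
proof -
  define \<sigma> where "\<sigma> = 1 / sqrt \<alpha>"
  have s: "0 < \<sigma>" "2 * pi * \<sigma>\<^sup>2 = 2 * pi / \<alpha>" using assms by (auto simp: \<sigma>_def power_divide)
  have "- (y - m)\<^sup>2 / (2 * \<sigma>\<^sup>2) = - \<alpha> * (y - m)\<^sup>2 / 2" for y
    using assms by (simp add: \<sigma>_def power_divide field_simps)
  then have "exp (- \<alpha> * (y - m)\<^sup>2 / 2) = sqrt (2 * pi / \<alpha>) * normal_density m \<sigma> y" for y
    using assms unfolding normal_density_def s(2) by simp
  then have "(\<integral>\<^sup>+y. ennreal (exp (- \<alpha> * (y - m)\<^sup>2 / 2)) \<partial>lborel) =
    (\<integral>\<^sup>+y. ennreal (sqrt (2 * pi / \<alpha>)) * ennreal (normal_density m \<sigma> y) \<partial>lborel)"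
    using assms by (simp add: ennreal_mult normal_density_nonneg)
  also have "\<dots> = ennreal (sqrt (2 * pi / \<alpha>)) * (\<integral>\<^sup>+y. ennreal (normal_density m \<sigma> y) \<partial>lborel)"
    by (rule nn_integral_cmult) auto
  also have "(\<integral>\<^sup>+y. ennreal (normal_density m \<sigma> y) \<partial>lborel) = 1"
    using s by (subst nn_integral_eq_integral) (auto simp: normal_density_nonneg)
  finally show ?thesis by simp
qed

text \<open>Integrating out the last coordinate replaces the matrix by its Schur complement.\<close>

lemma nn_integral_gaussian_sum:
  fixes A :: "nat \<Rightarrow> nat \<Rightarrow> real"
  assumes sym: "\<And>i j. i < d \<Longrightarrow> j < d \<Longrightarrow> A i j = A j i"
    and pos: "\<And>x. \<exists>i<d. x i \<noteq> 0 \<Longrightarrow> 0 < (\<Sum>i<d. \<Sum>j<d. A i j * x i * x j)"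
  shows "0 < det (mat d d (\<lambda>(i, j). A i j)) \<and>
    (\<integral>\<^sup>+x. ennreal (exp (- (\<Sum>i<d. \<Sum>j<d. A i j * x i * x j) / 2)) \<partial>(PiM {..<d} (\<lambda>_. lborel)))
      = ennreal (sqrt ((2 * pi) ^ d / det (mat d d (\<lambda>(i, j). A i j))))"
  using assms
proof (induction d arbitrary: A)
  case 0
  interpret product_sigma_finite "\<lambda>_::nat. lborel :: real measure" by standard
  have "(\<integral>\<^sup>+x. 1 \<partial>(PiM {} (\<lambda>_::nat. lborel :: real measure))) = 1"
    using nn_integral_empty[of "\<lambda>_. 1"] by simp
  then show ?case by simp
next
  case (Suc d)
  interpret product_sigma_finite "\<lambda>_::nat. lborel :: real measure" by standard
  define \<alpha> where "\<alpha> = A d d"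
  define c where "c i = A i d" for i
  define B where "B i j = A i j - c i * c j / \<alpha>" for i j
  define s where "s x = (\<Sum>i<d. c i * x i)" for x :: "nat \<Rightarrow> real"
  have expand: "(\<Sum>i<Suc d. \<Sum>j<Suc d. A i j * x i * x j) =
    (\<Sum>i<d. \<Sum>j<d. A i j * x i * x j) + 2 * x d * s x + \<alpha> * (x d)\<^sup>2" for x
  proof -
    have "(\<Sum>j<d. A d j * x d * x j) = x d * s x"
      unfolding s_def sum_distrib_left c_def using Suc.prems(1) by (intro sum.cong) auto
    moreover have "(\<Sum>i<d. A i d * x i * x d) = x d * s x"
      unfolding s_def sum_distrib_left c_def by (intro sum.cong) auto
    ultimately show ?thesis by (simp add: sum.distrib \<alpha>_def power2_eq_square)
  qed
  have \<alpha>: "0 < \<alpha>"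
    using Suc.prems(2)[of "\<lambda>i. if i = d then 1 else 0"] unfolding expand by (simp add: s_def) 
  have Bq: "(\<Sum>i<d. \<Sum>j<d. B i j * x i * x j) = (\<Sum>i<d. \<Sum>j<d. A i j * x i * x j) - (s x)\<^sup>2 / \<alpha>" for x
  proof -
    have "(\<Sum>i<d. \<Sum>j<d. c i * c j / \<alpha> * x i * x j) = (s x)\<^sup>2 / \<alpha>"
      by (simp add: s_def power2_eq_square sum_product sum_divide_distrib mult_ac)
    then show ?thesis by (simp add: B_def left_diff_distrib sum_subtractf)
  qed
  have complete: "(\<Sum>i<Suc d. \<Sum>j<Suc d. A i j * x i * x j) =
    (\<Sum>i<d. \<Sum>j<d. B i j * x i * x j) + \<alpha> * (x d - (- s x / \<alpha>))\<^sup>2" for x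
    unfolding expand Bq using \<alpha> by (simp add: power2_eq_square field_simps)
  have upd: "(\<Sum>i<d. \<Sum>j<d. B i j * (x(d := y)) i * (x(d := y)) j) = (\<Sum>i<d. \<Sum>j<d. B i j * x i * x j)"
    "s (x(d := y)) = s x" for x y
    by (auto simp: s_def intro!: sum.cong)
  have IH: "0 < det (mat d d (\<lambda>(i, j). B i j)) \<and>
    (\<integral>\<^sup>+x. ennreal (exp (- (\<Sum>i<d. \<Sum>j<d. B i j * x i * x j) / 2)) \<partial>(PiM {..<d} (\<lambda>_. lborel)))
      = ennreal (sqrt ((2 * pi) ^ d / det (mat d d (\<lambda>(i, j). B i j))))"
  proof (rule Suc.IH)
    show "B i j = B j i" if "i < d" "j < d" for i j
      using that Suc.prems(1)[of i j] by (simp add: B_def)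
    fix x :: "nat \<Rightarrow> real" assume "\<exists>i<d. x i \<noteq> 0"
    then obtain i where "i < d" "x i \<noteq> 0" by blast
    \<comment> \<open>The last coordinate \<open>- s x / \<alpha>\<close> makes the completed square
      vanish, so positivity of the full form passes to the Schur complement
      \<open>B\<close>.\<close>
    then have "\<exists>i<Suc d. (x(d := - s x / \<alpha>)) i \<noteq> 0" by (intro exI[of _ i]) auto
    from Suc.prems(2)[OF this] show "0 < (\<Sum>i<d. \<Sum>j<d. B i j * x i * x j)"
      unfolding complete upd by simp
  qed
  \<comment> \<open>Block elimination: a unit upper triangular factor times a lower triangular one
    whose diagonal blocks are the Schur complement and \<open>\<alpha>\<close>.\<close>
  have det: "det (mat (Suc d) (Suc d) (\<lambda>(i, j). A i j)) = \<alpha> * det (mat d d (\<lambda>(i, j). B i j))"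
  proof -
    let ?B = "mat d d (\<lambda>(i, j). B i j)" and ?c = "mat 1 d (\<lambda>(i, j). c j)" and ?a = "mat 1 1 (\<lambda>_. \<alpha>)"
      and ?c' = "mat d 1 (\<lambda>(i, j). c i / \<alpha>)"
    have "mat (Suc d) (Suc d) (\<lambda>(i, j). A i j) =
      four_block_mat (1\<^sub>m d) ?c' (0\<^sub>m 1 d) (1\<^sub>m 1) * four_block_mat ?B (0\<^sub>m d 1) ?c ?a"
    proof (subst mult_four_block_mat[of _ d d _ 1 _ 1 _ _ d _ 1])
      show "mat (Suc d) (Suc d) (\<lambda>(i, j). A i j) =
        four_block_mat (1\<^sub>m d * ?B + ?c' * ?c) (1\<^sub>m d * 0\<^sub>m d 1 + ?c' * ?a)
          (0\<^sub>m 1 d * ?B + 1\<^sub>m 1 * ?c) (0\<^sub>m 1 d * 0\<^sub>m d 1 + 1\<^sub>m 1 * ?a)"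
      proof (rule eq_matI)
        fix i j assume "i < dim_row (four_block_mat (1\<^sub>m d * ?B + ?c' * ?c) (1\<^sub>m d * 0\<^sub>m d 1 + ?c' * ?a)
          (0\<^sub>m 1 d * ?B + 1\<^sub>m 1 * ?c) (0\<^sub>m 1 d * 0\<^sub>m d 1 + 1\<^sub>m 1 * ?a))"
         "j < dim_col (four_block_mat (1\<^sub>m d * ?B + ?c' * ?c) (1\<^sub>m d * 0\<^sub>m d 1 + ?c' * ?a)
          (0\<^sub>m 1 d * ?B + 1\<^sub>m 1 * ?c) (0\<^sub>m 1 d * 0\<^sub>m d 1 + 1\<^sub>m 1 * ?a))"
        then have ij: "i < Suc d" "j < Suc d" by auto
        have "A d j = A j d" using ij Suc.prems(1) by auto
        then show "mat (Suc d) (Suc d) (\<lambda>(i, j). A i j) $$ (i, j) =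
          four_block_mat (1\<^sub>m d * ?B + ?c' * ?c) (1\<^sub>m d * 0\<^sub>m d 1 + ?c' * ?a)
          (0\<^sub>m 1 d * ?B + 1\<^sub>m 1 * ?c) (0\<^sub>m 1 d * 0\<^sub>m d 1 + 1\<^sub>m 1 * ?a) $$ (i, j)"
          using ij \<alpha> by (cases "i < d"; cases "j < d")
            (auto simp: scalar_prod_def B_def c_def \<alpha>_def not_less less_Suc_eq)
      qed auto
    qed auto
    then have "det (mat (Suc d) (Suc d) (\<lambda>(i, j). A i j)) =
      det (four_block_mat (1\<^sub>m d) ?c' (0\<^sub>m 1 d) (1\<^sub>m 1)) * det (four_block_mat ?B (0\<^sub>m d 1) ?c ?a)"
      by (simp only:) (rule det_mult[of _ "d + 1"], auto intro!: four_block_carrier_mat)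
    also have "det (four_block_mat (1\<^sub>m d) ?c' (0\<^sub>m 1 d) (1\<^sub>m 1)) = det (1\<^sub>m d) * det (1\<^sub>m 1 :: real mat)"
      by (rule det_four_block_mat_lower_left_zero) auto
    also have "det (four_block_mat ?B (0\<^sub>m d 1) ?c ?a) = det ?B * det ?a"
      by (rule det_four_block_mat_upper_right_zero) auto
    finally show ?thesis by (simp add: det_single)
  qed
  let ?D = "det (mat d d (\<lambda>(i, j). B i j))"
  have meas: "(\<lambda>x. ennreal (exp (- (\<Sum>i<Suc d. \<Sum>j<Suc d. A i j * x i * x j) / 2))) \<in>
      borel_measurable (PiM (insert d {..<d}) (\<lambda>_. lborel))"
    unfolding lessThan_Suc[symmetric] using quad_sum_measurable[of "Suc d" "Suc d" A] by measurable
  have "(\<integral>\<^sup>+x. ennreal (exp (- (\<Sum>i<Suc d. \<Sum>j<Suc d. A i j * x i * x j) / 2)) \<partial>(PiM {..<Suc d} (\<lambda>_. lborel)))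
    = (\<integral>\<^sup>+x. (\<integral>\<^sup>+y. ennreal (exp (- (\<Sum>i<Suc d. \<Sum>j<Suc d. A i j * (x(d := y)) i * (x(d := y)) j) / 2)) \<partial>lborel)
        \<partial>(PiM {..<d} (\<lambda>_. lborel)))"
    using product_nn_integral_insert[OF _ _ meas] by (simp only: lessThan_Suc) simp
  also have "\<dots> = (\<integral>\<^sup>+x. ennreal (exp (- (\<Sum>i<d. \<Sum>j<d. B i j * x i * x j) / 2)) * ennreal (sqrt (2 * pi / \<alpha>))
        \<partial>(PiM {..<d} (\<lambda>_. lborel)))"
  proof (intro nn_integral_cong)
    fix x :: "nat \<Rightarrow> real"
    let ?q = "\<Sum>i<d. \<Sum>j<d. B i j * x i * x j"
    have "ennreal (exp (- (\<Sum>i<Suc d. \<Sum>j<Suc d. A i j * (x(d := y)) i * (x(d := y)) j) / 2)) =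
      ennreal (exp (- ?q / 2)) * ennreal (exp (- \<alpha> * (y - (- s x / \<alpha>))\<^sup>2 / 2))" for y
      unfolding complete upd
      by (subst ennreal_mult[symmetric]) (auto simp: exp_add[symmetric] add_divide_distrib)
    then show "(\<integral>\<^sup>+y. ennreal (exp (- (\<Sum>i<Suc d. \<Sum>j<Suc d. A i j * (x(d := y)) i * (x(d := y)) j) / 2)) \<partial>lborel)
       = ennreal (exp (- ?q / 2)) * ennreal (sqrt (2 * pi / \<alpha>))"
      by (simp only: nn_integral_gaussian_1d[OF \<alpha>, of "- s x / \<alpha>", symmetric]) (rule nn_integral_cmult, measurable)
  qed
  also have "\<dots> = ennreal (sqrt ((2 * pi) ^ d / ?D)) * ennreal (sqrt (2 * pi / \<alpha>))"
    using IH by (subst nn_integral_multc) auto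
  also have "\<dots> = ennreal (sqrt ((2 * pi) ^ Suc d / (\<alpha> * ?D)))"
    using \<alpha> IH by (subst ennreal_mult[symmetric]) (auto simp: real_sqrt_mult[symmetric] mult_ac)
  finally show ?case using det \<alpha> IH by simp
qed

lemma quad_mat_sum:
  fixes A :: "real mat"
  assumes "A \<in> carrier_mat d d"
  shows "vec d x \<bullet> (A *\<^sub>v vec d x) = (\<Sum>i<d. \<Sum>j<d. A $$ (i, j) * x i * x j)"
proof -
  have "vec d x \<bullet> (A *\<^sub>v vec d x) = (\<Sum>i<d. x i * (\<Sum>j<d. A $$ (i, j) * x j))"
    using assms by (auto simp: scalar_prod_def atLeast0LessThan)
  also have "\<dots> = (\<Sum>i<d. \<Sum>j<d. A $$ (i, j) * x i * x j)"
    unfolding sum_distrib_left by (intro sum.cong refl) simp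
  finally show ?thesis .
qed

lemma nn_integral_gaussian:
  assumes A: "A \<in> PD d"
  shows "(\<integral>\<^sup>+x. ennreal (exp (- (vec d x \<bullet> (A *\<^sub>v vec d x)) / 2)) \<partial>(PiM {..<d} (\<lambda>_. lborel)))
      = ennreal (sqrt ((2 * pi) ^ d / det A))"
proof -
  have c: "A \<in> carrier_mat d d" "transpose_mat A = A" using A by (auto simp: PD_def)
  have m: "mat d d (\<lambda>(i, j). A $$ (i, j)) = A" using c by (intro eq_matI) auto
  have "A $$ (i, j) = A $$ (j, i)" if "i < d" "j < d" for i j
    using c that by (metis carrier_matD index_transpose_mat(1))
  moreover have "0 < (\<Sum>i<d. \<Sum>j<d. A $$ (i, j) * x i * x j)" if "\<exists>i<d. x i \<noteq> 0" for x
  proof -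
    have "vec d x \<noteq> 0\<^sub>v d" using that by (metis index_vec index_zero_vec(1))
    then have "0 < vec d x \<bullet> (A *\<^sub>v vec d x)" using A by (auto simp: PD_def)
    then show ?thesis using quad_mat_sum[OF c(1)] by simp
  qed
  ultimately show ?thesis using nn_integral_gaussian_sum[of d "\<lambda>i j. A $$ (i, j)"]
    unfolding quad_mat_sum[OF c(1)] m by blast
qed

lemma spectral_eigenvalue_bound:
  assumes W: "orth_mat n W" and b: "\<And>v. v \<in> carrier_vec n \<Longrightarrow> \<bar>v \<bullet> (spec n W \<mu> *\<^sub>v v)\<bar> \<le> b * (v \<bullet> v)"
    and j: "j < n"
  shows "\<bar>\<mu> j\<bar> \<le> b"
proof -
  obtain v where "v \<in> carrier_vec n" "v \<bullet> v = 1" "v \<bullet> (spec n W \<mu> *\<^sub>v v) = \<mu> j"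
    using spec_quad_eigenvector[OF W j] by metis
  then show ?thesis using b by force
qed

section \<open>Exponential moments and tails of quadratic forms in the whitened sample\<close>

locale normal_sample =
  fixes D n :: nat and U :: "real mat" and l :: "nat \<Rightarrow> real"
  assumes U: "orth_mat D U"
begin

definition Th :: "real mat" where "Th = spec D U (\<lambda>i. exp (l i))"
definition R :: "real mat" where "R = spec D U (\<lambda>i. exp (l i / 2))"
definition R' :: "real mat" where "R' = spec D U (\<lambda>i. exp (- l i / 2))"
definition N :: "(nat \<Rightarrow> real) measure" where "N = multivariate_normal D (inv_mat Th)"
definition P :: "(nat \<Rightarrow> nat \<Rightarrow> real) measure" where "P = iid_samples n N"
definition Y :: "(nat \<Rightarrow> real) \<Rightarrow> real vec" where "Y x = R *\<^sub>v vec D x"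

abbreviation sum_quad :: "(nat \<Rightarrow> nat \<Rightarrow> real) \<Rightarrow> real mat \<Rightarrow> real" where
  "sum_quad x M \<equiv> \<Sum>i<n. Y (x i) \<bullet> (M *\<^sub>v Y (x i))"
abbreviation sum_sq :: "(nat \<Rightarrow> nat \<Rightarrow> real) \<Rightarrow> real mat \<Rightarrow> real" where
  "sum_sq x M \<equiv> \<Sum>i<n. (nrm (M *\<^sub>v Y (x i)))\<^sup>2"

lemma R_carrier [simp]: "R \<in> carrier_mat D D" "R' \<in> carrier_mat D D" "Th \<in> carrier_mat D D"
  using U by (auto simp: R_def R'_def Th_def)

lemma R_facts: "R * R = Th" "R * R' = 1\<^sub>m D" "R' * R = 1\<^sub>m D" "transpose_mat R = R" "transpose_mat R' = R'"
  using spec_one[OF U] by (simp_all add: R_def R'_def Th_def spec_mult[OF U] spec_transpose[OF U] exp_add[symmetric])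

lemma Y_carrier [simp]: "Y x \<in> carrier_vec D"
  by (simp add: Y_def)

lemma quad_Y:
  assumes M: "M \<in> carrier_mat D D"
  shows "Y x \<bullet> (M *\<^sub>v Y x) = vec D x \<bullet> ((R * M * R) *\<^sub>v vec D x)"
proof -
  have "(R * M * R) *\<^sub>v vec D x = R *\<^sub>v (M *\<^sub>v Y x)"
    using M by (simp add: Y_def assoc_mult_mat_vec[of _ D D _ D] square_assoc[where n = D])
  then show ?thesis
    using scalar_prod_transpose[of R D D "vec D x" "M *\<^sub>v Y x"] M by (simp add: R_facts Y_def)
qed

lemma det_Th: "det Th = exp (\<Sum>i<D. l i)" "det R * det R = det Th" "det (inv_mat Th) = 1 / det Th" "inv_mat (inv_mat Th) = Th"
proof -
  show "det Th = exp (\<Sum>i<D. l i)" by (simp add: Th_def det_spec_exp[OF U])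
  show "det R * det R = det Th" using det_mult[of R D R] R_facts(1) by simp
  show "det (inv_mat Th) = 1 / det Th"
    unfolding Th_def inv_mat_spec[OF U] det_spec_exp[OF U] by (simp add: sum_negf exp_minus divide_inverse)
  show "inv_mat (inv_mat Th) = Th" using inv_mat_spec[OF U, of l] inv_mat_spec[OF U, of "\<lambda>i. - l i"] by (simp add: Th_def)
qed

lemma quad_measurable:
  fixes M :: "real mat"
  assumes "M \<in> carrier_mat D D"
  shows "(\<lambda>x. vec D x \<bullet> (M *\<^sub>v vec D x)) \<in> borel_measurable (PiM {..<D} (\<lambda>_. lborel))"
  unfolding quad_mat_sum[OF assms] by (rule quad_sum_measurable) simp

text \<open>Tilting the density by the quadratic form gives an unnormalized Gaussian with precision
  \<open>R * K * R\<close>, where \<open>K\<close> has eigenvalues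
  \<open>1 - 2 * s * \<mu> j\<close>, positive by assumption. The integral is a ratio of normalizing
  constants, in which \<open>det Th\<close> cancels. Later estimates see the Gaussian law only
  through this formula.\<close>

lemma laplace:
  assumes W: "orth_mat D W" and s: "\<And>j. j < D \<Longrightarrow> 2 * s * \<mu> j < 1"
  shows "(\<integral>\<^sup>+x. ennreal (exp (s * (Y x \<bullet> (spec D W \<mu> *\<^sub>v Y x)))) \<partial>N) = ennreal (1 / sqrt (\<Prod>j<D. 1 - 2 * s * \<mu> j))"
proof -
  define Z where "Z = sqrt ((2 * pi) ^ D * det (inv_mat Th))"
  have dT: "0 < det Th" by (simp add: det_Th)
  then have Z: "0 < Z" by (simp add: Z_def det_Th)
  define K where "K = spec D W (\<lambda>i. 1 - 2 * s * \<mu> i)"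
  have "K = spec D W (\<lambda>i. exp (ln (1 - 2 * s * \<mu> i)))"
    unfolding K_def using s by (intro arg_cong2[where f = "(*)"] refl) (auto simp: mat_diag_def intro!: eq_matI)
  then have K: "K \<in> PD D" using PD_spec[OF W] by metis
  have Kc: "K \<in> carrier_mat D D" using PD_carrier[OF K] .
  have B: "R * K * R \<in> PD D" using PD_congruence[OF K R_carrier(1,2) R_facts(3)] by (simp add: R_facts)
  have Bc: "R * K * R \<in> carrier_mat D D" using PD_carrier[OF B] .
  have detB: "det (R * K * R) = det Th * (\<Prod>j<D. 1 - 2 * s * \<mu> j)"
    using Kc by (simp add: det_mult[of _ D] det_Th(2)[symmetric] K_def det_spec[OF W])
  have Kq: "y \<bullet> (K *\<^sub>v y) = y \<bullet> y - 2 * s * (y \<bullet> (spec D W \<mu> *\<^sub>v y))" if y: "y \<in> carrier_vec D" for y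
    unfolding K_def quad_spec[OF W y] nrm_sq[symmetric] orth_nrm[OF W y, symmetric]
    by (simp add: sum_distrib_left left_diff_distrib sum_subtractf mult.assoc)
  have YY: "Y x \<bullet> Y x = vec D x \<bullet> (Th *\<^sub>v vec D x)" for x
    using quad_Y[of "1\<^sub>m D" x] by (simp add: R_facts right_mult_one_mat[of R D D] one_mult_mat_vec[of _ D])
  have key: "- (vec D x \<bullet> (Th *\<^sub>v vec D x)) / 2 + s * (Y x \<bullet> (spec D W \<mu> *\<^sub>v Y x))
      = - (vec D x \<bullet> ((R * K * R) *\<^sub>v vec D x)) / 2" for x
    using Kq[of "Y x"] YY[of x] quad_Y[OF Kc, of x] by simp
  have "(\<integral>\<^sup>+x. ennreal (exp (s * (Y x \<bullet> (spec D W \<mu> *\<^sub>v Y x)))) \<partial>N)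
    = (\<integral>\<^sup>+x. ennreal (exp (- (vec D x \<bullet> (Th *\<^sub>v vec D x)) / 2) / Z) * ennreal (exp (s * (Y x \<bullet> (spec D W \<mu> *\<^sub>v Y x)))) \<partial>(PiM {..<D} (\<lambda>_. lborel)))"
    unfolding N_def multivariate_normal_def det_Th(4) Z_def[symmetric]
  proof (rule nn_integral_density)
    have [measurable]: "(\<lambda>x. Y x \<bullet> (spec D W \<mu> *\<^sub>v Y x)) \<in> borel_measurable (PiM {..<D} (\<lambda>_. lborel))"
      "(\<lambda>x. vec D x \<bullet> (Th *\<^sub>v vec D x)) \<in> borel_measurable (PiM {..<D} (\<lambda>_. lborel))"
      using W by (simp_all add: quad_Y quad_measurable)
    show "(\<lambda>x. ennreal (exp (- (vec D x \<bullet> (Th *\<^sub>v vec D x)) / 2) / Z)) \<in> borel_measurable (PiM {..<D} (\<lambda>_. lborel))"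
      "(\<lambda>x. ennreal (exp (s * (Y x \<bullet> (spec D W \<mu> *\<^sub>v Y x))))) \<in> borel_measurable (PiM {..<D} (\<lambda>_. lborel))"
      by measurable
  qed
  also have "\<dots> = (\<integral>\<^sup>+x. ennreal (1 / Z) * ennreal (exp (- (vec D x \<bullet> ((R * K * R) *\<^sub>v vec D x)) / 2)) \<partial>(PiM {..<D} (\<lambda>_. lborel)))"
  proof (rule nn_integral_cong)
    fix x :: "nat \<Rightarrow> real"
    have "exp (- (vec D x \<bullet> (Th *\<^sub>v vec D x)) / 2) / Z * exp (s * (Y x \<bullet> (spec D W \<mu> *\<^sub>v Y x)))
        = 1 / Z * exp (- (vec D x \<bullet> ((R * K * R) *\<^sub>v vec D x)) / 2)"
      unfolding key[symmetric] exp_add by simp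
    then show "ennreal (exp (- (vec D x \<bullet> (Th *\<^sub>v vec D x)) / 2) / Z) * ennreal (exp (s * (Y x \<bullet> (spec D W \<mu> *\<^sub>v Y x))))
        = ennreal (1 / Z) * ennreal (exp (- (vec D x \<bullet> ((R * K * R) *\<^sub>v vec D x)) / 2))"
      using Z by (simp only: ennreal_mult'[symmetric] exp_ge_zero divide_nonneg_pos zero_le_one)
  qed
  also have "\<dots> = ennreal (1 / Z) * ennreal (sqrt ((2 * pi) ^ D / det (R * K * R)))"
  proof -
    have [measurable]: "(\<lambda>x. vec D x \<bullet> ((R * K * R) *\<^sub>v vec D x)) \<in> borel_measurable (PiM {..<D} (\<lambda>_. lborel))"
      by (rule quad_measurable[OF Bc])
    show ?thesis unfolding nn_integral_gaussian[OF B, symmetric] by (intro nn_integral_cmult) measurable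
  qed
  also have "\<dots> = ennreal (1 / sqrt (\<Prod>j<D. 1 - 2 * s * \<mu> j))"
  proof -
    have p: "0 < (\<Prod>j<D. 1 - 2 * s * \<mu> j)" using s by (intro prod_pos) auto
    have "1 / Z * sqrt ((2 * pi) ^ D / det (R * K * R)) = sqrt (((2 * pi) ^ D / det (R * K * R)) / ((2 * pi) ^ D * det (inv_mat Th)))"
      unfolding Z_def real_sqrt_divide[of _ "(2 * pi) ^ D * det (inv_mat Th)"] by simp
    also have "((2 * pi) ^ D / det (R * K * R)) / ((2 * pi) ^ D * det (inv_mat Th)) = 1 / (\<Prod>j<D. 1 - 2 * s * \<mu> j)"
      unfolding detB det_Th(3) using dT p by (simp add: field_simps)
    finally have "1 / Z * sqrt ((2 * pi) ^ D / det (R * K * R)) = 1 / sqrt (\<Prod>j<D. 1 - 2 * s * \<mu> j)"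
      by (simp only: real_sqrt_divide real_sqrt_one)
    then show ?thesis using Z by (subst ennreal_mult'[symmetric]) auto
  qed
  finally show ?thesis .
qed

lemma sets_N: "sets N = sets (PiM {..<D} (\<lambda>_. lborel))"
  by (simp add: N_def multivariate_normal_def)

text \<open>The total mass is \<open>laplace\<close> at \<open>s = 0\<close>.\<close>

lemma prob_space_N: "prob_space N"
proof
  have "(\<integral>\<^sup>+x. ennreal (exp (0 * (Y x \<bullet> (spec D (1\<^sub>m D) (\<lambda>_. 0) *\<^sub>v Y x)))) \<partial>N) = ennreal (1 / sqrt (\<Prod>j<D. 1 - 2 * 0 * 0))"
    by (rule laplace) (auto simp: orth_mat_one)
  then show "emeasure N (space N) = 1" by simp
qed

sublocale N: prob_space N by (rule prob_space_N)

lemma prob_space_P: "prob_space P"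
  unfolding P_def iid_samples_def by (rule prob_space_PiM) (rule prob_space_N)

sublocale P: prob_space P by (rule prob_space_P)

lemma quad_Y_measurable:
  assumes "M \<in> carrier_mat D D"
  shows "(\<lambda>x. Y x \<bullet> (M *\<^sub>v Y x)) \<in> borel_measurable N"
  unfolding quad_Y[OF assms] measurable_cong_sets[OF sets_N refl] using assms by (intro quad_measurable) auto

lemma quad_sample_measurable:
  assumes "M \<in> carrier_mat D D"
  shows "(\<lambda>x. \<Sum>i<n. Y (x i) \<bullet> (M *\<^sub>v Y (x i))) \<in> borel_measurable P"
  unfolding P_def iid_samples_def
proof (rule borel_measurable_sum)
  fix i assume "i \<in> {..<n}"
  then show "(\<lambda>x. Y (x i) \<bullet> (M *\<^sub>v Y (x i))) \<in> borel_measurable (PiM {..<n} (\<lambda>_. N))"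
    using measurable_compose[of "\<lambda>x. x i" "PiM {..<n} (\<lambda>_. N)" N "\<lambda>y. Y y \<bullet> (M *\<^sub>v Y y)" borel]
      measurable_component_singleton[of i "{..<n}" "\<lambda>_. N"] quad_Y_measurable[OF assms] by blast
qed

text \<open>Independence turns the integral into an \<open>n\<close>-th power of the one-sample
  formula, whose logarithm is then expanded to second order in \<open>s\<close>. The result involves
  only the trace and the squared Frobenius norm.\<close>

lemma laplace_sample:
  assumes W: "orth_mat D W" and s: "\<And>j. j < D \<Longrightarrow> \<bar>2 * s * \<mu> j\<bar> \<le> 1 / 2"
  shows "(\<integral>\<^sup>+x. ennreal (exp (s * sum_quad x (spec D W \<mu>))) \<partial>P)
    \<le> ennreal (exp (real n * (s * (\<Sum>j<D. \<mu> j) + 4 * s\<^sup>2 * (\<Sum>j<D. (\<mu> j)\<^sup>2))))"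
proof -
  interpret product_sigma_finite "\<lambda>_::nat. N" by standard
  have lt: "2 * s * \<mu> j < 1" if "j < D" for j using s[OF that] by (simp add: abs_le_iff)
  let ?q = "\<lambda>x. ennreal (exp (s * (Y x \<bullet> (spec D W \<mu> *\<^sub>v Y x))))"
  have "(\<integral>\<^sup>+x. ennreal (exp (s * sum_quad x (spec D W \<mu>))) \<partial>P)
    = (\<integral>\<^sup>+x. (\<Prod>i<n. ?q (x i)) \<partial>(PiM {..<n} (\<lambda>_. N)))"
    unfolding P_def iid_samples_def by (simp add: sum_distrib_left exp_sum prod_ennreal)
  also have "\<dots> = (\<Prod>i<n. integral\<^sup>N N ?q)"
  proof (intro product_nn_integral_prod)
    have "(\<lambda>x. Y x \<bullet> (spec D W \<mu> *\<^sub>v Y x)) \<in> borel_measurable N" using W by (intro quad_Y_measurable) simp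
    then show "?q \<in> borel_measurable N" by measurable
  qed simp
  also have "\<dots> = ennreal (1 / sqrt (\<Prod>j<D. 1 - 2 * s * \<mu> j)) ^ n" using lt by (simp add: laplace[OF W])
  also have "\<dots> \<le> ennreal (exp (s * (\<Sum>j<D. \<mu> j) + 4 * s\<^sup>2 * (\<Sum>j<D. (\<mu> j)\<^sup>2))) ^ n"
  proof (intro power_mono ennreal_leI zero_le)
    have "1 / sqrt (\<Prod>j<D. 1 - 2 * s * \<mu> j) = exp (- (\<Sum>j<D. ln (1 - 2 * s * \<mu> j)) / 2)"
    proof -
      have "(\<Prod>j<D. 1 - 2 * s * \<mu> j) = exp (\<Sum>j<D. ln (1 - 2 * s * \<mu> j))"
        unfolding exp_sum[OF finite_lessThan] using lt by (intro prod.cong refl) auto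
      also have "\<dots> = (exp ((\<Sum>j<D. ln (1 - 2 * s * \<mu> j)) / 2))\<^sup>2" by (simp add: power2_eq_square exp_add[symmetric])
      finally have "sqrt (\<Prod>j<D. 1 - 2 * s * \<mu> j) = exp ((\<Sum>j<D. ln (1 - 2 * s * \<mu> j)) / 2)"
        by (simp only: real_sqrt_abs abs_exp_cancel)
      then show ?thesis by (simp only: minus_divide_left exp_minus mult_minus_left divide_inverse mult_1_left)
    qed
    moreover have "- (\<Sum>j<D. ln (1 - 2 * s * \<mu> j)) / 2 \<le> s * (\<Sum>j<D. \<mu> j) + 4 * s\<^sup>2 * (\<Sum>j<D. (\<mu> j)\<^sup>2)"
    proof -
      \<comment> \<open>With \<open>u = 2 * s * \<mu> j\<close> this is half of
        \<open>- ln (1 - u) \<le> u + 2 * u\<^sup>2\<close>, valid for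
        \<open>\<bar>u\<bar> \<le> 1 / 2\<close>.\<close>
      have "- ln (1 - 2 * s * \<mu> j) / 2 \<le> s * \<mu> j + 4 * s\<^sup>2 * (\<mu> j)\<^sup>2" if "j < D" for j
        using abs_ln_one_plus_x_minus_x_bound[of "- (2 * s * \<mu> j)"] s[OF that]
        by (simp add: power_mult_distrib abs_le_iff)
      then have "(\<Sum>j<D. - ln (1 - 2 * s * \<mu> j) / 2) \<le> (\<Sum>j<D. s * \<mu> j + 4 * s\<^sup>2 * (\<mu> j)\<^sup>2)"
        by (intro sum_mono) auto
      then show ?thesis by (simp add: sum.distrib sum_distrib_left sum_negf[symmetric] sum_divide_distrib)
    qed
    ultimately show "1 / sqrt (\<Prod>j<D. 1 - 2 * s * \<mu> j) \<le> exp (s * (\<Sum>j<D. \<mu> j) + 4 * s\<^sup>2 * (\<Sum>j<D. (\<mu> j)\<^sup>2))"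
      by (simp only: exp_le_cancel_iff)
  qed
  also have "\<dots> = ennreal (exp (real n * (s * (\<Sum>j<D. \<mu> j) + 4 * s\<^sup>2 * (\<Sum>j<D. (\<mu> j)\<^sup>2))))"
    by (simp add: ennreal_power exp_of_nat_mult)
  finally show ?thesis .
qed

text \<open>Markov's inequality for \<open>exp (s * q)\<close>. The bound \<open>b\<close> on the
  quadratic form stands for the operator norm, and \<open>4 * s * b \<le> 1\<close> keeps every
  eigenvalue within reach of \<open>laplace_sample\<close>. The choice of \<open>s\<close> is left
  to the application.\<close>

lemma chernoff:
  assumes M: "M \<in> carrier_mat D D" "transpose_mat M = M"
    and b: "\<And>v. v \<in> carrier_vec D \<Longrightarrow> \<bar>v \<bullet> (M *\<^sub>v v)\<bar> \<le> b * (v \<bullet> v)"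
    and F: "frob2 M \<le> F" and s: "0 \<le> s" "4 * s * b \<le> 1"
  shows "measure P {x \<in> space P. u \<le> sum_quad x M - real n * tr M} \<le> exp (- s * u + 4 * s\<^sup>2 * real n * F)"
proof -
  obtain W \<mu> where W: "orth_mat D W" "M = spec D W \<mu>" by (rule spectral_theorem[OF M])
  have \<mu>: "\<bar>\<mu> j\<bar> \<le> b" if "j < D" for j
    using spectral_eigenvalue_bound[OF W(1) _ that] b W(2) by blast
  have s2: "\<bar>2 * s * \<mu> j\<bar> \<le> 1 / 2" if "j < D" for j
    using mult_left_mono[OF \<mu>[OF that] s(1)] s by (simp add: abs_mult)
  define q where "q x = sum_quad x M" for x
  let ?c = "ennreal (exp (- s * (u + real n * tr M)))"
  have "q \<in> borel_measurable P" unfolding q_def by (rule quad_sample_measurable[OF M(1)])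
  then have eq: "(\<lambda>x. exp (s * q x)) \<in> borel_measurable P" by measurable
  have "emeasure P {x \<in> space P. u \<le> q x - real n * tr M} \<le> emeasure P {x \<in> space P. 1 \<le> ?c * ennreal (exp (s * q x))}"
  proof (intro emeasure_mono subsetI)
    fix x assume "x \<in> {x \<in> space P. u \<le> q x - real n * tr M}"
    then have x: "x \<in> space P" "u + real n * tr M \<le> q x" by auto
    have "ennreal 1 \<le> ennreal (exp (- s * (u + real n * tr M)) * exp (s * q x))"
      using mult_left_mono[OF x(2) s(1)] by (intro ennreal_leI) (simp add: exp_add[symmetric] algebra_simps)
    also have "ennreal (exp (- s * (u + real n * tr M)) * exp (s * q x)) = ?c * ennreal (exp (s * q x))"
      by (rule ennreal_mult) (rule exp_ge_zero)+
    finally show "x \<in> {x \<in> space P. 1 \<le> ?c * ennreal (exp (s * q x))}" using x(1) unfolding ennreal_1 by blast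
  next
    show "{x \<in> space P. 1 \<le> ?c * ennreal (exp (s * q x))} \<in> sets P"
      by (intro borel_measurable_le borel_measurable_const borel_measurable_times_ennreal eq
          measurable_compose[OF _ measurable_ennreal])
  qed
  also have "\<dots> \<le> ?c * (\<integral>\<^sup>+x. ennreal (exp (s * q x)) * indicator (space P) x \<partial>P)"
    by (rule nn_integral_Markov_inequality)
      (intro borel_measurable_times_ennreal borel_measurable_indicator sets.top measurable_compose[OF eq measurable_ennreal] | simp)+
  also have "(\<integral>\<^sup>+x. ennreal (exp (s * q x)) * indicator (space P) x \<partial>P) = (\<integral>\<^sup>+x. ennreal (exp (s * q x)) \<partial>P)"
    by (intro nn_integral_cong) auto
  also have "?c * \<dots> \<le> ?c * ennreal (exp (real n * (s * tr M + 4 * s\<^sup>2 * frob2 M)))"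
    using laplace_sample[OF W(1) s2] W by (intro mult_left_mono) (simp_all add: tr_spec frob2_spec q_def)
  also have "\<dots> = ennreal (exp (- s * u + 4 * s\<^sup>2 * real n * frob2 M))"
    by (simp add: ennreal_mult[symmetric] exp_add[symmetric] algebra_simps)
  also have "\<dots> \<le> ennreal (exp (- s * u + 4 * s\<^sup>2 * real n * F))"
    using F by (intro ennreal_leI) (simp add: mult_left_mono)
  finally show ?thesis by (simp add: P.emeasure_eq_measure q_def)
qed

end

section \<open>Nets\<close>

text \<open>Integer coordinates of a lattice with mesh \<open>1 / (4 * sqrt m)\<close>,
  \<open>m = card E\<close>, so the unit ball corresponds to a sum of squares at most
  \<open>16 * m\<close>. The box makes the set a part of a finite function space; coordinates of
  size at most \<open>4 * sqrt m\<close> lie in it.\<close>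

definition grid :: "'e set \<Rightarrow> ('e \<Rightarrow> int) set" where
  "grid E = {k \<in> PiE E (\<lambda>_. {- (4 * int (card E))..4 * int (card E)}). (\<Sum>e\<in>E. (real_of_int (k e))\<^sup>2) \<le> 16 * card E}"

definition grid_point :: "'e set \<Rightarrow> ('e \<Rightarrow> int) \<Rightarrow> 'e \<Rightarrow> real" where
  "grid_point E k e = real_of_int (k e) / (4 * sqrt (card E))"

lemma finite_grid: "finite E \<Longrightarrow> finite (grid E)"
  unfolding grid_def by (rule finite_Collect_conjI) (simp add: finite_PiE)

text \<open>The bound is uniform in \<open>b\<close> because \<open>exp (- i\<^sup>2)\<close> is at
  most \<open>2\<close> to the power \<open>- i\<close> for \<open>i \<ge> 1\<close>; the geometric
  remainder is kept so that the induction closes.\<close>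

lemma sum_exp_neg_sq_le:
  "(\<Sum>i\<in>{- int b..int b}. exp (- (real_of_int i)\<^sup>2)) \<le> 3 - 2 * (1 / 2) ^ b"
proof (induction b)
  case (Suc b)
  have "{- int (Suc b)..int (Suc b)} = insert (- int (Suc b)) (insert (int (Suc b)) {- int b..int b})" by auto
  then have "(\<Sum>i\<in>{- int (Suc b)..int (Suc b)}. exp (- (real_of_int i)\<^sup>2)) =
    2 * exp (- (real (Suc b))\<^sup>2) + (\<Sum>i\<in>{- int b..int b}. exp (- (real_of_int i)\<^sup>2))"
    by (simp add: power2_eq_square algebra_simps)
  moreover have "exp (- (real (Suc b))\<^sup>2) \<le> (1 / 2) ^ Suc b"
  proof -
    have "real (Suc b) * 1 \<le> (real (Suc b))\<^sup>2" unfolding power2_eq_square by (intro mult_left_mono) auto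
    then have "exp (- (real (Suc b))\<^sup>2) \<le> exp (real (Suc b) * (- 1))" by simp
    also have "\<dots> = exp (- 1) ^ Suc b" by (rule exp_of_nat_mult)
    also have "\<dots> \<le> (1 / 2) ^ Suc b"
      using exp_ge_add_one_self[of 1] by (intro power_mono) (auto simp: exp_minus field_simps)
    finally show ?thesis .
  qed
  ultimately show ?case using Suc by simp
qed simp

text \<open>Counting by weights instead of volumes. Each grid point has weight at least
  \<open>exp (- 16 * m)\<close> under the product of the weights \<open>exp (- i\<^sup>2)\<close>,
  with \<open>m = card E\<close>. The total weight over the box factorizes and is at most
  \<open>3 ^ m\<close>, hence at most \<open>exp (2 * m)\<close>.\<close>

lemma card_grid_le:
  assumes "finite E"
  shows "card (grid E) \<le> exp (18 * card E)"
proof -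
  let ?I = "{- (4 * int (card E))..4 * int (card E)}"
  have "card (grid E) * exp (- (16 * real (card E))) = (\<Sum>k\<in>grid E. exp (- (16 * real (card E))))" by simp
  also have "\<dots> \<le> (\<Sum>k\<in>grid E. \<Prod>e\<in>E. exp (- (real_of_int (k e))\<^sup>2))"
    by (intro sum_mono) (auto simp: grid_def exp_sum[OF assms, symmetric] sum_negf)
  also have "\<dots> \<le> (\<Sum>k\<in>PiE E (\<lambda>_. ?I). \<Prod>e\<in>E. exp (- (real_of_int (k e))\<^sup>2))"
    using assms by (intro sum_mono2 finite_PiE) (auto simp: grid_def intro: prod_nonneg)
  also have "\<dots> = (\<Prod>e\<in>E. \<Sum>i\<in>?I. exp (- (real_of_int i)\<^sup>2))"
    using assms by (subst prod_sum_PiE) auto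
  also have "\<dots> \<le> (\<Prod>e\<in>E. exp 2)"
  proof (intro prod_mono conjI sum_nonneg)
    have "(\<Sum>i\<in>?I. exp (- (real_of_int i)\<^sup>2)) \<le> 3"
      using sum_exp_neg_sq_le[of "4 * card E"] by (auto intro: order_trans)
    also have "(3::real) \<le> exp 2" using exp_ge_add_one_self[of 2] by simp
    finally show "(\<Sum>i\<in>?I. exp (- (real_of_int i)\<^sup>2)) \<le> exp 2" .
  qed auto
  also have "\<dots> = exp (2 * real (card E))" by (simp add: exp_of_nat2_mult)
  finally have "card (grid E) * exp (- (16 * real (card E))) * exp (16 * real (card E)) \<le> exp (2 * real (card E)) * exp (16 * real (card E))"
    by (intro mult_right_mono) auto
  then show ?thesis by (simp add: mult.assoc exp_add[symmetric])
qed

text \<open>Coordinates are rounded towards zero, so that the norm does not increase.\<close>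

lemma grid_approx:
  assumes E: "finite E" "E \<noteq> {}" and p: "L2_set p E \<le> 1"
  obtains k where "k \<in> grid E" "L2_set (grid_point E k) E \<le> 1" "L2_set (\<lambda>e. p e - grid_point E k e) E \<le> 1 / 4"
proof -
  define m where "m = real (card E)"
  define h where "h = 1 / (4 * sqrt m)"
  have m: "1 \<le> m" using E by (simp add: m_def Suc_leI card_gt_0_iff)
  then have h: "0 < h" "m * h\<^sup>2 = 1 / 16" by (auto simp: h_def power_divide power_mult_distrib)
  define k where "k = restrict (\<lambda>e. if 0 \<le> p e then \<lfloor>p e / h\<rfloor> else - \<lfloor>- p e / h\<rfloor>) E"
  have gp: "grid_point E k e = real_of_int (k e) * h" for e
    by (simp add: grid_point_def h_def m_def)
  have err: "\<bar>p e - real_of_int (k e) * h\<bar> \<le> h" and le: "\<bar>real_of_int (k e) * h\<bar> \<le> \<bar>p e\<bar>" if "e \<in> E" for e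
  proof -
    have fl: "real_of_int \<lfloor>t / h\<rfloor> * h \<le> t" "t \<le> real_of_int \<lfloor>t / h\<rfloor> * h + h" "0 \<le> real_of_int \<lfloor>t / h\<rfloor> * h" if "0 \<le> t" for t
    proof -
      have "real_of_int \<lfloor>t / h\<rfloor> \<le> t / h" "t / h \<le> real_of_int \<lfloor>t / h\<rfloor> + 1" by linarith+
      then have "real_of_int \<lfloor>t / h\<rfloor> * h \<le> t / h * h" "t / h * h \<le> (real_of_int \<lfloor>t / h\<rfloor> + 1) * h"
        using h(1) by (simp_all only: mult_right_mono less_imp_le)
      then show "real_of_int \<lfloor>t / h\<rfloor> * h \<le> t" "t \<le> real_of_int \<lfloor>t / h\<rfloor> * h + h"
        using h(1) by (simp_all add: distrib_right)
      show "0 \<le> real_of_int \<lfloor>t / h\<rfloor> * h" using that h by simp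
    qed
    show "\<bar>p e - real_of_int (k e) * h\<bar> \<le> h" "\<bar>real_of_int (k e) * h\<bar> \<le> \<bar>p e\<bar>"
      using fl[of "p e"] fl[of "- p e"] that by (cases "0 \<le> p e"; simp add: k_def abs_le_iff; linarith)+
  qed
  have n1: "L2_set (grid_point E k) E \<le> L2_set p E"
  proof -
    have "L2_set (\<lambda>e. \<bar>grid_point E k e\<bar>) E \<le> L2_set (\<lambda>e. \<bar>p e\<bar>) E"
      using le by (intro L2_set_mono) (auto simp: gp)
    then show ?thesis by (simp add: L2_set_def)
  qed
  have "L2_set (\<lambda>e. \<bar>p e - grid_point E k e\<bar>) E \<le> L2_set (\<lambda>e. h) E"
    using err by (intro L2_set_mono) (auto simp: gp)
  also have "L2_set (\<lambda>e. h) E = sqrt (m * h\<^sup>2)" by (simp add: L2_set_def m_def)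
  also have "\<dots> = 1 / 4" unfolding h(2) by (simp add: real_sqrt_divide)
  finally have n2: "L2_set (\<lambda>e. p e - grid_point E k e) E \<le> 1 / 4" by (simp add: L2_set_def)
  have s: "(\<Sum>e\<in>E. (real_of_int (k e))\<^sup>2) \<le> 16 * m"
  proof -
    have "(\<Sum>e\<in>E. (grid_point E k e)\<^sup>2) \<le> 1"
      using n1 p by (simp add: L2_set_def)
    then have "(\<Sum>e\<in>E. (real_of_int (k e))\<^sup>2) * h\<^sup>2 \<le> 16 * m * h\<^sup>2"
      using h by (simp add: gp power_mult_distrib sum_distrib_right)
    then show ?thesis using h by simp
  qed
  have "k e \<in> {- (4 * int (card E))..4 * int (card E)}" if e: "e \<in> E" for e
  proof -
    have "(real_of_int (k e))\<^sup>2 \<le> (\<Sum>e\<in>E. (real_of_int (k e))\<^sup>2)"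
      using E e by (intro member_le_sum) auto
    also have "\<dots> \<le> 16 * m * m" using s m by (auto intro: order_trans[OF _ mult_left_mono[of 1]])
    also have "\<dots> = (4 * m)\<^sup>2" by (simp add: power2_eq_square)
    finally have "\<bar>real_of_int (k e)\<bar> \<le> \<bar>4 * m\<bar>" by (simp only: abs_le_square_iff)
    then have "\<bar>real_of_int (k e)\<bar> \<le> 4 * m" using m by simp
    then have "\<bar>k e\<bar> \<le> 4 * int (card E)" unfolding m_def by linarith
    then show ?thesis by auto
  qed
  then have "k \<in> grid E" using s by (auto simp: grid_def m_def k_def PiE_def extensional_def)
  then show ?thesis using that n1 n2 p by auto
qed

text \<open>If \<open>S\<close> is the supremum of \<open>Q\<close> over the unit ball, rounding to
  the grid gives \<open>S \<le> B + S / 4\<close>, hence the factor \<open>4 / 3\<close>. The a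
  priori constant \<open>C\<close> makes the supremum finite and settles vectors of norm zero; it
  does not enter the result.\<close>

lemma seminorm_net:
  fixes Q :: "('e \<Rightarrow> real) \<Rightarrow> real"
  assumes E: "finite E" "E \<noteq> {}"
    and add: "\<And>p q. Q (\<lambda>e. p e + q e) \<le> Q p + Q q"
    and scale: "\<And>c p. Q (\<lambda>e. c * p e) = \<bar>c\<bar> * Q p"
    and bound: "\<And>p. Q p \<le> C * L2_set p E"
    and net: "\<And>k. k \<in> grid E \<Longrightarrow> L2_set (grid_point E k) E \<le> 1 \<Longrightarrow> Q (grid_point E k) \<le> B"
  shows "Q p \<le> 4 / 3 * B * L2_set p E"
proof -
  define A where "A = {Q p |p. L2_set p E \<le> 1}"
  have L2s: "L2_set (\<lambda>e. c * p e) E = \<bar>c\<bar> * L2_set p E" for c p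
    unfolding L2_set_def power_mult_distrib sum_distrib_left[symmetric] by (simp add: real_sqrt_mult)
  have C: "Q p \<le> \<bar>C\<bar>" if "L2_set p E \<le> 1" for p
  proof -
    have "Q p \<le> \<bar>C\<bar> * L2_set p E"
      by (rule order_trans[OF bound]) (intro mult_right_mono abs_ge_self L2_set_nonneg)
    also have "\<dots> \<le> \<bar>C\<bar> * 1" using that by (intro mult_left_mono) auto
    finally show ?thesis by simp
  qed
  have bdd: "bdd_above A" unfolding A_def by (rule bdd_aboveI[where M = "\<bar>C\<bar>"]) (use C in auto)
  have ne: "A \<noteq> {}" unfolding A_def by (auto intro!: exI[of _ "\<lambda>_. 0"] simp: L2_set_def)
  have step: "Q p \<le> B + Sup A / 4" if p: "L2_set p E \<le> 1" for p
  proof -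
    obtain k where k: "k \<in> grid E" "L2_set (grid_point E k) E \<le> 1" "L2_set (\<lambda>e. p e - grid_point E k e) E \<le> 1 / 4"
      using grid_approx[OF E p] by blast
    let ?r = "\<lambda>e. 4 * (p e - grid_point E k e)"
    have "L2_set ?r E \<le> 1" using k(3) unfolding L2s by simp
    then have "Q ?r \<le> Sup A" by (intro cSup_upper bdd) (auto simp: A_def)
    moreover have "Q ?r = 4 * Q (\<lambda>e. p e - grid_point E k e)" unfolding scale by simp
    moreover have "Q p \<le> Q (grid_point E k) + Q (\<lambda>e. p e - grid_point E k e)"
      using add[of "grid_point E k" "\<lambda>e. p e - grid_point E k e"] by simp
    ultimately show ?thesis using net[OF k(1,2)] by linarith
  qed
  have "Sup A \<le> B + Sup A / 4"
  proof (rule cSup_least[OF ne])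
    fix y assume "y \<in> A"
    then show "y \<le> B + Sup A / 4" unfolding A_def using step[unfolded A_def] by blast
  qed
  then have S: "Q p \<le> 4 / 3 * B" if "L2_set p E \<le> 1" for p using step[OF that] by simp
  show ?thesis
  proof (cases "L2_set p E = 0")
    case True
    then show ?thesis using bound[of p] by simp
  next
    case False
    then have n: "0 < L2_set p E" using L2_set_nonneg[of p E] by linarith
    have "Q (\<lambda>e. inverse (L2_set p E) * p e) \<le> 4 / 3 * B" by (rule S) (use n in \<open>simp add: L2s\<close>)
    then show ?thesis unfolding scale using n by (simp add: field_simps)
  qed
qed

section \<open>First- and second-order bounds on a linear family of matrices\<close>

abbreviation total_quad :: "nat \<Rightarrow> (nat \<Rightarrow> real vec) \<Rightarrow> real mat \<Rightarrow> real" where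
  "total_quad n y M \<equiv> \<Sum>i<n. y i \<bullet> (M *\<^sub>v y i)"
abbreviation total_sq :: "nat \<Rightarrow> (nat \<Rightarrow> real vec) \<Rightarrow> real mat \<Rightarrow> real" where
  "total_sq n y M \<equiv> \<Sum>i<n. (nrm (M *\<^sub>v y i))\<^sup>2"

lemma abs_scalar_prod_le:
  assumes "v \<in> carrier_vec n" "w \<in> carrier_vec n"
  shows "\<bar>v \<bullet> w\<bar> \<le> nrm v * nrm w"
proof -
  have "(v \<bullet> w)\<^sup>2 \<le> (nrm v * nrm w)\<^sup>2"
    using Cauchy_Schwarz_ineq_sum[of "\<lambda>i. v $ i" "\<lambda>i. w $ i" "{..<n}"] assms
    by (simp add: power_mult_distrib nrm_sq_sum[of _ n] scalar_prod_def atLeast0LessThan)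
  then have "\<bar>v \<bullet> w\<bar> \<le> \<bar>nrm v * nrm w\<bar>" by (simp only: abs_le_square_iff)
  then show ?thesis by simp
qed

lemma frob2_L2_set:
  assumes "A \<in> carrier_mat m n"
  shows "sqrt (frob2 A) = L2_set (\<lambda>ij. A $$ ij) ({..<m} \<times> {..<n})"
  using assms by (simp add: frob2_def L2_set_def sum.cartesian_product)

lemma frob_triangle:
  assumes "A \<in> carrier_mat m n" "B \<in> carrier_mat m n"
  shows "sqrt (frob2 (A + B)) \<le> sqrt (frob2 A) + sqrt (frob2 B)"
proof -
  have "L2_set (\<lambda>ij. (A + B) $$ ij) ({..<m} \<times> {..<n}) = L2_set (\<lambda>ij. A $$ ij + B $$ ij) ({..<m} \<times> {..<n})"
    using assms by (intro L2_set_cong) auto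
  then show ?thesis
    using L2_set_triangle_ineq[of "\<lambda>ij. A $$ ij" "\<lambda>ij. B $$ ij" "{..<m} \<times> {..<n}"] assms
    by (simp add: frob2_L2_set[where m = m and n = n])
qed

lemma frob2_smult: "frob2 (c \<cdot>\<^sub>m A) = c\<^sup>2 * frob2 A"
  by (simp add: frob2_def power_mult_distrib sum_distrib_left)

lemma abs_tr_le:
  assumes "A \<in> carrier_mat n n"
  shows "\<bar>tr A\<bar> \<le> sqrt n * sqrt (frob2 A)"
proof -
  have "(tr A)\<^sup>2 \<le> (\<Sum>i<n. 1\<^sup>2) * (\<Sum>i<n. (A $$ (i, i))\<^sup>2)"
    using Cauchy_Schwarz_ineq_sum[of "\<lambda>_. 1" "\<lambda>i. A $$ (i, i)" "{..<n}"] assms by (simp add: tr_def)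
  also have "\<dots> \<le> n * frob2 A"
  proof -
    have "(A $$ (i, i))\<^sup>2 \<le> (\<Sum>j<n. (A $$ (i, j))\<^sup>2)" if "i < n" for i
      using that by (intro member_le_sum[of i "{..<n}" "\<lambda>j. (A $$ (i, j))\<^sup>2"]) auto
    then show ?thesis using assms by (auto simp: frob2_def intro!: mult_left_mono sum_mono)
  qed
  also have "\<dots> = (sqrt n * sqrt (frob2 A))\<^sup>2" by (simp add: power_mult_distrib)
  finally have "\<bar>tr A\<bar> \<le> \<bar>sqrt n * sqrt (frob2 A)\<bar>" by (simp only: abs_le_square_iff)
  then show ?thesis by simp
qed

text \<open>Chernoff bounds are stated for symmetric matrices, while the blocks are arbitrary. A
  quadratic form sees only the symmetric part, which has the same trace and no larger Frobenius
  norm.\<close>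

lemma sym_part:
  fixes M :: "real mat"
  assumes M: "M \<in> carrier_mat n n"
  defines "S \<equiv> (1 / 2) \<cdot>\<^sub>m (M + transpose_mat M)"
  shows "S \<in> carrier_mat n n" "transpose_mat S = S" "tr S = tr M" "frob2 S \<le> frob2 M"
    "v \<in> carrier_vec n \<Longrightarrow> v \<bullet> (S *\<^sub>v v) = v \<bullet> (M *\<^sub>v v)"
proof -
  show "S \<in> carrier_mat n n" using M by (simp add: S_def)
  show "transpose_mat S = S" using M by (intro eq_matI) (auto simp: S_def)
  show "tr S = tr M" using M by (simp add: S_def tr_def)
  have "sqrt (frob2 (M + transpose_mat M)) \<le> sqrt (frob2 M) + sqrt (frob2 (transpose_mat M))"
    using M by (intro frob_triangle[of _ n n]) auto
  also have "frob2 (transpose_mat M) = frob2 M"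
    using M sum.swap[of "\<lambda>i j. (M $$ (i, j))\<^sup>2" "{..<n}" "{..<n}"] by (simp add: frob2_def)
  finally have "(sqrt (frob2 (M + transpose_mat M)))\<^sup>2 \<le> (2 * sqrt (frob2 M))\<^sup>2"
    by (intro power_mono) auto
  then show "frob2 S \<le> frob2 M" by (simp add: S_def frob2_smult power_divide power_mult_distrib)
  assume v: "v \<in> carrier_vec n"
  have "S *\<^sub>v v = (1 / 2) \<cdot>\<^sub>v (M *\<^sub>v v + transpose_mat M *\<^sub>v v)"
    using M v by (intro eq_vecI) (auto simp: S_def scalar_prod_def sum.distrib[symmetric] sum_distrib_left distrib_right mult.assoc intro!: sum.cong)
  then have "v \<bullet> (S *\<^sub>v v) = (1 / 2) * (v \<bullet> (M *\<^sub>v v) + v \<bullet> (transpose_mat M *\<^sub>v v))"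
    using M v by (simp add: scalar_prod_add_distrib[of _ n])
  also have "v \<bullet> (transpose_mat M *\<^sub>v v) = v \<bullet> (M *\<^sub>v v)"
    using scalar_prod_transpose[of "transpose_mat M" n n v v] M v by (simp add: comm_scalar_prod[of _ n])
  finally show "v \<bullet> (S *\<^sub>v v) = v \<bullet> (M *\<^sub>v v)" by simp
qed

text \<open>The Gram matrix makes the squared norms in the second-order term a quadratic form, ready
  for the Chernoff bound. Its eigenvalues lie between 0 and \<open>b\<^sup>2\<close>, so the sum of
  their squares is at most \<open>b\<^sup>2\<close> times their sum.\<close>

lemma gram_mat:
  fixes M :: "real mat"
  assumes M: "M \<in> carrier_mat n n" and b: "opb n M b" "0 \<le> b"
  defines "S \<equiv> transpose_mat M * M"
  shows "S \<in> carrier_mat n n" "transpose_mat S = S" "tr S = frob2 M" "frob2 S \<le> b\<^sup>2 * frob2 M"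
    "v \<in> carrier_vec n \<Longrightarrow> v \<bullet> (S *\<^sub>v v) = (nrm (M *\<^sub>v v))\<^sup>2"
    "v \<in> carrier_vec n \<Longrightarrow> \<bar>v \<bullet> (S *\<^sub>v v)\<bar> \<le> b\<^sup>2 * (v \<bullet> v)"
proof -
  show Sc: "S \<in> carrier_mat n n" using M by (simp add: S_def)
  show Ss: "transpose_mat S = S" using M by (simp add: S_def square_transpose[where n = n])
  show tS: "tr S = frob2 M" using frob2_tr[OF M] by (simp add: S_def)
  show q: "v \<bullet> (S *\<^sub>v v) = (nrm (M *\<^sub>v v))\<^sup>2" if v: "v \<in> carrier_vec n" for v
    using scalar_prod_transpose[of "transpose_mat M" n n v "M *\<^sub>v v"] M v
    by (simp add: S_def nrm_sq assoc_mult_mat_vec[of _ n n _ n])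
  show bb: "\<bar>v \<bullet> (S *\<^sub>v v)\<bar> \<le> b\<^sup>2 * (v \<bullet> v)" if v: "v \<in> carrier_vec n" for v
  proof -
    have "(nrm (M *\<^sub>v v))\<^sup>2 \<le> (b * nrm v)\<^sup>2" using b v by (intro power_mono) (auto simp: opb_def)
    then show ?thesis unfolding q[OF v] abs_power2 by (simp add: power_mult_distrib nrm_sq)
  qed
  obtain W \<mu> where W: "orth_mat n W" "S = spec n W \<mu>" by (rule spectral_theorem[OF Sc Ss])
  have \<mu>: "\<bar>\<mu> j\<bar> \<le> b\<^sup>2" if "j < n" for j using spectral_eigenvalue_bound[OF W(1) _ that] bb W(2) by blast
  have "0 \<le> \<mu> j" if j: "j < n" for j
  proof -
    obtain v where "v \<in> carrier_vec n" "v \<bullet> (S *\<^sub>v v) = \<mu> j"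
      using spec_quad_eigenvector[OF W(1) j] unfolding W(2) by metis
    then show ?thesis using q by (metis zero_le_power2)
  qed
  then have "(\<Sum>j<n. (\<mu> j)\<^sup>2) \<le> (\<Sum>j<n. b\<^sup>2 * \<mu> j)"
    using \<mu> by (intro sum_mono) (auto simp: power2_eq_square intro!: mult_right_mono)
  then show "frob2 S \<le> b\<^sup>2 * frob2 M"
    unfolding tS[symmetric] unfolding W(2) frob2_spec[OF W(1)] tr_spec[OF W(1)] by (simp add: sum_distrib_left)
qed

lemma smult_mat_mult_vec:
  fixes A :: "real mat"
  assumes "v \<in> carrier_vec n" "A \<in> carrier_mat m n"
  shows "(c \<cdot>\<^sub>m A) *\<^sub>v v = c \<cdot>\<^sub>v (A *\<^sub>v v)"
  using assms by (intro eq_vecI) (auto simp: scalar_prod_def sum_distrib_left mult.assoc)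

text \<open>\<open>\<kappa>\<close> is the price for passing from the normalized Frobenius norm to
  the operator norm. \<open>L_frob\<close> is an inequality because the parametrization used later
  has a kernel; the lower bound \<open>hessian_net\<close> asks for equality at the point
  concerned.\<close>

locale linear_family =
  fixes D :: nat and E :: "'e set" and L :: "('e \<Rightarrow> real) \<Rightarrow> real mat" and \<kappa> :: real
  assumes E: "finite E" "E \<noteq> {}" and D: "0 < D" and \<kappa>: "0 < \<kappa>"
    and L_carrier [simp]: "\<And>p. L p \<in> carrier_mat D D"
    and L_add: "\<And>p q. L (\<lambda>e. p e + q e) = L p + L q"
    and L_scale: "\<And>c p. L (\<lambda>e. c * p e) = c \<cdot>\<^sub>m L p"
    and L_frob: "\<And>p. frob2 (L p) \<le> D * (L2_set p E)\<^sup>2"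
    and L_op: "\<And>p. opb D (L p) (sqrt \<kappa> * L2_set p E)"
begin

lemma L_op_le_1:
  assumes "L2_set p E \<le> 1" "v \<in> carrier_vec D"
  shows "nrm (L p *\<^sub>v v) \<le> sqrt \<kappa> * nrm v"
proof -
  have "nrm (L p *\<^sub>v v) \<le> sqrt \<kappa> * L2_set p E * nrm v" using L_op assms by (auto simp: opb_def)
  also have "\<dots> \<le> sqrt \<kappa> * 1 * nrm v" using assms \<kappa> by (intro mult_right_mono mult_left_mono) auto
  finally show ?thesis by simp
qed

text \<open>The deviation of the quadratic sum from its mean is linear in \<open>p\<close>, so its
  absolute value is a seminorm. The a priori constant is crude and depends on the samples, which
  \<open>seminorm_net\<close> permits.\<close>

lemma gradient_net:
  assumes y: "\<And>i. i < n \<Longrightarrow> y i \<in> carrier_vec D"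
    and net: "\<And>k. k \<in> grid E \<Longrightarrow> L2_set (grid_point E k) E \<le> 1 \<Longrightarrow>
      \<bar>total_quad n y (L (grid_point E k)) - real n * tr (L (grid_point E k))\<bar> \<le> B"
  shows "\<bar>total_quad n y (L p) - real n * tr (L p)\<bar> \<le> 4 / 3 * B * L2_set p E"
proof (rule seminorm_net[where Q = "\<lambda>p. \<bar>total_quad n y (L p) - real n * tr (L p)\<bar>"])
  fix p q :: "'e \<Rightarrow> real" and c :: real
  have "total_quad n y (L (\<lambda>e. p e + q e)) = total_quad n y (L p) + total_quad n y (L q)"
    unfolding L_add sum.distrib[symmetric] using y
    by (intro sum.cong refl) (simp add: add_mult_distrib_mat_vec[of _ D D] scalar_prod_add_distrib[of _ D])
  then show "\<bar>total_quad n y (L (\<lambda>e. p e + q e)) - real n * tr (L (\<lambda>e. p e + q e))\<bar>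
    \<le> \<bar>total_quad n y (L p) - real n * tr (L p)\<bar> + \<bar>total_quad n y (L q) - real n * tr (L q)\<bar>"
    by (simp add: L_add tr_add[of _ D] distrib_left)
  have "(c \<cdot>\<^sub>m L p) *\<^sub>v y i = c \<cdot>\<^sub>v (L p *\<^sub>v y i)" if "i < n" for i
    using y[OF that] L_carrier[of p] by (rule smult_mat_mult_vec)
  then have "total_quad n y (L (\<lambda>e. c * p e)) = c * total_quad n y (L p)"
    unfolding L_scale sum_distrib_left using y L_carrier[of p] by (intro sum.cong refl) (auto simp: scalar_prod_smult_distrib[of _ D])
  then show "\<bar>total_quad n y (L (\<lambda>e. c * p e)) - real n * tr (L (\<lambda>e. c * p e))\<bar>
    = \<bar>c\<bar> * \<bar>total_quad n y (L p) - real n * tr (L p)\<bar>"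
    by (simp add: L_scale tr_smult[of _ D] abs_mult[symmetric] right_diff_distrib mult.left_commute)
  have 1: "\<bar>\<Sum>i<n. y i \<bullet> (L p *\<^sub>v y i)\<bar> \<le> (\<Sum>i<n. sqrt \<kappa> * L2_set p E * (nrm (y i))\<^sup>2)"
  proof (rule order_trans[OF sum_abs], intro sum_mono)
    fix i assume "i \<in> {..<n}"
    then have yi: "y i \<in> carrier_vec D" using y by simp
    have "\<bar>y i \<bullet> (L p *\<^sub>v y i)\<bar> \<le> nrm (y i) * nrm (L p *\<^sub>v y i)"
      using yi by (intro abs_scalar_prod_le[of _ D]) auto
    also have "\<dots> \<le> nrm (y i) * (sqrt \<kappa> * L2_set p E * nrm (y i))"
      using L_op[of p] yi by (intro mult_left_mono) (auto simp: opb_def)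
    finally show "\<bar>y i \<bullet> (L p *\<^sub>v y i)\<bar> \<le> sqrt \<kappa> * L2_set p E * (nrm (y i))\<^sup>2"
      by (simp add: power2_eq_square mult_ac)
  qed
  have 2: "\<bar>tr (L p)\<bar> \<le> D * L2_set p E"
  proof -
    have "sqrt (frob2 (L p)) \<le> sqrt (D * (L2_set p E)\<^sup>2)" using L_frob by simp
    then have "sqrt (frob2 (L p)) \<le> sqrt D * L2_set p E" by (simp add: real_sqrt_mult L2_set_nonneg)
    then have "sqrt D * sqrt (frob2 (L p)) \<le> sqrt D * (sqrt D * L2_set p E)" by (intro mult_left_mono) auto
    then show ?thesis using abs_tr_le[OF L_carrier[of p]] by (simp add: mult.assoc[symmetric])
  qed
  have "\<bar>total_quad n y (L p) - real n * tr (L p)\<bar> \<le> \<bar>\<Sum>i<n. y i \<bullet> (L p *\<^sub>v y i)\<bar> + real n * \<bar>tr (L p)\<bar>"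
    by (rule order_trans[OF abs_triangle_ineq4]) (simp add: abs_mult)
  also have "\<dots> \<le> (\<Sum>i<n. sqrt \<kappa> * L2_set p E * (nrm (y i))\<^sup>2) + real n * (D * L2_set p E)"
    using 1 2 by (intro add_mono mult_left_mono) auto
  also have "\<dots> = (sqrt \<kappa> * (\<Sum>i<n. (nrm (y i))\<^sup>2) + real n * D) * L2_set p E"
    unfolding sum_distrib_left[symmetric] by (simp add: algebra_simps)
  finally show "\<bar>total_quad n y (L p) - real n * tr (L p)\<bar>
    \<le> (sqrt \<kappa> * (\<Sum>i<n. (nrm (y i))\<^sup>2) + real n * D) * L2_set p E" .
qed (use E net in auto)

end

context linear_family
begin

text \<open>The square root \<open>Q\<close> of the second-order term is a seminorm. The net first
  yields an upper bound for \<open>Q\<close> everywhere; this upper bound then controls the rounding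
  error when the lower bound on the net is carried over to an arbitrary direction.\<close>

lemma hessian_net:
  assumes y: "\<And>i. i < n \<Longrightarrow> y i \<in> carrier_vec D"
    and net: "\<And>k. k \<in> grid E \<Longrightarrow> L2_set (grid_point E k) E \<le> 1 \<Longrightarrow>
      \<bar>total_sq n y (L (grid_point E k)) - real n * frob2 (L (grid_point E k))\<bar> \<le> real n * D / 16"
    and p: "frob2 (L p) = D * (L2_set p E)\<^sup>2"
  shows "real n * D * (L2_set p E)\<^sup>2 / 8 \<le> total_sq n y (L p)"
proof -
  define Q where "Q p = L2_set (\<lambda>i. nrm (L p *\<^sub>v y i)) {..<n}" for p
  define N where "N = sqrt (real n * D)"
  have N: "0 \<le> N" "N\<^sup>2 = real n * D" by (auto simp: N_def)
  have Q2: "(Q p)\<^sup>2 = total_sq n y (L p)" for p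
    by (simp add: Q_def L2_set_def sum_nonneg)
  have Q0: "0 \<le> Q p" for p by (simp add: Q_def L2_set_nonneg)
  have add: "Q (\<lambda>e. p e + q e) \<le> Q p + Q q" for p q
  proof -
    have "Q (\<lambda>e. p e + q e) \<le> L2_set (\<lambda>i. nrm (L p *\<^sub>v y i) + nrm (L q *\<^sub>v y i)) {..<n}"
      unfolding Q_def L_add using y
      by (intro L2_set_mono) (auto simp: add_mult_distrib_mat_vec[of _ D D] intro!: nrm_triangle[of _ D])
    also have "\<dots> \<le> Q p + Q q" unfolding Q_def by (rule L2_set_triangle_ineq)
    finally show ?thesis .
  qed
  have scale: "Q (\<lambda>e. c * p e) = \<bar>c\<bar> * Q p" for c p
  proof -
    have "Q (\<lambda>e. c * p e) = L2_set (\<lambda>i. \<bar>c\<bar> * nrm (L p *\<^sub>v y i)) {..<n}"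
      unfolding Q_def L_scale using y
      by (intro L2_set_cong) (auto simp: smult_mat_mult_vec[OF _ L_carrier] nrm_smult)
    also have "\<dots> = \<bar>c\<bar> * Q p"
      unfolding Q_def L2_set_def power_mult_distrib sum_distrib_left[symmetric] by (simp add: real_sqrt_mult)
    finally show ?thesis .
  qed
  have bound: "Q p \<le> (sqrt \<kappa> * L2_set (\<lambda>i. nrm (y i)) {..<n}) * L2_set p E" for p
  proof -
    have "Q p \<le> L2_set (\<lambda>i. sqrt \<kappa> * L2_set p E * nrm (y i)) {..<n}"
      unfolding Q_def using L_op[of p] y by (intro L2_set_mono) (auto simp: opb_def)
    also have "\<dots> = (sqrt \<kappa> * L2_set p E) * L2_set (\<lambda>i. nrm (y i)) {..<n}"
      unfolding L2_set_def power_mult_distrib sum_distrib_left[symmetric]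
      using \<kappa> by (simp add: real_sqrt_mult sum_nonneg)
    finally show ?thesis by (simp add: mult_ac)
  qed
  \<comment> \<open>The factor \<open>33 / 32\<close> is a rational upper bound for the square root
    of \<open>1 + 1 / 16\<close>.\<close>
  have up: "Q (grid_point E k) \<le> 33 / 32 * N" if k: "k \<in> grid E" "L2_set (grid_point E k) E \<le> 1" for k
  proof -
    have "frob2 (L (grid_point E k)) \<le> D * (L2_set (grid_point E k) E)\<^sup>2" by (rule L_frob)
    also have "\<dots> \<le> real D * 1" using k(2) by (intro mult_left_mono power_le_one L2_set_nonneg) auto
    finally have "real n * frob2 (L (grid_point E k)) \<le> real n * D" by (intro mult_left_mono) auto
    then have "(Q (grid_point E k))\<^sup>2 \<le> real n * D + real n * D / 16" using net[OF k] unfolding Q2 by linarith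
    also have "\<dots> \<le> (33 / 32 * N)\<^sup>2" unfolding power_mult_distrib N(2) by (simp add: power2_eq_square)
    finally show ?thesis by (rule power2_le_imp_le) (use N(1) in simp)
  qed
  have all: "Q p \<le> 4 / 3 * (33 / 32 * N) * L2_set p E" for p
    by (rule seminorm_net[OF E add scale bound up])
  have L2s: "L2_set (\<lambda>e. c * p e) E = \<bar>c\<bar> * L2_set p E" for c p
    unfolding L2_set_def power_mult_distrib sum_distrib_left[symmetric] by (simp add: real_sqrt_mult)
  \<comment> \<open>The grid point \<open>z\<close> next to \<open>p\<close> keeps
    \<open>3 / 4\<close> of the Frobenius norm, so \<open>(Q z)\<^sup>2\<close> is at least
    \<open>9 / 16 - 1 / 16 = 1 / 2\<close> of \<open>N\<^sup>2\<close> and \<open>Q z\<close> at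
    least \<open>7 / 10\<close> of \<open>N\<close>. Rounding costs
    \<open>4 / 3 * 33 / 32 / 4 = 11 / 32\<close>; more than \<open>89 / 250\<close> remains, and its
    square exceeds \<open>1 / 8\<close>.\<close>
  have low: "(89 / 250) * N \<le> Q p" if p1: "L2_set p E = 1" and fp: "frob2 (L p) = D" for p
  proof -
    obtain k where k: "k \<in> grid E" "L2_set (grid_point E k) E \<le> 1" "L2_set (\<lambda>e. p e - grid_point E k e) E \<le> 1 / 4"
      using grid_approx[OF E, of p] p1 by auto
    define z where "z = grid_point E k"
    have split: "L p = L (\<lambda>e. p e - z e) + L z" using L_add[of "\<lambda>e. p e - z e" z] by simp
    have "sqrt D \<le> sqrt (frob2 (L (\<lambda>e. p e - z e))) + sqrt (frob2 (L z))"
      using frob_triangle[of "L (\<lambda>e. p e - z e)" D D "L z"] fp split by simp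
    moreover have "sqrt (frob2 (L (\<lambda>e. p e - z e))) \<le> sqrt D * (1 / 4)"
    proof -
      have "sqrt (frob2 (L (\<lambda>e. p e - z e))) \<le> sqrt (D * (L2_set (\<lambda>e. p e - z e) E)\<^sup>2)"
        using L_frob by (rule real_sqrt_le_mono)
      also have "\<dots> = sqrt D * L2_set (\<lambda>e. p e - z e) E" by (simp add: real_sqrt_mult L2_set_nonneg)
      also have "\<dots> \<le> sqrt D * (1 / 4)" using k(3) by (intro mult_left_mono) (auto simp: z_def)
      finally show ?thesis .
    qed
    ultimately have "sqrt D * (3 / 4) \<le> sqrt (frob2 (L z))" by simp
    then have "(sqrt D * (3 / 4))\<^sup>2 \<le> (sqrt (frob2 (L z)))\<^sup>2" by (intro power_mono) auto
    then have "9 / 16 * D \<le> frob2 (L z)" by (simp add: power_mult_distrib power_divide)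
    then have "real n * (9 / 16 * D) \<le> real n * frob2 (L z)" by (intro mult_left_mono) auto
    moreover have "real n * frob2 (L z) - (Q z)\<^sup>2 \<le> real n * D / 16"
      using net[OF k(1,2)] unfolding Q2 z_def abs_le_iff by simp
    ultimately have "real n * D / 2 \<le> (Q z)\<^sup>2" by (simp add: mult.left_commute)
    moreover have "(7 / 10 * N)\<^sup>2 \<le> real n * D / 2" unfolding power_mult_distrib N(2) by (simp add: power2_eq_square)
    ultimately have "(7 / 10 * N)\<^sup>2 \<le> (Q z)\<^sup>2" by linarith
    then have "7 / 10 * N \<le> Q z" using Q0 by (rule power2_le_imp_le)
    moreover have "Q z \<le> Q p + Q (\<lambda>e. p e - z e)"
      using add[of p "\<lambda>e. (- 1) * (p e - z e)"] scale[of "- 1" "\<lambda>e. p e - z e"] by simp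
    moreover have "Q (\<lambda>e. p e - z e) \<le> 4 / 3 * (33 / 32 * N) * (1 / 4)"
      using k(3) N by (intro order_trans[OF all] mult_left_mono) (auto simp: z_def)
    ultimately show ?thesis using N(1) by simp
  qed
  show ?thesis
  proof (cases "L2_set p E = 0")
    case True
    then show ?thesis by (simp add: sum_nonneg)
  next
    case False
    then have l: "0 < L2_set p E" using L2_set_nonneg[of p E] by linarith
    let ?c = "inverse (L2_set p E)"
    have "(89 / 250) * N \<le> Q (\<lambda>e. ?c * p e)"
    proof (rule low)
      show "L2_set (\<lambda>e. ?c * p e) E = 1" using l by (simp add: L2s)
      show "frob2 (L (\<lambda>e. ?c * p e)) = D" using l by (simp add: L_scale frob2_smult p power_inverse)
    qed
    then have "(89 / 250) * N * L2_set p E \<le> Q p" unfolding scale using l by (simp add: field_simps)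
    then have "((89 / 250) * N * L2_set p E)\<^sup>2 \<le> (Q p)\<^sup>2" using N l by (intro power_mono) auto
    moreover have "real n * D * (L2_set p E)\<^sup>2 / 8 \<le> ((89 / 250) * N * L2_set p E)\<^sup>2"
      unfolding power_mult_distrib N(2) by (simp add: power2_eq_square)
    ultimately show ?thesis unfolding Q2 by simp
  qed
qed

end

section \<open>Net bounds that hold with high probability\<close>

context normal_sample
begin

lemma chernoff_abs:
  assumes M: "M \<in> carrier_mat D D" "transpose_mat M = M"
    and b: "\<And>v. v \<in> carrier_vec D \<Longrightarrow> \<bar>v \<bullet> (M *\<^sub>v v)\<bar> \<le> b * (v \<bullet> v)"
    and F: "frob2 M \<le> F" and s: "0 \<le> s" "4 * s * b \<le> 1"
  shows "measure P {x \<in> space P. u \<le> \<bar>sum_quad x M - real n * tr M\<bar>} \<le> 2 * exp (- s * u + 4 * s\<^sup>2 * real n * F)"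
    "{x \<in> space P. u \<le> \<bar>sum_quad x M - real n * tr M\<bar>} \<in> sets P"
proof -
  let ?M = "(- 1) \<cdot>\<^sub>m M"
  define q where "q x = sum_quad x M" for x
  have qm: "q \<in> borel_measurable P" unfolding q_def by (rule quad_sample_measurable[OF M(1)])
  then have m: "{x \<in> space P. u \<le> q x - real n * tr M} \<in> sets P" "{x \<in> space P. u \<le> - (q x - real n * tr M)} \<in> sets P"
    by measurable
  have neg: "v \<bullet> (?M *\<^sub>v v) = - (v \<bullet> (M *\<^sub>v v))" if "v \<in> carrier_vec D" for v
    using that M(1) by (simp add: smult_mat_mult_vec[of _ D _ D])
  have "measure P {x \<in> space P. u \<le> sum_quad x (?M) - real n * tr ?M} \<le> exp (- s * u + 4 * s\<^sup>2 * real n * F)"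
  proof (rule chernoff[OF _ _ _ _ s])
    show "transpose_mat ?M = ?M" using M by (intro eq_matI) (auto, metis carrier_matD index_transpose_mat(1))
    show "\<bar>v \<bullet> (?M *\<^sub>v v)\<bar> \<le> b * (v \<bullet> v)" if "v \<in> carrier_vec D" for v
      unfolding neg[OF that] using b[OF that] by simp
    show "frob2 ?M \<le> F" using F unfolding frob2_smult by simp
  qed (use M in auto)
  then have 1: "measure P {x \<in> space P. u \<le> - (q x - real n * tr M)} \<le> exp (- s * u + 4 * s\<^sup>2 * real n * F)"
    unfolding neg[OF Y_carrier] tr_smult[OF M(1)] by (simp add: sum_negf q_def)
  have 2: "measure P {x \<in> space P. u \<le> q x - real n * tr M} \<le> exp (- s * u + 4 * s\<^sup>2 * real n * F)"
    unfolding q_def by (rule chernoff[OF M b F s])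
  have eq: "{x \<in> space P. u \<le> \<bar>q x - real n * tr M\<bar>} =
    {x \<in> space P. u \<le> q x - real n * tr M} \<union> {x \<in> space P. u \<le> - (q x - real n * tr M)}" by (auto simp: abs_if split: if_splits)
  show "{x \<in> space P. u \<le> \<bar>sum_quad x M - real n * tr M\<bar>} \<in> sets P"
    unfolding q_def[symmetric] eq using m by (rule sets.Un)
  show "measure P {x \<in> space P. u \<le> \<bar>sum_quad x M - real n * tr M\<bar>} \<le> 2 * exp (- s * u + 4 * s\<^sup>2 * real n * F)"
    unfolding q_def[symmetric] eq using measure_Un_le[OF m] 1 2 by simp
qed

text \<open>Each net point has one bad event for the slope, tested on the symmetric part, and one
  for the second-order term, tested on the Gram matrix. Outside the union of these finitely many
  events the deterministic net lemmas serve all \<open>p\<close> at once.\<close>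

lemma good_event:
  assumes fam: "linear_family D E L \<kappa>" and \<epsilon>: "0 \<le> \<epsilon>" "\<epsilon> * sqrt \<kappa> \<le> 2"
  shows "\<exists>G \<in> sets P. 1 - exp (18 * card E) * (2 * exp (- (\<epsilon>\<^sup>2 * (real n * D) / 16)) + 2 * exp (- (real n * D / (4096 * \<kappa>)))) \<le> measure P G \<and>
    (\<forall>x \<in> G. \<forall>p. \<bar>sum_quad x (L p) - real n * tr (L p)\<bar> \<le> 4 / 3 * (\<epsilon> * (real n * D)) * L2_set p E \<and>
      (frob2 (L p) = D * (L2_set p E)\<^sup>2 \<longrightarrow> real n * D * (L2_set p E)\<^sup>2 / 8 \<le> sum_sq x (L p)))"
proof -
  interpret linear_family D E L \<kappa> by (rule fam)
  define K where "K = {k \<in> grid E. L2_set (grid_point E k) E \<le> 1}"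
  have finK: "finite K" unfolding K_def using finite_grid[OF E(1)] by simp
  have cardK: "card K \<le> exp (18 * card E)"
  proof -
    have "card K \<le> card (grid E)" unfolding K_def by (intro card_mono finite_grid E) auto
    then show ?thesis using card_grid_le[OF E(1)] by linarith
  qed
  define S where "S k = (1 / 2) \<cdot>\<^sub>m (L (grid_point E k) + transpose_mat (L (grid_point E k)))" for k
  define T where "T k = transpose_mat (L (grid_point E k)) * L (grid_point E k)" for k
  define A where "A k = {x \<in> space P. \<epsilon> * (real n * D) \<le> \<bar>sum_quad x (S k) - real n * tr (S k)\<bar>}" for k
  define B where "B k = {x \<in> space P. real n * D / 16 \<le> \<bar>sum_quad x (T k) - real n * tr (T k)\<bar>}" for k
  have op: "opb D (L (grid_point E k)) (sqrt \<kappa>)" if "k \<in> K" for k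
    using L_op_le_1 that by (auto simp: opb_def K_def)
  have fr: "frob2 (L (grid_point E k)) \<le> D" if "k \<in> K" for k
  proof -
    have "frob2 (L (grid_point E k)) \<le> D * (L2_set (grid_point E k) E)\<^sup>2" by (rule L_frob)
    also have "\<dots> \<le> real D * 1" using that by (intro mult_left_mono power_le_one L2_set_nonneg) (auto simp: K_def)
    finally show ?thesis by simp
  qed
  have A: "A k \<in> sets P" "measure P (A k) \<le> 2 * exp (- (\<epsilon>\<^sup>2 * (real n * D) / 16))" if k: "k \<in> K" for k
  proof -
    note sp = sym_part[OF L_carrier[of "grid_point E k"], folded S_def]
    have c: "S k \<in> carrier_mat D D" "transpose_mat (S k) = S k" using sp by auto
    have b: "\<bar>v \<bullet> (S k *\<^sub>v v)\<bar> \<le> sqrt \<kappa> * (v \<bullet> v)" if v: "v \<in> carrier_vec D" for v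
    proof -
      have "\<bar>v \<bullet> (S k *\<^sub>v v)\<bar> \<le> nrm v * nrm (L (grid_point E k) *\<^sub>v v)"
        unfolding sp(5)[OF v] using v by (intro abs_scalar_prod_le[of _ D]) auto
      also have "\<dots> \<le> nrm v * (sqrt \<kappa> * nrm v)" using op[OF k] v by (intro mult_left_mono) (auto simp: opb_def)
      finally show ?thesis by (simp add: nrm_sq[symmetric] power2_eq_square mult_ac)
    qed
    have F: "frob2 (S k) \<le> D" using sp(4) fr[OF k] by linarith
    \<comment> \<open>\<open>\<epsilon> / 8\<close> minimizes the exponent:
      \<open>- 1 / 8 + 4 / 64 = - 1 / 16\<close> in units of
      \<open>\<epsilon>\<^sup>2 * n * D\<close>.\<close>
    have s: "0 \<le> \<epsilon> / 8" "4 * (\<epsilon> / 8) * sqrt \<kappa> \<le> 1" using \<epsilon> by auto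
    note ch = chernoff_abs[OF c b F s, of "\<epsilon> * (real n * D)"]
    show "A k \<in> sets P" unfolding A_def by (rule ch(2))
    have "- (\<epsilon> / 8) * (\<epsilon> * (real n * D)) + 4 * (\<epsilon> / 8)\<^sup>2 * real n * D = - (\<epsilon>\<^sup>2 * (real n * D) / 16)"
      by (simp add: power2_eq_square)
    then show "measure P (A k) \<le> 2 * exp (- (\<epsilon>\<^sup>2 * (real n * D) / 16))" unfolding A_def using ch(1) by simp
  qed
  have B: "B k \<in> sets P" "measure P (B k) \<le> 2 * exp (- (real n * D / (4096 * \<kappa>)))" if k: "k \<in> K" for k
  proof -
    have s0: "0 \<le> sqrt \<kappa>" using \<kappa> by simp
    note g = gram_mat[OF L_carrier op[OF k] s0, folded T_def]
    have k2: "(sqrt \<kappa>)\<^sup>2 = \<kappa>" using \<kappa> by simp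
    have F: "frob2 (T k) \<le> \<kappa> * D"
      using g(4) mult_left_mono[OF fr[OF k], of \<kappa>] \<kappa> unfolding k2 by linarith
    \<comment> \<open>The minimizer of the exponent for deviation \<open>n * D / 16\<close> and
      squared Frobenius norm \<open>\<kappa> * D\<close>; the exponent is
      \<open>- 1 / 2048 + 1 / 4096\<close> in units of \<open>n * D / \<kappa>\<close>.\<close>
    have s: "0 \<le> 1 / (128 * \<kappa>)" "4 * (1 / (128 * \<kappa>)) * \<kappa> \<le> 1" using \<kappa> by (auto simp: field_simps)
    note ch = chernoff_abs[OF g(1,2) g(6)[unfolded k2] F s, of "real n * D / 16"]
    show "B k \<in> sets P" unfolding B_def by (rule ch(2))
    have "- (1 / (128 * \<kappa>)) * (real n * D / 16) + 4 * (1 / (128 * \<kappa>))\<^sup>2 * real n * (\<kappa> * D) = - (real n * D / (4096 * \<kappa>))"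
      using \<kappa> by (simp add: power2_eq_square field_simps)
    then show "measure P (B k) \<le> 2 * exp (- (real n * D / (4096 * \<kappa>)))" unfolding B_def using ch(1) by simp
  qed
  define bad where "bad = (\<Union>k\<in>K. A k \<union> B k)"
  have badm: "bad \<in> sets P" unfolding bad_def using A B finK by (intro sets.finite_UN) auto
  define t where "t = 2 * exp (- (\<epsilon>\<^sup>2 * (real n * D) / 16)) + 2 * exp (- (real n * D / (4096 * \<kappa>)))"
  have "measure P bad \<le> (\<Sum>k\<in>K. measure P (A k \<union> B k))"
    unfolding bad_def using A B finK by (intro P.finite_measure_subadditive_finite) auto
  also have "\<dots> \<le> (\<Sum>k\<in>K. t)"
  proof (rule sum_mono)
    fix k assume k: "k \<in> K"
    show "measure P (A k \<union> B k) \<le> t" using measure_Un_le[OF A(1)[OF k] B(1)[OF k]] A(2)[OF k] B(2)[OF k] by (simp add: t_def)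
  qed
  also have "\<dots> \<le> exp (18 * card E) * t" using cardK by (simp add: t_def mult_right_mono)
  finally have "1 - exp (18 * card E) * t \<le> measure P (space P - bad)"
    using P.prob_compl[OF badm] by simp
  moreover have "\<bar>sum_quad x (L p) - real n * tr (L p)\<bar> \<le> 4 / 3 * (\<epsilon> * (real n * D)) * L2_set p E \<and>
      (frob2 (L p) = D * (L2_set p E)\<^sup>2 \<longrightarrow> real n * D * (L2_set p E)\<^sup>2 / 8 \<le> sum_sq x (L p))"
    if x: "x \<in> space P - bad" for x p
  proof
    have kx: "x \<notin> A k" "x \<notin> B k" if "k \<in> grid E" "L2_set (grid_point E k) E \<le> 1" for k
      using x that by (auto simp: bad_def K_def)
    show "\<bar>sum_quad x (L p) - real n * tr (L p)\<bar> \<le> 4 / 3 * (\<epsilon> * (real n * D)) * L2_set p E"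
    proof (rule gradient_net)
      show "Y (x i) \<in> carrier_vec D" for i by (rule Y_carrier)
      fix k assume k: "k \<in> grid E" "L2_set (grid_point E k) E \<le> 1"
      show "\<bar>sum_quad x (L (grid_point E k)) - real n * tr (L (grid_point E k))\<bar> \<le> \<epsilon> * (real n * D)"
      proof -
        note sp = sym_part[OF L_carrier[of "grid_point E k"], folded S_def]
        have "sum_quad x (S k) = sum_quad x (L (grid_point E k))"
          by (intro sum.cong refl sp(5) Y_carrier)
        moreover have "x \<in> space P" "x \<notin> A k" using x kx(1)[OF k] by blast+
        ultimately show ?thesis unfolding A_def sp(3) mem_Collect_eq by linarith
      qed
    qed
    show "frob2 (L p) = D * (L2_set p E)\<^sup>2 \<longrightarrow> real n * D * (L2_set p E)\<^sup>2 / 8 \<le> sum_sq x (L p)"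
    proof
      assume fp: "frob2 (L p) = D * (L2_set p E)\<^sup>2"
      show "real n * D * (L2_set p E)\<^sup>2 / 8 \<le> sum_sq x (L p)"
      proof (rule hessian_net[where y = "\<lambda>i. Y (x i)" and n = n, OF _ _ fp])
        show "Y (x i) \<in> carrier_vec D" for i by (rule Y_carrier)
        fix k assume k: "k \<in> grid E" "L2_set (grid_point E k) E \<le> 1"
        have s0: "0 \<le> sqrt \<kappa>" using \<kappa> by simp
        have kK: "k \<in> K" using k unfolding K_def by blast
        note g = gram_mat[OF L_carrier op[OF kK] s0, folded T_def]
        have "sum_quad x (T k) = sum_sq x (L (grid_point E k))"
          by (intro sum.cong refl g(5) Y_carrier)
        moreover have "x \<in> space P" "x \<notin> B k" using x kx(2)[OF k] by blast+
        ultimately show "\<bar>sum_sq x (L (grid_point E k)) - real n * frob2 (L (grid_point E k))\<bar> \<le> real n * D / 16"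
          unfolding B_def g(3) mem_Collect_eq by linarith
      qed
    qed
  qed
  moreover have "space P - bad \<in> sets P" using badm by (rule sets.compl_sets)
  ultimately show ?thesis unfolding t_def by blast
qed

end

section \<open>The space of Kronecker sums\<close>

lemma frob2_add_scalar:
  assumes "A \<in> carrier_mat n n"
  shows "frob2 (A + c \<cdot>\<^sub>m 1\<^sub>m n) = frob2 A + 2 * c * tr A + c\<^sup>2 * n"
proof -
  have "frob2 (A + c \<cdot>\<^sub>m 1\<^sub>m n) = (\<Sum>i<n. \<Sum>j<n. (A $$ (i, j))\<^sup>2 + (if i = j then 1 else 0) * (2 * c * A $$ (i, j) + c\<^sup>2))"
    using assms unfolding frob2_def by (auto intro!: sum.cong simp: power2_sum)
  also have "\<dots> = frob2 A + (\<Sum>i<n. 2 * c * A $$ (i, i) + c\<^sup>2)"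
    using assms by (simp add: sum.distrib sum_delta_mult frob2_def)
  also have "\<dots> = frob2 A + 2 * c * tr A + c\<^sup>2 * n"
    using assms by (simp add: tr_def sum.distrib sum_distrib_left)
  finally show ?thesis .
qed

lemma opb_mono: "opb n A b \<Longrightarrow> b \<le> c \<Longrightarrow> opb n A c"
  unfolding opb_def by (meson mult_right_mono nrm_nonneg order_trans)

locale tensor_dims =
  fixes k :: nat and d :: "nat \<Rightarrow> nat"
  assumes k: "1 \<le> k" and d: "\<And>a. a < k \<Longrightarrow> 1 \<le> d a"
begin

definition xs :: "nat list" where "xs = [0..<k]"
definition D :: nat where "D = pdim d xs"
definition dmax :: nat where "dmax = Max (d ` {..<k})"

lemma set_xs [simp]: "set xs = {..<k}"
  by (auto simp: xs_def)

lemma sum_list_xs: "(\<Sum>a\<leftarrow>xs. f a) = (\<Sum>a<k. f a :: real)"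
  by (simp add: xs_def interv_sum_list_conv_sum_set_nat atLeast0LessThan)

lemma D_pos: "0 < D"
proof -
  have "0 < pdim d ys" if "set ys \<subseteq> {..<k}" for ys
    using that by (induction ys) (auto dest: d)
  then show ?thesis by (simp add: D_def)
qed

lemma d_le_dmax: "a < k \<Longrightarrow> d a \<le> dmax"
  by (simp add: dmax_def)

lemma dmax_pos: "1 \<le> dmax"
  using d_le_dmax[of 0] d[of 0] k by simp

text \<open>Triples with \<open>a < k\<close> address block entries. The extra index
  \<open>(k, 0, 0)\<close>, outside all blocks, carries the common scalar part.\<close>

definition idx :: "(nat \<times> nat \<times> nat) set" where
  "idx = insert (k, 0, 0) (SIGMA a:{..<k}. {..<d a} \<times> {..<d a})"

lemma finite_idx: "finite idx" "idx \<noteq> {}"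
  by (auto simp: idx_def)

lemma card_idx: "card idx \<le> 2 * k * dmax\<^sup>2"
proof -
  have "card (SIGMA a:{..<k}. {..<d a} \<times> {..<d a}) = (\<Sum>a<k. d a * d a)"
    by (simp add: card_cartesian_product)
  also have "\<dots> \<le> (\<Sum>a<k. dmax\<^sup>2)"
    by (intro sum_mono) (simp add: power2_eq_square mult_le_mono d_le_dmax)
  finally have "card idx \<le> 1 + k * dmax\<^sup>2" unfolding idx_def by (subst card.insert) auto
  moreover have "0 < k * dmax\<^sup>2" using k dmax_pos by simp
  ultimately show ?thesis unfolding mult.assoc by linarith
qed

definition blk :: "(nat \<times> nat \<times> nat \<Rightarrow> real) \<Rightarrow> nat \<Rightarrow> real mat" where
  "blk p a = mat (d a) (d a) (\<lambda>(i, j). p (a, i, j))"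

lemma blk_carrier [simp]: "blk p a \<in> carrier_mat (d a) (d a)"
  by (simp add: blk_def)

lemma blk_index [simp]: "i < d a \<Longrightarrow> j < d a \<Longrightarrow> blk p a $$ (i, j) = p (a, i, j)"
  by (simp add: blk_def)

lemma blk_dim [simp]: "dim_row (blk p a) = d a" "dim_col (blk p a) = d a"
  by (simp_all add: blk_def)

lemma L2_set_idx: "(L2_set p idx)\<^sup>2 = (\<Sum>a<k. frob2 (blk p a)) + (p (k, 0, 0))\<^sup>2"
proof -
  have "(L2_set p idx)\<^sup>2 = (\<Sum>e\<in>idx. (p e)\<^sup>2)" by (simp add: L2_set_def sum_nonneg)
  also have "\<dots> = (p (k, 0, 0))\<^sup>2 + (\<Sum>e\<in>(SIGMA a:{..<k}. {..<d a} \<times> {..<d a}). (p e)\<^sup>2)"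
    unfolding idx_def by (subst sum.insert) auto
  also have "(\<Sum>e\<in>(SIGMA a:{..<k}. {..<d a} \<times> {..<d a}). (p e)\<^sup>2) = (\<Sum>a<k. \<Sum>ij\<in>{..<d a} \<times> {..<d a}. (p (a, ij))\<^sup>2)"
    by (subst sum.Sigma) auto
  also have "\<dots> = (\<Sum>a<k. frob2 (blk p a))"
    by (intro sum.cong refl) (simp add: frob2_def blk_def sum.cartesian_product split_def)
  finally show ?thesis by simp
qed

text \<open>The coordinates are the traceless parts of the blocks, scaled by \<open>sqrt (d a)\<close>, and one scalar
  coordinate. With this choice the Frobenius norm of \<open>Lin p\<close> is at most \<open>sqrt D\<close> times the
  Euclidean norm of \<open>p\<close>.\<close>

definition Gen :: "(nat \<times> nat \<times> nat \<Rightarrow> real) \<Rightarrow> nat \<Rightarrow> real mat" where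
  "Gen p a = sqrt (d a) \<cdot>\<^sub>m (blk p a + (- tr (blk p a) / d a) \<cdot>\<^sub>m 1\<^sub>m (d a)) + (p (k, 0, 0) / k) \<cdot>\<^sub>m 1\<^sub>m (d a)"

definition Lin :: "(nat \<times> nat \<times> nat \<Rightarrow> real) \<Rightarrow> real mat" where
  "Lin p = ksum d (Gen p) xs"

lemma Gen_carrier [simp]: "Gen p a \<in> carrier_mat (d a) (d a)"
  by (simp add: Gen_def)

lemma tr_blk: "tr (blk p a) = (\<Sum>i<d a. p (a, i, i))"
  by (simp add: tr_def blk_def)

lemma Lin_carrier: "Lin p \<in> carrier_mat D D"
  unfolding Lin_def D_def by (rule ksum_carrier) simp

lemma Lin_add: "Lin (\<lambda>e. p e + q e) = Lin p + Lin q"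
proof -
  have "Gen (\<lambda>e. p e + q e) a = Gen p a + Gen q a" for a
  proof -
    have t: "tr (blk (\<lambda>e. p e + q e) a) = tr (blk p a) + tr (blk q a)" by (simp add: tr_blk sum.distrib)
    show ?thesis unfolding Gen_def t
      by (rule eq_matI) (auto simp: algebra_simps add_divide_distrib diff_divide_distrib)
  qed
  then have "Gen (\<lambda>e. p e + q e) = (\<lambda>a. Gen p a + Gen q a)" by blast
  then show ?thesis unfolding Lin_def by (simp add: ksum_add)
qed

lemma Lin_scale: "Lin (\<lambda>e. c * p e) = c \<cdot>\<^sub>m Lin p"
proof -
  have "Gen (\<lambda>e. c * p e) a = c \<cdot>\<^sub>m Gen p a" for a
  proof -
    have t: "tr (blk (\<lambda>e. c * p e) a) = c * tr (blk p a)" by (simp add: tr_blk sum_distrib_left)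
    show ?thesis unfolding Gen_def t
      by (rule eq_matI) (auto simp: algebra_simps)
  qed
  then have "Gen (\<lambda>e. c * p e) = (\<lambda>a. c \<cdot>\<^sub>m Gen p a)" by blast
  then show ?thesis unfolding Lin_def by (simp add: ksum_smult)
qed

lemma traceless_blk:
  assumes "a < k"
  shows "tr (blk p a + (- tr (blk p a) / d a) \<cdot>\<^sub>m 1\<^sub>m (d a)) = 0"
    "frob2 (blk p a + (- tr (blk p a) / d a) \<cdot>\<^sub>m 1\<^sub>m (d a)) = frob2 (blk p a) - (tr (blk p a))\<^sup>2 / d a"
  using d[OF assms]
  by (simp_all add: tr_add[of _ "d a"] tr_smult[of _ "d a"] tr_one frob2_add_scalar power2_eq_square field_simps)

lemma tr_Gen: "a < k \<Longrightarrow> tr (Gen p a) / d a = p (k, 0, 0) / k"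
  using d[of a] unfolding Gen_def
  by (simp add: tr_add[of _ "d a"] tr_smult[of _ "d a"] tr_one traceless_blk(1)[simplified] del: tr_add)

text \<open>The factor \<open>sqrt (d a)\<close> in \<open>Gen\<close> cancels the division by
  \<open>d a\<close> in the variance of block \<open>a\<close>, so blocks of different dimensions
  enter the norm with equal weight.\<close>

lemma frob2_Gen:
  assumes "a < k"
  shows "frob2 (Gen p a) / d a - (tr (Gen p a) / d a)\<^sup>2 = frob2 (blk p a) - (tr (blk p a))\<^sup>2 / d a"
proof -
  let ?X = "blk p a + (- tr (blk p a) / d a) \<cdot>\<^sub>m 1\<^sub>m (d a)"
  have "frob2 (Gen p a) = d a * frob2 ?X + (p (k, 0, 0) / k)\<^sup>2 * d a"
    unfolding Gen_def using traceless_blk(1)[OF assms, of p]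
    by (subst frob2_add_scalar) (auto simp: frob2_smult tr_smult[of _ "d a"])
  then show ?thesis
    unfolding tr_Gen[OF assms] traceless_blk(2)[OF assms] using d[OF assms] by (simp add: add_divide_distrib)
qed

lemma frob2_Lin: "frob2 (Lin p) = D * ((\<Sum>a<k. frob2 (blk p a) - (tr (blk p a))\<^sup>2 / d a) + (p (k, 0, 0))\<^sup>2)"
proof -
  have "frob2 (Lin p) / D = (\<Sum>a\<leftarrow>xs. frob2 (Gen p a) / d a - (tr (Gen p a) / d a)\<^sup>2) + (\<Sum>a\<leftarrow>xs. tr (Gen p a) / d a)\<^sup>2"
    unfolding Lin_def D_def by (rule frob2_ksum) (use d in \<open>auto simp: Suc_le_eq\<close>)
  also have "\<dots> = (\<Sum>a<k. frob2 (blk p a) - (tr (blk p a))\<^sup>2 / d a) + (p (k, 0, 0))\<^sup>2"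
  proof -
    have "(\<Sum>a<k. frob2 (Gen p a) / d a - (tr (Gen p a) / d a)\<^sup>2) = (\<Sum>a<k. frob2 (blk p a) - (tr (blk p a))\<^sup>2 / d a)"
      by (rule sum.cong) (auto simp only: frob2_Gen lessThan_iff)
    moreover have "(\<Sum>a<k. tr (Gen p a) / d a) = p (k, 0, 0)" using k by (simp add: tr_Gen)
    ultimately show ?thesis unfolding sum_list_xs by simp
  qed
  finally show ?thesis using D_pos by (simp add: field_simps)
qed

text \<open>Each block's operator norm is bounded by its Frobenius norm, of order
  \<open>sqrt (d a)\<close> in the coordinates. Cauchy-Schwarz over the \<open>k\<close> blocks
  gives \<open>sqrt (k * dmax)\<close>, and adding the scalar coordinate through
  \<open>(x + y)\<^sup>2 \<le> 2 * (x\<^sup>2 + y\<^sup>2)\<close> costs the factor 2.\<close>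

lemma opb_Lin: "opb D (Lin p) (sqrt (2 * real k * dmax) * L2_set p idx)"
proof -
  let ?t = "p (k, 0, 0)"
  have op: "opb (d a) (Gen p a) (sqrt (d a) * sqrt (frob2 (blk p a)) + \<bar>?t / k\<bar>)" if a: "a < k" for a
  proof -
    let ?X = "sqrt (d a) \<cdot>\<^sub>m (blk p a + (- tr (blk p a) / d a) \<cdot>\<^sub>m 1\<^sub>m (d a))"
    have "frob2 ?X \<le> d a * frob2 (blk p a)"
      unfolding frob2_smult traceless_blk(2)[OF a] by (simp add: mult_left_mono)
    then have "sqrt (frob2 ?X) \<le> sqrt (d a) * sqrt (frob2 (blk p a))"
      using real_sqrt_le_mono by (fastforce simp: real_sqrt_mult)
    then have "opb (d a) ?X (sqrt (d a) * sqrt (frob2 (blk p a)))" by (intro opb_mono[OF opb_frob]) auto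
    then show ?thesis unfolding Gen_def by (intro opb_add opb_scalar) auto
  qed
  have "opb D (Lin p) (\<Sum>a\<leftarrow>xs. sqrt (d a) * sqrt (frob2 (blk p a)) + \<bar>?t / k\<bar>)"
    unfolding Lin_def D_def by (rule opb_ksum) (use op in auto)
  moreover have "(\<Sum>a\<leftarrow>xs. sqrt (d a) * sqrt (frob2 (blk p a)) + \<bar>?t / k\<bar>) \<le> sqrt (2 * real k * dmax) * L2_set p idx"
  proof -
    define S where "S = (\<Sum>a<k. sqrt (d a) * sqrt (frob2 (blk p a)))"
    have "(\<Sum>a\<leftarrow>xs. sqrt (d a) * sqrt (frob2 (blk p a)) + \<bar>?t / k\<bar>) = S + \<bar>?t\<bar>"
      unfolding sum_list_xs S_def using k by (simp add: sum.distrib)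
    moreover have "S \<le> sqrt (real k * dmax) * sqrt (\<Sum>a<k. frob2 (blk p a))"
    proof -
      have "S\<^sup>2 \<le> (\<Sum>a<k. (sqrt (d a))\<^sup>2) * (\<Sum>a<k. (sqrt (frob2 (blk p a)))\<^sup>2)"
        unfolding S_def by (rule Cauchy_Schwarz_ineq_sum)
      also have "\<dots> \<le> (real k * dmax) * (\<Sum>a<k. frob2 (blk p a))"
      proof -
        have "(\<Sum>a<k. real (d a)) \<le> (\<Sum>a<k. real dmax)" by (intro sum_mono) (simp add: d_le_dmax)
        then show ?thesis by (simp add: mult_right_mono sum_nonneg)
      qed
      finally have "sqrt (S\<^sup>2) \<le> sqrt ((real k * dmax) * (\<Sum>a<k. frob2 (blk p a)))" by (rule real_sqrt_le_mono)
      then show ?thesis unfolding real_sqrt_mult by (simp add: real_sqrt_mult)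
    qed
    moreover have "sqrt (real k * dmax) * sqrt (\<Sum>a<k. frob2 (blk p a)) + \<bar>?t\<bar> \<le> sqrt (2 * real k * dmax) * L2_set p idx"
    proof (rule power2_le_imp_le)
      let ?A = "sqrt (real k * dmax)" and ?B = "sqrt (\<Sum>a<k. frob2 (blk p a))"
      have kd: "1 \<le> real k * dmax" using k dmax_pos mult_mono[of 1 "real k" 1 "real dmax"] by simp
      have "(?A * ?B + \<bar>?t\<bar>)\<^sup>2 \<le> 2 * ((?A * ?B)\<^sup>2 + ?t\<^sup>2)"
        using sum_squares_ge_zero[of "?A * ?B - \<bar>?t\<bar>" 0] by (simp add: power2_eq_square algebra_simps)
      also have "\<dots> \<le> 2 * ((?A * ?B)\<^sup>2 + (real k * dmax) * ?t\<^sup>2)"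
        using mult_right_mono[OF kd, of "?t\<^sup>2"] by simp
      also have "\<dots> = (sqrt (2 * real k * dmax) * L2_set p idx)\<^sup>2"
        unfolding power_mult_distrib L2_set_idx using kd by (simp add: sum_nonneg algebra_simps)
      finally show "(?A * ?B + \<bar>?t\<bar>)\<^sup>2 \<le> (sqrt (2 * real k * dmax) * L2_set p idx)\<^sup>2" .
    qed (auto simp: L2_set_nonneg)
    ultimately show ?thesis by linarith
  qed
  ultimately show ?thesis by (rule opb_mono)
qed

lemma linear_family_Lin: "linear_family D idx Lin (2 * real k * dmax)"
proof
  show "frob2 (Lin p) \<le> D * (L2_set p idx)\<^sup>2" for p
    unfolding frob2_Lin L2_set_idx by (intro mult_left_mono add_mono sum_mono) auto
  show "0 < 2 * real k * dmax" using k dmax_pos by simp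
qed (use finite_idx D_pos Lin_carrier Lin_add Lin_scale opb_Lin in auto)

text \<open>\<open>ksum\<close> is unchanged when multiples of the identity with coefficients summing to zero are added.\<close>

lemma Lin_surj:
  assumes H: "\<And>a. a < k \<Longrightarrow> H a \<in> carrier_mat (d a) (d a)"
  obtains p where "Lin p = ksum d H xs" "frob2 (Lin p) = D * (L2_set p idx)\<^sup>2"
proof -
  define m where "m a = tr (H a) / d a" for a
  \<comment> \<open>The blocks of this preimage are traceless, so nothing of \<open>p\<close> lies
    in the kernel of \<open>Lin\<close> and its norm is exact; the normalized traces of the
    \<open>H a\<close> are collected in the scalar coordinate.\<close>
  define p where "p = (\<lambda>(a, i, j). if a < k then (H a $$ (i, j) - (if i = j then m a else 0)) / sqrt (d a) else (\<Sum>a<k. m a))"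
  have pk: "p (k, 0, 0) = (\<Sum>a<k. m a)" by (simp add: p_def)
  have trp: "tr (blk p a) = 0" if a: "a < k" for a
  proof -
    have "tr (blk p a) = (\<Sum>i<d a. (H a $$ (i, i) - m a) / sqrt (d a))" using a by (simp add: tr_blk p_def)
    also have "\<dots> = (tr (H a) - d a * m a) / sqrt (d a)"
      using H[OF a] by (simp add: tr_def sum_divide_distrib[symmetric] sum_subtractf)
    finally show ?thesis using d[OF a] by (simp add: m_def)
  qed
  have G: "Gen p a = H a + ((\<Sum>a<k. m a) / k - m a) \<cdot>\<^sub>m 1\<^sub>m (d a)" if a: "a < k" for a
    using H[OF a] d[OF a] a trp[OF a] by (intro eq_matI) (auto simp: Gen_def pk blk_def p_def)
  have "Lin p = ksum d (\<lambda>a. H a + ((\<Sum>a<k. m a) / k - m a) \<cdot>\<^sub>m 1\<^sub>m (d a)) xs"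
    unfolding Lin_def by (rule ksum_cong) (simp add: G)
  also have "\<dots> = ksum d H xs + (\<Sum>a\<leftarrow>xs. (\<Sum>a<k. m a) / k - m a) \<cdot>\<^sub>m 1\<^sub>m (pdim d xs)"
    using H by (subst ksum_add) (auto simp: ksum_scalar)
  also have "(\<Sum>a\<leftarrow>xs. (\<Sum>a<k. m a) / k - m a) = 0"
    unfolding sum_list_xs using k by (simp add: sum_subtractf)
  also have "ksum d H xs + 0 \<cdot>\<^sub>m 1\<^sub>m (pdim d xs) = ksum d H xs"
    using ksum_carrier[of xs H d] H by (intro eq_matI) auto
  finally have "Lin p = ksum d H xs" .
  moreover have "frob2 (Lin p) = D * (L2_set p idx)\<^sup>2"
    unfolding frob2_Lin L2_set_idx by (simp add: trp)
  ultimately show ?thesis using that by blast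
qed

end

section \<open>Existence and uniqueness of the minimizer\<close>

text \<open>Square \<open>1 + z / 2 \<le> exp (z / 2)\<close>; the restriction on \<open>z\<close>
  keeps the left side nonnegative.\<close>

lemma exp_quadratic_lower:
  fixes z :: real
  assumes "\<bar>z\<bar> \<le> 1"
  shows "1 + z + z\<^sup>2 / 4 \<le> exp z"
proof -
  have "(1 + z / 2)\<^sup>2 \<le> (exp (z / 2))\<^sup>2" using assms exp_ge_add_one_self[of "z / 2"] by (intro power_mono) auto
  also have "(exp (z / 2))\<^sup>2 = exp z" by (simp add: power2_eq_square exp_add[symmetric])
  finally show ?thesis by (simp add: power2_eq_square algebra_simps)
qed

lemma exp_convex_ray:
  fixes z s :: real
  assumes "0 \<le> s" "s \<le> 1"
  shows "exp (s * z) \<le> (1 - s) + s * exp z"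
  using convex_onD[OF exp_convex, of s 0 z] assms by simp

lemma frob2_eq_0:
  assumes "A \<in> carrier_mat m n" "frob2 A = 0"
  shows "A = 0\<^sub>m m n"
proof (rule eq_matI)
  fix i j assume "i < dim_row (0\<^sub>m m n :: real mat)" "j < dim_col (0\<^sub>m m n :: real mat)"
  then have ij: "i < m" "j < n" by auto
  have "\<forall>i\<in>{..<m}. (\<Sum>j<n. (A $$ (i, j))\<^sup>2) = 0"
    using assms by (subst sum_nonneg_eq_0_iff[symmetric]) (auto simp: frob2_def sum_nonneg)
  then have "(\<Sum>j<n. (A $$ (i, j))\<^sup>2) = 0" using ij by auto
  then show "A $$ (i, j) = 0\<^sub>m m n $$ (i, j)" using ij by (simp add: sum_nonneg_eq_0_iff)
qed (use assms in auto)

lemma spec_zero: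
  assumes "orth_mat n U" "spec n U l = 0\<^sub>m n n"
  shows "i < n \<Longrightarrow> l i = 0"
proof -
  have "(\<Sum>i<n. (l i)\<^sup>2) = 0" using frob2_spec[OF assms(1), of l] assms(2) by (simp add: frob2_def)
  then show "i < n \<Longrightarrow> l i = 0" by (simp add: sum_nonneg_eq_0_iff)
qed

lemma lam_scale: "lam d (\<lambda>a i. s * l a i) ys j = s * lam d l ys j"
  by (induction ys arbitrary: j) (auto simp: distrib_left)

text \<open>The chance events are condensed in \<open>gradient\<close> and \<open>hessian\<close>;
  what follows is deterministic. Both are required for arbitrary square blocks. \<open>small\<close>
  says that eigenvalues are at most 1 in absolute value on the critical sphere.\<close>

locale tensor_sample = tensor_dims +
  fixes n :: nat and y :: "nat \<Rightarrow> real vec" and \<epsilon> \<kappa> :: real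
  assumes n: "0 < n" and y: "\<And>i. i < n \<Longrightarrow> y i \<in> carrier_vec D" and \<epsilon>: "0 < \<epsilon>" and \<kappa>: "0 < \<kappa>"
    and small: "40 * \<epsilon> * sqrt \<kappa> \<le> 1"
    and gradient: "\<And>H. (\<And>a. a < k \<Longrightarrow> H a \<in> carrier_mat (d a) (d a)) \<Longrightarrow>
      \<bar>total_quad n y (ksum d H xs) - real n * tr (ksum d H xs)\<bar> \<le> \<epsilon> * (real n * D) * sqrt (frob2 (ksum d H xs) / D)"
    and hessian: "\<And>H. (\<And>a. a < k \<Longrightarrow> H a \<in> carrier_mat (d a) (d a)) \<Longrightarrow>
      real n * frob2 (ksum d H xs) / 8 \<le> total_sq n y (ksum d H xs)"
    and opnorm: "\<And>H. (\<And>a. a < k \<Longrightarrow> H a \<in> carrier_mat (d a) (d a)) \<Longrightarrow>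
      opb D (ksum d H xs) (sqrt \<kappa> * sqrt (frob2 (ksum d H xs) / D))"
begin

text \<open>The second-order gain on the sphere is \<open>\<rho>\<^sup>2 / 32\<close>, from
  \<open>1 / 8\<close> in \<open>hessian\<close> and \<open>1 / 4\<close> in
  \<open>exp_quadratic_lower\<close>, while the slope can lose \<open>\<epsilon> * \<rho>\<close>.
  Any radius above \<open>32 * \<epsilon>\<close> would win.\<close>

definition \<rho> :: real where "\<rho> = 40 * \<epsilon>"

abbreviation orth_tuple :: "(nat \<Rightarrow> real mat) \<Rightarrow> bool" where
  "orth_tuple U \<equiv> \<forall>a<k. orth_mat (d a) (U a)"

abbreviation Wk :: "(nat \<Rightarrow> real mat) \<Rightarrow> real mat" where
  "Wk U \<equiv> kron_list (map U xs)"

abbreviation lm :: "(nat \<Rightarrow> nat \<Rightarrow> real) \<Rightarrow> nat \<Rightarrow> real" where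
  "lm l \<equiv> lam d l xs"

text \<open>The objective in eigencoordinates: the weight of \<open>exp (lm l j)\<close> is the
  sample energy along column \<open>j\<close> of \<open>Wk U\<close>. For fixed \<open>U\<close>
  convexity in \<open>l\<close> is visible; \<open>Phi_Ks\<close> identifies it with the objective
  on matrices.\<close>

definition obj :: "(nat \<Rightarrow> real mat) \<Rightarrow> (nat \<Rightarrow> nat \<Rightarrow> real) \<Rightarrow> real" where
  "obj U l = (\<Sum>j<D. exp (lm l j) * (\<Sum>i<n. ((transpose_mat (Wk U) *\<^sub>v y i) $ j)\<^sup>2)) / (real n * D) - (\<Sum>j<D. lm l j) / D"

text \<open>The normalized squared Frobenius norm of the generator; it does not depend on the
  orthogonal factors.\<close>

definition msq :: "(nat \<Rightarrow> nat \<Rightarrow> real) \<Rightarrow> real" where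
  "msq l = (\<Sum>j<D. (lm l j)\<^sup>2) / D"

definition obj0 :: real where "obj0 = (\<Sum>i<n. (nrm (y i))\<^sup>2) / (real n * D)"

lemma Wk_orth: "orth_tuple U \<Longrightarrow> orth_mat D (Wk U)"
  unfolding D_def by (rule kron_list_orth) auto

lemma nD: "0 < real n * D"
  using n D_pos by simp

lemma sum_c:
  assumes "orth_tuple U"
  shows "(\<Sum>j<D. g j * (\<Sum>i<n. ((transpose_mat (Wk U) *\<^sub>v y i) $ j)\<^sup>2)) = total_quad n y (spec D (Wk U) g)"
proof -
  have "(\<Sum>j<D. g j * (\<Sum>i<n. ((transpose_mat (Wk U) *\<^sub>v y i) $ j)\<^sup>2)) = (\<Sum>i<n. \<Sum>j<D. g j * ((transpose_mat (Wk U) *\<^sub>v y i) $ j)\<^sup>2)"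
    unfolding sum_distrib_left by (rule sum.swap)
  also have "\<dots> = total_quad n y (spec D (Wk U) g)"
    by (intro sum.cong refl quad_spec[OF Wk_orth[OF assms], symmetric] y) simp
  finally show ?thesis .
qed

lemma sum_c_one:
  assumes U: "orth_tuple U"
  shows "(\<Sum>j<D. \<Sum>i<n. ((transpose_mat (Wk U) *\<^sub>v y i) $ j)\<^sup>2) = obj0 * (real n * D)"
proof -
  have "(\<Sum>j<D. \<Sum>i<n. ((transpose_mat (Wk U) *\<^sub>v y i) $ j)\<^sup>2) = (\<Sum>i<n. y i \<bullet> y i)"
    using sum_c[OF U, of "\<lambda>_. 1"] spec_one[OF Wk_orth[OF U]] y by simp
  also have "\<dots> = obj0 * (real n * D)" using n D_pos unfolding obj0_def nrm_sq by simp
  finally show ?thesis .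
qed

lemma ksum_spec: "orth_tuple U \<Longrightarrow> ksum d (\<lambda>a. spec (d a) (U a) (l a)) xs = spec D (Wk U) (lm l)"
  unfolding D_def by (rule ksum_spectral) auto

lemma lam_bound:
  assumes U: "orth_tuple U" and j: "j < D"
  shows "\<bar>lm l j\<bar> \<le> sqrt \<kappa> * sqrt (msq l)"
proof (rule spectral_eigenvalue_bound[OF Wk_orth[OF U] _ j])
  fix v :: "real vec" assume v: "v \<in> carrier_vec D"
  have W: "orth_mat D (Wk U)" by (rule Wk_orth[OF U])
  have "opb D (spec D (Wk U) (lm l)) (sqrt \<kappa> * sqrt (msq l))"
    using opnorm[of "\<lambda>a. spec (d a) (U a) (l a)"] U unfolding ksum_spec[OF U] frob2_spec[OF W] msq_def by simp
  then have "nrm (spec D (Wk U) (lm l) *\<^sub>v v) \<le> sqrt \<kappa> * sqrt (msq l) * nrm v" using v by (simp add: opb_def)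
  then have "nrm v * nrm (spec D (Wk U) (lm l) *\<^sub>v v) \<le> nrm v * (sqrt \<kappa> * sqrt (msq l) * nrm v)" by (rule mult_left_mono) simp
  moreover have "\<bar>v \<bullet> (spec D (Wk U) (lm l) *\<^sub>v v)\<bar> \<le> nrm v * nrm (spec D (Wk U) (lm l) *\<^sub>v v)"
    using v W by (intro abs_scalar_prod_le[of _ D] mult_mat_vec_closed spec_carrier) auto
  ultimately show "\<bar>v \<bullet> (spec D (Wk U) (lm l) *\<^sub>v v)\<bar> \<le> sqrt \<kappa> * sqrt (msq l) * (v \<bullet> v)"
    unfolding nrm_sq[symmetric] power2_eq_square by (simp only: mult_ac)
qed

lemma obj_sphere:
  assumes U: "orth_tuple U" and l: "msq l = \<rho>\<^sup>2"
  shows "obj0 < obj U l"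
proof -
  define c where "c j = (\<Sum>i<n. ((transpose_mat (Wk U) *\<^sub>v y i) $ j)\<^sup>2)" for j
  have W: "orth_mat D (Wk U)" by (rule Wk_orth[OF U])
  have c0: "0 \<le> c j" for j by (simp add: c_def sum_nonneg)
  have r: "0 < \<rho>" "sqrt \<kappa> * \<rho> \<le> 1" using \<epsilon> small by (auto simp: \<rho>_def mult_ac)
  have lj: "\<bar>lm l j\<bar> \<le> 1" if "j < D" for j
    using lam_bound[OF U that, of l] r unfolding l by simp
  have car: "\<And>a. a < k \<Longrightarrow> spec (d a) (U a) (l a) \<in> carrier_mat (d a) (d a)" using U by (intro spec_carrier) blast
  have fr: "frob2 (spec D (Wk U) (lm l)) = D * \<rho>\<^sup>2"
    using l D_pos unfolding frob2_spec[OF W] msq_def by (simp add: field_simps)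
  have g: "- (\<epsilon> * (real n * D) * \<rho>) \<le> (\<Sum>j<D. lm l j * c j) - real n * (\<Sum>j<D. lm l j)"
  proof -
    have "sqrt (frob2 (spec D (Wk U) (lm l)) / D) = \<rho>" unfolding fr using D_pos r by simp
    then show ?thesis
      using gradient[of "\<lambda>a. spec (d a) (U a) (l a)"] car
      unfolding ksum_spec[OF U] tr_spec[OF W] c_def sum_c[OF U] abs_le_iff by simp
  qed
  have h: "real n * D * \<rho>\<^sup>2 / 8 \<le> (\<Sum>j<D. (lm l j)\<^sup>2 * c j)"
  proof -
    have "total_sq n y (spec D (Wk U) (lm l)) = (\<Sum>j<D. (lm l j)\<^sup>2 * c j)"
      unfolding c_def sum_c[OF U] using y by (intro sum.cong refl nrm_spec[OF W]) auto
    then show ?thesis using hessian[OF car] unfolding ksum_spec[OF U] fr by (simp add: mult.assoc)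
  qed
  have "(\<Sum>j<D. c j) + (\<Sum>j<D. lm l j * c j) + (\<Sum>j<D. (lm l j)\<^sup>2 * c j) / 4 \<le> (\<Sum>j<D. exp (lm l j) * c j)"
  proof -
    have "(1 + lm l j + (lm l j)\<^sup>2 / 4) * c j \<le> exp (lm l j) * c j" if "j < D" for j
      using exp_quadratic_lower[OF lj[OF that]] c0 by (intro mult_right_mono)
    then have "(\<Sum>j<D. (1 + lm l j + (lm l j)\<^sup>2 / 4) * c j) \<le> (\<Sum>j<D. exp (lm l j) * c j)"
      by (intro sum_mono) auto
    then show ?thesis by (simp add: distrib_right sum.distrib sum_divide_distrib)
  qed
  moreover have "(\<Sum>j<D. c j) = obj0 * (real n * D)" unfolding c_def by (rule sum_c_one[OF U])
  \<comment> \<open>This is where 40 must exceed 32.\<close>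
  moreover have "\<epsilon> * (real n * D) * \<rho> < real n * D * \<rho>\<^sup>2 / 32"
    using nD r \<epsilon> by (simp add: \<rho>_def power2_eq_square)
  ultimately have "obj0 * (real n * D) < (\<Sum>j<D. exp (lm l j) * c j) - real n * (\<Sum>j<D. lm l j)"
    using g h by linarith
  also have "\<dots> = obj U l * (real n * D)"
    using nD n D_pos by (simp add: obj_def c_def field_simps)
  finally show ?thesis using nD by (simp add: mult_less_cancel_right_disj)
qed

lemma obj_outside:
  assumes U: "orth_tuple U" and l: "\<rho>\<^sup>2 \<le> msq l"
  shows "obj0 < obj U l"
proof -
  have r: "0 < \<rho>" using \<epsilon> by (simp add: \<rho>_def)
  \<comment> \<open>Scaling by \<open>s\<close> moves the point along its ray back to the sphere.
    Convexity gives \<open>obj0 < (1 - s) * obj0 + s * obj U l\<close>, from which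
    \<open>obj0\<close> is subtracted.\<close>
  define s where "s = \<rho> / sqrt (msq l)"
  have ml: "0 < msq l" using l r by (meson less_le_trans zero_less_power)
  have s: "0 < s" "s \<le> 1"
    using r ml real_sqrt_le_mono[OF l] by (auto simp: s_def)
  have W: "orth_mat D (Wk U)" by (rule Wk_orth[OF U])
  define c where "c j = (\<Sum>i<n. ((transpose_mat (Wk U) *\<^sub>v y i) $ j)\<^sup>2)" for j
  have c0: "0 \<le> c j" for j by (simp add: c_def sum_nonneg)
  have "msq (\<lambda>a i. s * l a i) = s\<^sup>2 * msq l"
    by (simp add: msq_def lam_scale power_mult_distrib sum_distrib_left)
  also have "\<dots> = \<rho>\<^sup>2" using ml by (simp add: s_def power_divide)
  finally have "obj0 < obj U (\<lambda>a i. s * l a i)" by (rule obj_sphere[OF U])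
  also have "\<dots> \<le> (1 - s) * obj0 + s * obj U l"
  proof -
    have sc: "(\<Sum>j<D. c j) = obj0 * (real n * D)" unfolding c_def by (rule sum_c_one[OF U])
    have "(\<Sum>j<D. exp (s * lm l j) * c j) \<le> (\<Sum>j<D. ((1 - s) + s * exp (lm l j)) * c j)"
      using s c0 by (intro sum_mono mult_right_mono exp_convex_ray) auto
    also have "\<dots> = (1 - s) * (obj0 * (real n * D)) + s * (\<Sum>j<D. exp (lm l j) * c j)"
      unfolding sc[symmetric] by (simp add: distrib_right sum.distrib sum_distrib_left mult.assoc)
    finally have "(\<Sum>j<D. exp (s * lm l j) * c j) / (real n * D) \<le> ((1 - s) * (obj0 * (real n * D)) + s * (\<Sum>j<D. exp (lm l j) * c j)) / (real n * D)"
      using nD by (intro divide_right_mono) auto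
    also have "\<dots> = (1 - s) * obj0 + s * ((\<Sum>j<D. exp (lm l j) * c j) / (real n * D))"
      using nD n D_pos by (simp add: add_divide_distrib)
    finally show ?thesis
      unfolding obj_def c_def[symmetric] lam_scale sum_distrib_left[symmetric] by (simp add: right_diff_distrib)
  qed
  finally have "s * obj0 < s * obj U l" by (simp add: algebra_simps)
  then show ?thesis using s by simp
qed

end

section \<open>Existence of a minimizer by compactness\<close>

lemma compact_box: "compact {f :: 'a \<Rightarrow> real. \<forall>e. f e \<in> {- b..b}}"
proof -
  \<comment> \<open>Tychonoff in the product topology of the function type. The index type may be
    infinite, so one type serves all dimensions.\<close>
  have "compactin (product_topology (\<lambda>_::'a. euclidean :: real topology) UNIV) (PiE UNIV (\<lambda>_. {- b..b}))"
    by (subst compactin_PiE) auto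
  then have "compact (PiE (UNIV :: 'a set) (\<lambda>_. {- b..b}))"
    unfolding euclidean_product_topology compactin_euclidean_iff .
  moreover have "PiE (UNIV :: 'a set) (\<lambda>_. {- b..b}) = {f. \<forall>e. f e \<in> {- b..b}}" by (auto simp: PiE_def)
  ultimately show ?thesis by simp
qed

lemma continuous_coordinate [continuous_intros]: "continuous_on S (\<lambda>f :: 'a \<Rightarrow> real. f e)"
  by (rule continuous_on_subset[OF continuous_on_product_coordinates]) simp

lemma orth_mat_entry_le:
  assumes "orth_mat n U" "i < n" "j < n"
  shows "\<bar>U $$ (i, j)\<bar> \<le> 1"
proof -
  have c: "U \<in> carrier_mat n n" using assms by simp
  have "(\<Sum>i<n. (U $$ (i, j))\<^sup>2) = (transpose_mat U * U) $$ (j, j)"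
    using c assms(2,3) by (simp add: scalar_prod_def atLeast0LessThan power2_eq_square)
  also have "\<dots> = 1" using orth_mat_left[OF assms(1)] assms(3) by simp
  finally have "(U $$ (i, j))\<^sup>2 \<le> 1"
    using member_le_sum[of i "{..<n}" "\<lambda>i. (U $$ (i, j))\<^sup>2"] assms by simp
  then show ?thesis by (simp add: abs_square_le_1)
qed

context tensor_sample
begin

definition mean :: "(nat \<Rightarrow> nat \<Rightarrow> real) \<Rightarrow> nat \<Rightarrow> real" where
  "mean l a = (\<Sum>i<d a. l a i) / d a"

text \<open>\<open>frob2_ksum\<close> applied to diagonal blocks, whose eigenvalues are those of the
  Kronecker sum: variances of the blocks plus the squared sum of their means.\<close>

lemma msq_formula:
  "msq l = (\<Sum>a<k. (\<Sum>i<d a. (l a i)\<^sup>2) / d a - (mean l a)\<^sup>2) + (\<Sum>a<k. mean l a)\<^sup>2"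
proof -
  have "frob2 (ksum d (\<lambda>a. mat_diag (d a) (l a)) xs) / pdim d xs =
    (\<Sum>a\<leftarrow>xs. frob2 (mat_diag (d a) (l a)) / d a - (tr (mat_diag (d a) (l a)) / d a)\<^sup>2) + (\<Sum>a\<leftarrow>xs. tr (mat_diag (d a) (l a)) / d a)\<^sup>2"
    by (rule frob2_ksum) (use d in \<open>auto simp: Suc_le_eq\<close>)
  then show ?thesis
    by (simp add: msq_def mean_def ksum_diag frob2_diag tr_diag sum_list_xs D_def)
qed

lemma lam_shift: "lam d (\<lambda>a i. l a i + c a) ys j = lam d l ys j + (\<Sum>a\<leftarrow>ys. c a)"
  by (induction ys arbitrary: j) auto

text \<open>Moves the means of the blocks to a common value without changing the tensor product.\<close>

definition equalize :: "(nat \<Rightarrow> nat \<Rightarrow> real) \<Rightarrow> nat \<Rightarrow> nat \<Rightarrow> real" where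
  "equalize l a i = l a i + ((\<Sum>a<k. mean l a) / k - mean l a)"

lemma lam_equalize: "lm (equalize l) = lm l"
proof
  fix j
  have "equalize l = (\<lambda>a i. l a i + ((\<Sum>a<k. mean l a) / k - mean l a))" by (intro ext) (rule equalize_def)
  then show "lm (equalize l) j = lm l j"
    using k by (simp add: lam_shift sum_list_xs sum_subtractf)
qed

lemma mean_equalize: "a < k \<Longrightarrow> mean (equalize l) a = (\<Sum>a<k. mean l a) / k"
  using d[of a] by (simp add: mean_def equalize_def sum.distrib add_divide_distrib)

lemma obj_equalize: "obj U (equalize l) = obj U l" "msq (equalize l) = msq l"
  by (simp_all add: obj_def msq_def lam_equalize)

text \<open>With all means equal to \<open>\<tau> / k\<close>, the mean square of block
  \<open>a\<close> is its variance, one of the nonnegative summands of \<open>msq\<close>, plus at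
  most \<open>\<tau>\<^sup>2\<close>, the remaining part of \<open>msq\<close>. This turns the bound
  on the full estimator into the bounds on its factors.\<close>

lemma normalized_sq_le:
  assumes l: "\<And>a. a < k \<Longrightarrow> mean l a = \<tau> / k" and a: "a < k"
  shows "(\<Sum>i<d a. (l a i)\<^sup>2) \<le> d a * msq l"
proof -
  have var: "0 \<le> (\<Sum>i<d b. (l b i)\<^sup>2) / d b - (mean l b)\<^sup>2" if "b < k" for b
  proof -
    have "(\<Sum>i<d b. l b i)\<^sup>2 \<le> real (d b) * (\<Sum>i<d b. (l b i)\<^sup>2)"
      using Cauchy_Schwarz_ineq_sum[of "\<lambda>_. 1" "\<lambda>i. l b i" "{..<d b}"] by simp
    then show ?thesis using d[OF that] by (simp add: mean_def power_divide field_simps power2_eq_square)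
  qed
  have "(\<Sum>i<d a. (l a i)\<^sup>2) / d a - (mean l a)\<^sup>2 \<le> (\<Sum>a<k. (\<Sum>i<d a. (l a i)\<^sup>2) / d a - (mean l a)\<^sup>2)"
    using var a by (intro member_le_sum[of a "{..<k}" "\<lambda>a. (\<Sum>i<d a. (l a i)\<^sup>2) / d a - (mean l a)\<^sup>2"]) auto
  moreover have "(\<Sum>a<k. mean l a) = \<tau>" using l k by simp
  moreover have "(\<tau> / k)\<^sup>2 \<le> \<tau>\<^sup>2"
    using k by (simp add: power_divide divide_le_eq mult_le_cancel_left1 not_less)
  ultimately have "(\<Sum>i<d a. (l a i)\<^sup>2) / d a \<le> msq l"
    unfolding msq_formula l[OF a] by simp
  then show ?thesis using d[OF a] by (simp add: field_simps)
qed

text \<open>A minimizer is found by compactness in the coordinates given by the entries of the orthogonal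
  factors and the logarithms of the eigenvalues, packed into one function.\<close>

definition decode_orth :: "(nat \<times> nat \<times> nat \<Rightarrow> real) \<Rightarrow> nat \<Rightarrow> real mat" where
  "decode_orth f a = mat (d a) (d a) (\<lambda>(i, j). f (a, i, Suc j))"

text \<open>Slot 0 of the third index is free for eigenvalues because \<open>decode_orth\<close>
  shifts the columns by one.\<close>

definition decode_eig :: "(nat \<times> nat \<times> nat \<Rightarrow> real) \<Rightarrow> nat \<Rightarrow> nat \<Rightarrow> real" where
  "decode_eig f a i = f (a, i, 0)"

lemma continuous_kron_list:
  assumes "i < pdim d ys" "j < pdim d ys"
  shows "continuous_on S (\<lambda>f. kron_list (map (decode_orth f) ys) $$ (i, j))"
  using assms
proof (induction ys arbitrary: i j)
  case (Cons a ys)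
  have c: "kron_list (map (decode_orth f) ys) \<in> carrier_mat (pdim d ys) (pdim d ys)" for f
    by (rule kron_list_carrier) (simp add: decode_orth_def)
  have ij: "i < d a * pdim d ys" "j < d a * pdim d ys" using Cons.prems by auto
  note dm = div_mod_less[OF ij(1)] div_mod_less[OF ij(2)]
  have e: "kron_list (map (decode_orth f) (a # ys)) $$ (i, j) =
    f (a, i div pdim d ys, Suc (j div pdim d ys)) * kron_list (map (decode_orth f) ys) $$ (i mod pdim d ys, j mod pdim d ys)" for f
    using kron_index[OF _ c ij, of "decode_orth f a" f] dm by (simp add: decode_orth_def)
  show ?case unfolding e using dm by (intro continuous_intros Cons.IH)
qed (auto intro: continuous_intros)

lemma continuous_lam: "continuous_on S (\<lambda>f. lam d (decode_eig f) ys j)"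
  by (induction ys arbitrary: j) (auto simp: decode_eig_def intro!: continuous_intros)

lemma continuous_obj: "continuous_on S (\<lambda>f. obj (decode_orth f) (decode_eig f))"
proof -
  have W: "Wk (decode_orth f) \<in> carrier_mat D D" for f
    unfolding D_def by (rule kron_list_carrier) (simp add: decode_orth_def)
  have e: "(transpose_mat (Wk (decode_orth f)) *\<^sub>v y i) $ j = (\<Sum>m<D. Wk (decode_orth f) $$ (m, j) * y i $ m)" if "i < n" "j < D" for f i j
    using W[of f] y[OF that(1)] that by (simp add: scalar_prod_def atLeast0LessThan)
  have c: "continuous_on S (\<lambda>f. \<Sum>m<D. Wk (decode_orth f) $$ (m, j) * y i $ m)" if "j < D" for i j
  proof -
    have "continuous_on S (\<lambda>f. Wk (decode_orth f) $$ (m, j))" if "m < D" for m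
      by (rule continuous_kron_list) (use that \<open>j < D\<close> in \<open>simp_all add: D_def\<close>)
    then show ?thesis by (intro continuous_intros) auto
  qed
  have "continuous_on S (\<lambda>f. (\<Sum>j<D. exp (lm (decode_eig f) j) * (\<Sum>i<n. (\<Sum>m<D. Wk (decode_orth f) $$ (m, j) * y i $ m)\<^sup>2)) / (real n * D) - (\<Sum>j<D. lm (decode_eig f) j) / D)"
    using n D_pos by (intro continuous_intros continuous_lam c) auto
  then show ?thesis unfolding obj_def by (simp add: e)
qed

lemma orth_tuple_decode:
  "orth_tuple (decode_orth f) \<longleftrightarrow> (\<forall>a\<in>{..<k}. \<forall>i\<in>{..<d a}. \<forall>j\<in>{..<d a}. (\<Sum>m<d a. f (a, m, Suc i) * f (a, m, Suc j)) = (if i = j then 1 else 0))"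
proof -
  have "orth_mat (d a) (decode_orth f a) \<longleftrightarrow> (\<forall>i\<in>{..<d a}. \<forall>j\<in>{..<d a}. (\<Sum>m<d a. f (a, m, Suc i) * f (a, m, Suc j)) = (if i = j then 1 else 0))" for a
    by (auto simp: orth_mat_def decode_orth_def mat_eq_iff scalar_prod_def atLeast0LessThan)
  then show ?thesis by auto
qed

lemma lam_cong: 
  assumes "\<And>a i. a \<in> set ys \<Longrightarrow> i < d a \<Longrightarrow> l a i = l' a i" "j < pdim d ys"
  shows "lam d l ys j = lam d l' ys j"
  using assms
proof (induction ys arbitrary: j)
  case (Cons a ys)
  have "j < d a * pdim d ys" using Cons.prems by simp
  from div_mod_less[OF this] show ?case using Cons by simp
qed simp

text \<open>A minimum over the compact set \<open>K\<close> is global: points with larger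
  \<open>msq\<close> exceed \<open>obj0\<close> by \<open>obj_outside\<close>, and
  \<open>obj0\<close> is attained at the identity, which is represented in \<open>K\<close>.
  Equalizing the means of the minimizer changes neither \<open>obj\<close> nor
  \<open>msq\<close>.\<close>

lemma minimizer_exists:
  obtains U l where "orth_tuple U" "\<And>a. a < k \<Longrightarrow> mean l a = (\<Sum>a<k. mean l a) / k" "msq l \<le> \<rho>\<^sup>2"
    "\<And>V m. orth_tuple V \<Longrightarrow> obj U l \<le> obj V m"
proof -
  \<comment> \<open>Entries of orthogonal matrices are bounded by 1, and equalized logarithmic
    eigenvalues by \<open>sqrt dmax * \<rho>\<close> in view of
    \<open>normalized_sq_le\<close>.\<close>
  define b where "b = max 1 (sqrt dmax * \<rho>)"
  have r: "0 < \<rho>" using \<epsilon> by (simp add: \<rho>_def)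
  define K where "K = {f :: nat \<times> nat \<times> nat \<Rightarrow> real. \<forall>e. f e \<in> {- b..b}} \<inter> ({f. orth_tuple (decode_orth f)} \<inter> {f. msq (decode_eig f) \<le> \<rho>\<^sup>2})"
  have "closed {f. orth_tuple (decode_orth f)}"
    unfolding orth_tuple_decode Collect_ball_eq by (intro closed_INT ballI closed_Collect_eq continuous_intros)
  moreover have "closed {f. msq (decode_eig f) \<le> \<rho>\<^sup>2}"
    unfolding msq_def using D_pos by (intro closed_Collect_le continuous_intros continuous_lam) auto
  ultimately have cK: "compact K" unfolding K_def by (intro compact_Int_closed compact_box closed_Int)
  \<comment> \<open>A bound on \<open>msq\<close> alone leaves the block means free to drift apart.
    Hence \<open>m\<close> is equalized before being packed, which keeps \<open>lm\<close> and
    therefore the objective.\<close>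
  have inK: "\<exists>f\<in>K. obj (decode_orth f) (decode_eig f) = obj V m" if V: "orth_tuple V" and m: "msq m \<le> \<rho>\<^sup>2" for V m
  proof -
    define f where "f = (\<lambda>(a, i, j). if a < k \<and> i < d a \<and> j \<le> d a then (if j = 0 then equalize m a i else V a $$ (i, j - 1)) else 0)"
    have UV: "decode_orth f a = V a" if "a < k" for a
    proof -
      have "V a \<in> carrier_mat (d a) (d a)" using V that by simp
      then show ?thesis using that by (intro eq_matI) (auto simp: decode_orth_def f_def)
    qed
    have lf: "lm (decode_eig f) j = lm m j" if "j < D" for j
      unfolding lam_equalize[of m, symmetric] using that by (intro lam_cong) (auto simp: decode_eig_def f_def D_def)
    have W: "Wk (decode_orth f) = Wk V" using UV by (intro arg_cong[where f = kron_list] map_cong) auto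
    have "equalize m a i \<in> {- b..b}" if a: "a < k" and i: "i < d a" for a i
    proof -
      have "(equalize m a i)\<^sup>2 \<le> (\<Sum>i<d a. (equalize m a i)\<^sup>2)" using i by (intro member_le_sum[of i "{..<d a}" "\<lambda>i. (equalize m a i)\<^sup>2"]) auto
      also have "\<dots> \<le> d a * msq (equalize m)" by (rule normalized_sq_le[OF mean_equalize a])
      also have "\<dots> \<le> dmax * \<rho>\<^sup>2" unfolding obj_equalize using m d_le_dmax[OF a] by (intro mult_mono) (auto simp: msq_def sum_nonneg)
      also have "\<dots> = (sqrt dmax * \<rho>)\<^sup>2" by (simp add: power_mult_distrib)
      finally have "\<bar>equalize m a i\<bar> \<le> \<bar>sqrt dmax * \<rho>\<bar>" by (simp only: abs_le_square_iff)
      then have "\<bar>equalize m a i\<bar> \<le> b" using r by (simp add: b_def)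
      then show ?thesis by (simp add: abs_le_iff)
    qed
    moreover have "V a $$ (i, j) \<in> {- b..b}" if "a < k" "i < d a" "j < d a" for a i j
    proof -
      have "\<bar>V a $$ (i, j)\<bar> \<le> 1" using orth_mat_entry_le[of "d a" "V a" i j] V that by blast
      also have "1 \<le> b" by (simp add: b_def)
      finally show ?thesis by (simp add: abs_le_iff)
    qed
    moreover have "0 \<in> {- b..b}" by (simp add: b_def)
    ultimately have "f e \<in> {- b..b}" for e by (cases e) (auto simp: f_def simp del: atLeastAtMost_iff)
    moreover have "orth_tuple (decode_orth f)" using V UV by simp
    moreover have "msq (decode_eig f) = msq m" by (simp add: msq_def lf)
    ultimately have "f \<in> K" using m by (simp add: K_def)
    moreover have "obj (decode_orth f) (decode_eig f) = obj V m" by (simp add: obj_def lf W)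
    ultimately show ?thesis by blast
  qed
  have one: "orth_tuple (\<lambda>a. 1\<^sub>m (d a))" by (simp add: orth_mat_one)
  have lam0: "lam d (\<lambda>_ _. 0) ys j = 0" for ys j by (induction ys arbitrary: j) auto
  have m0: "msq (\<lambda>_ _. 0) \<le> \<rho>\<^sup>2" by (simp add: msq_def lam0)
  have o0: "obj (\<lambda>a. 1\<^sub>m (d a)) (\<lambda>_ _. 0) = obj0"
    unfolding obj_def lam0 using sum_c_one[OF one] n D_pos by simp
  have "K \<noteq> {}" using inK[OF one m0] by blast
  then obtain f where f: "f \<in> K" "\<And>g. g \<in> K \<Longrightarrow> obj (decode_orth f) (decode_eig f) \<le> obj (decode_orth g) (decode_eig g)"
    using continuous_attains_inf[OF cK _ continuous_obj] by blast
  have f0: "obj (decode_orth f) (decode_eig f) \<le> obj0" using inK[OF one m0] f(2) unfolding o0 by metis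
  have min: "obj (decode_orth f) (decode_eig f) \<le> obj V m" if V: "orth_tuple V" for V m
  proof (cases "msq m \<le> \<rho>\<^sup>2")
    case True
    then show ?thesis using inK[OF V] f(2) by metis
  next
    case False
    then show ?thesis using obj_outside[OF V, of m] f0 by simp
  qed
  have fK: "orth_tuple (decode_orth f)" "msq (decode_eig f) \<le> \<rho>\<^sup>2" using f(1) by (auto simp: K_def)
  have mn: "mean (equalize (decode_eig f)) a = (\<Sum>a<k. mean (equalize (decode_eig f)) a) / k" if "a < k" for a
    using that k by (simp add: mean_equalize)
  have m2: "msq (equalize (decode_eig f)) \<le> \<rho>\<^sup>2" "\<And>V m. orth_tuple V \<Longrightarrow> obj (decode_orth f) (equalize (decode_eig f)) \<le> obj V m"
    unfolding obj_equalize using fK(2) min by blast+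
  show ?thesis by (rule that[OF fK(1) mn m2])
qed

end

section \<open>Uniqueness of the minimizer\<close>

context tensor_sample
begin

abbreviation Ks :: "(nat \<Rightarrow> real mat) \<Rightarrow> (nat \<Rightarrow> nat \<Rightarrow> real) \<Rightarrow> real mat" where
  "Ks U l \<equiv> kron_list (map (\<lambda>a. spec (d a) (U a) (\<lambda>i. exp (l a i))) xs)"

definition Phi :: "real mat \<Rightarrow> real" where
  "Phi K = total_quad n y K / (real n * D) - ln (det K) / D"

lemma Ks_spec: "orth_tuple U \<Longrightarrow> Ks U l = spec D (Wk U) (\<lambda>j. exp (lm l j))"
  unfolding D_def by (rule kron_list_spectral_exp) auto

lemma Phi_Ks:
  assumes "orth_tuple U"
  shows "Phi (Ks U l) = obj U l"
  unfolding Ks_spec[OF assms] Phi_def obj_def sum_c[OF assms] det_spec_exp[OF Wk_orth[OF assms]] by simp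

lemma PD_tuple_Ks:
  assumes "\<And>a. a < k \<Longrightarrow> T a \<in> PD (d a)"
  obtains U l where "orth_tuple U" "\<And>a. a < k \<Longrightarrow> T a = spec (d a) (U a) (\<lambda>i. exp (l a i))"
    "kron_list (map T xs) = Ks U l"
proof -
  have "\<exists>U l. orth_mat (d a) U \<and> T a = spec (d a) U (\<lambda>i. exp (l i))" if "a < k" for a
    using PD_spectral[OF assms[OF that]] by metis
  then obtain U l where Ul: "\<And>a. a < k \<Longrightarrow> orth_mat (d a) (U a) \<and> T a = spec (d a) (U a) (\<lambda>i. exp (l a i))"
    by metis
  have "map T xs = map (\<lambda>a. spec (d a) (U a) (\<lambda>i. exp (l a i))) xs" using Ul by simp
  then have "kron_list (map T xs) = Ks U l" by (rule arg_cong)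
  then show ?thesis using that Ul by blast
qed

text \<open>Equality of the two objective values along the geodesic joining two minimizers forces the
  generator of the geodesic, transported to the identity, to annihilate every sample.\<close>

lemma minimizer_unique:
  assumes U: "orth_tuple U" and min: "\<And>V m. orth_tuple V \<Longrightarrow> obj U l \<le> obj V m"
    and V: "orth_tuple V" and le: "obj V m \<le> obj U l"
  shows "Ks V m = Ks U l"
proof -
  define A where "A a = spec (d a) (U a) (\<lambda>i. exp (l a i / 2))" for a
  define A' where "A' a = spec (d a) (U a) (\<lambda>i. exp (- l a i / 2))" for a
  have Ac: "A a \<in> carrier_mat (d a) (d a)" "A' a \<in> carrier_mat (d a) (d a)" and AA: "A a * A' a = 1\<^sub>m (d a)" "A' a * A a = 1\<^sub>m (d a)"
    and At: "transpose_mat (A a) = A a" "transpose_mat (A' a) = A' a"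
    and Asq: "A a * A a = spec (d a) (U a) (\<lambda>i. exp (l a i))" if "a < k" for a
  proof -
    have o: "orth_mat (d a) (U a)" using U that by blast
    show "A a \<in> carrier_mat (d a) (d a)" "A' a \<in> carrier_mat (d a) (d a)" unfolding A_def A'_def using o by (rule spec_carrier)+
    show "A a * A' a = 1\<^sub>m (d a)" "A' a * A a = 1\<^sub>m (d a)"
      unfolding A_def A'_def spec_mult[OF o] exp_add[symmetric] using spec_one[OF o] by simp_all
    show "transpose_mat (A a) = A a" "transpose_mat (A' a) = A' a" unfolding A_def A'_def using o by (rule spec_transpose)+
    show "A a * A a = spec (d a) (U a) (\<lambda>i. exp (l a i))"
      unfolding A_def spec_mult[OF o] exp_add[symmetric] by simp
  qed
  \<comment> \<open>The second minimizer seen from the first: \<open>A a\<close> is the square root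
    of the block of the first one. The logarithm of \<open>B a\<close>, with eigenvalues
    \<open>h a\<close>, generates the geodesic from the first to the second.\<close>
  define B where "B a = A' a * spec (d a) (V a) (\<lambda>i. exp (m a i)) * A' a" for a
  have BPD: "B a \<in> PD (d a)" if a: "a < k" for a
  proof -
    have "spec (d a) (V a) (\<lambda>i. exp (m a i)) \<in> PD (d a)" using V a by (intro PD_spec) blast
    from PD_congruence[OF this Ac(2,1)[OF a] AA(1)[OF a]] show ?thesis unfolding B_def At[OF a] .
  qed
  obtain W h where W: "orth_tuple W" and Bh: "\<And>a. a < k \<Longrightarrow> B a = spec (d a) (W a) (\<lambda>i. exp (h a i))"
    using PD_tuple_Ks[of B] BPD by metis
  have Vm: "spec (d a) (V a) (\<lambda>i. exp (m a i)) = A a * spec (d a) (W a) (\<lambda>i. exp (h a i)) * A a" if a: "a < k" for a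
  proof -
    have c: "spec (d a) (V a) (\<lambda>i. exp (m a i)) \<in> carrier_mat (d a) (d a)" using V a by (intro spec_carrier) blast
    have "A a * B a * A a = (A a * A' a) * spec (d a) (V a) (\<lambda>i. exp (m a i)) * (A' a * A a)"
      unfolding B_def using c Ac[OF a]
      by (simp only: square_mult_carrier square_assoc[where n = "d a"])
    also have "\<dots> = spec (d a) (V a) (\<lambda>i. exp (m a i))" unfolding AA[OF a] using left_mult_one_mat[OF c] right_mult_one_mat[OF c] by simp
    finally show ?thesis unfolding Bh[OF a] by simp
  qed
  define KA where "KA = kron_list (map A xs)"
  define KA' where "KA' = kron_list (map A' xs)"
  have KAc: "KA \<in> carrier_mat D D" "KA' \<in> carrier_mat D D"
    unfolding KA_def KA'_def D_def using Ac by (auto intro!: kron_list_carrier)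
  have KAt: "transpose_mat KA = KA"
    unfolding KA_def kron_list_transpose using At by (intro arg_cong[where f = kron_list] map_cong) auto
  have KAA: "KA * KA' = 1\<^sub>m D" "KA' * KA = 1\<^sub>m D"
  proof -
    have "KA * KA' = kron_list (map (\<lambda>a. A a * A' a) xs)" "KA' * KA = kron_list (map (\<lambda>a. A' a * A a) xs)"
      unfolding KA_def KA'_def using Ac by (intro kron_list_mult[where d = d]; simp)+
    moreover have "map (\<lambda>a. A a * A' a) xs = map (\<lambda>a. 1\<^sub>m (d a)) xs" "map (\<lambda>a. A' a * A a) xs = map (\<lambda>a. 1\<^sub>m (d a)) xs"
      using AA by auto
    ultimately show "KA * KA' = 1\<^sub>m D" "KA' * KA = 1\<^sub>m D" by (simp_all add: kron_list_one D_def)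
  qed
  have KAsq: "KA * KA = Ks U l"
  proof -
    have "KA * KA = kron_list (map (\<lambda>a. A a * A a) xs)"
      unfolding KA_def using Ac by (intro kron_list_mult[where d = d]) auto
    also have "map (\<lambda>a. A a * A a) xs = map (\<lambda>a. spec (d a) (U a) (\<lambda>i. exp (l a i))) xs" using Asq by auto
    finally show ?thesis .
  qed
  define \<eta> where "\<eta> = lm h"
  define Wm where "Wm = Wk W"
  have Wo: "orth_mat D Wm" unfolding Wm_def by (rule Wk_orth[OF W])
  have path: "kron_list (map (\<lambda>a. A a * spec (d a) (W a) (\<lambda>i. exp (s * h a i)) * A a) xs) = KA * spec D Wm (\<lambda>j. exp (s * \<eta> j)) * KA" for s
  proof -
    have "spec D Wm (\<lambda>j. exp (s * \<eta> j)) = Ks W (\<lambda>a i. s * h a i)"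
      unfolding Ks_spec[OF W] lam_scale \<eta>_def Wm_def ..
    moreover have "KA * Ks W (\<lambda>a i. s * h a i) * KA = kron_list (map (\<lambda>a. A a * spec (d a) (W a) (\<lambda>i. exp (s * h a i)) * A a) xs)"
      unfolding KA_def using Ac W by (intro kron_list_mult3[where d = d]) (auto intro!: spec_carrier)
    ultimately show ?thesis by simp
  qed
  define z where "z i = KA *\<^sub>v y i" for i
  have z: "z i \<in> carrier_vec D" if "i < n" for i using y[OF that] KAc by (simp add: z_def)
  define c where "c j = (\<Sum>i<n. ((transpose_mat Wm *\<^sub>v z i) $ j)\<^sup>2)" for j
  have c0: "0 \<le> c j" for j by (simp add: c_def sum_nonneg)
  have quad: "total_quad n y (KA * spec D Wm g * KA) = (\<Sum>j<D. g j * c j)" for g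
  proof -
    have "total_quad n y (KA * spec D Wm g * KA) = (\<Sum>i<n. z i \<bullet> (spec D Wm g *\<^sub>v z i))"
    proof (intro sum.cong refl)
      fix i assume "i \<in> {..<n}"
      then have yi: "y i \<in> carrier_vec D" "z i \<in> carrier_vec D" using y z by auto
      have sc: "spec D Wm g \<in> carrier_mat D D" using Wo by (rule spec_carrier)
      have "(KA * spec D Wm g * KA) *\<^sub>v y i = KA *\<^sub>v (spec D Wm g *\<^sub>v z i)"
        unfolding z_def using assoc_mult_mat_vec[OF square_mult_carrier[OF KAc(1) sc] KAc(1) yi(1)]
          assoc_mult_mat_vec[OF KAc(1) sc yi(2)[unfolded z_def]] by simp
      then show "y i \<bullet> ((KA * spec D Wm g * KA) *\<^sub>v y i) = z i \<bullet> (spec D Wm g *\<^sub>v z i)"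
        using scalar_prod_transpose[OF KAc(1) yi(1) mult_mat_vec_closed[OF sc yi(2)]] KAt by (simp add: z_def)
    qed
    also have "\<dots> = (\<Sum>i<n. \<Sum>j<D. g j * ((transpose_mat Wm *\<^sub>v z i) $ j)\<^sup>2)"
      using z by (intro sum.cong refl quad_spec[OF Wo]) simp
    also have "\<dots> = (\<Sum>j<D. g j * c j)" unfolding c_def sum_distrib_left by (rule sum.swap)
    finally show ?thesis .
  qed
  have dKA: "0 < det KA * det KA"
    using KAsq det_mult[OF KAc(1) KAc(1)] det_spec_exp[OF Wk_orth[OF U]] unfolding Ks_spec[OF U] by (metis exp_gt_zero)
  have PhiS: "Phi (KA * spec D Wm (\<lambda>j. exp (s * \<eta> j)) * KA) =
    (\<Sum>j<D. exp (s * \<eta> j) * c j) / (real n * D) - (ln (det KA * det KA) + s * (\<Sum>j<D. \<eta> j)) / D" for s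
  proof -
    have sc: "spec D Wm (\<lambda>j. exp (s * \<eta> j)) \<in> carrier_mat D D" using Wo by (rule spec_carrier)
    have "det (KA * spec D Wm (\<lambda>j. exp (s * \<eta> j)) * KA) = det KA * det KA * exp (s * (\<Sum>j<D. \<eta> j))"
      unfolding det_mult[OF square_mult_carrier[OF KAc(1) sc] KAc(1)] det_mult[OF KAc(1) sc] det_spec_exp[OF Wo]
      by (simp add: sum_distrib_left)
    then have "ln (det (KA * spec D Wm (\<lambda>j. exp (s * \<eta> j)) * KA)) = ln (det KA * det KA) + s * (\<Sum>j<D. \<eta> j)"
      using dKA by (simp add: ln_mult_pos)
    then show ?thesis unfolding Phi_def quad by simp
  qed
  have KV: "Ks V m = KA * spec D Wm (\<lambda>j. exp (1 * \<eta> j)) * KA"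
    unfolding path[symmetric] using Vm by (intro arg_cong[where f = kron_list] map_cong) auto
  have KU: "Ks U l = KA * spec D Wm (\<lambda>j. exp (0 * \<eta> j)) * KA"
    using spec_one[OF Wo] KAc KAsq by (simp add: right_mult_one_mat[of KA D D])
  \<comment> \<open>The midpoint of the geodesic is again a Kronecker product of positive definite
    blocks, so minimality applies to it.\<close>
  have half: "obj U l \<le> Phi (KA * spec D Wm (\<lambda>j. exp (1 / 2 * \<eta> j)) * KA)"
  proof -
    have pd: "A a * spec (d a) (W a) (\<lambda>i. exp (1 / 2 * h a i)) * A a \<in> PD (d a)" if a: "a < k" for a
    proof -
      have "spec (d a) (W a) (\<lambda>i. exp (1 / 2 * h a i)) \<in> PD (d a)" using W a by (intro PD_spec) blast
      from PD_congruence[OF this Ac(1,2)[OF a] AA(2)[OF a]] show ?thesis unfolding At[OF a] .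
    qed
    obtain V' m' where V': "orth_tuple V'" "kron_list (map (\<lambda>a. A a * spec (d a) (W a) (\<lambda>i. exp (1 / 2 * h a i)) * A a) xs) = Ks V' m'"
      by (rule PD_tuple_Ks[of "\<lambda>a. A a * spec (d a) (W a) (\<lambda>i. exp (1 / 2 * h a i)) * A a", OF pd])
    show ?thesis unfolding path[symmetric] V'(2) Phi_Ks[OF V'(1)] by (rule min[OF V'(1)])
  qed
  define S where "S s = (\<Sum>j<D. exp (s * \<eta> j) * c j)" for s
  define t where "t = (\<Sum>j<D. \<eta> j) / D"
  have P: "Phi (KA * spec D Wm (\<lambda>j. exp (s * \<eta> j)) * KA) = S s / (real n * D) - ln (det KA * det KA) / D - s * t" for s
    unfolding PhiS S_def t_def by (simp add: add_divide_distrib)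
  \<comment> \<open>The log-determinant is affine along the geodesic, so its contributions cancel
    when both endpoints are compared with the midpoint.\<close>
  have mid: "a - L - 1 * t \<le> b - L - 0 * t \<Longrightarrow> b - L - 0 * t \<le> c - L - 1 / 2 * t \<Longrightarrow> a + b \<le> 2 * c" for a b c L t :: real
    by simp
  have "Phi (KA * spec D Wm (\<lambda>j. exp (1 * \<eta> j)) * KA) \<le> Phi (KA * spec D Wm (\<lambda>j. exp (0 * \<eta> j)) * KA)"
    using le unfolding Phi_Ks[OF U, symmetric] Phi_Ks[OF V, symmetric] KU KV .
  moreover have "Phi (KA * spec D Wm (\<lambda>j. exp (0 * \<eta> j)) * KA) \<le> Phi (KA * spec D Wm (\<lambda>j. exp (1 / 2 * \<eta> j)) * KA)"
    using half unfolding Phi_Ks[OF U, symmetric] KU .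
  ultimately have "S 1 / (real n * D) + S 0 / (real n * D) \<le> 2 * (S (1 / 2) / (real n * D))"
    unfolding P by (rule mid)
  then have "(S 1 + S 0) / (real n * D) \<le> (2 * S (1 / 2)) / (real n * D)" by (simp add: add_divide_distrib)
  then have "S 1 + S 0 \<le> 2 * S (1 / 2)" using nD by (simp only: divide_le_cancel less_imp_not_less if_False simp_thms)
  \<comment> \<open>The convexity defect is a sum of nonnegative terms, since
    \<open>exp \<eta> + 1 - 2 * exp (\<eta> / 2)\<close> is a square. Each term must vanish:
    wherever the weight \<open>c j\<close> is nonzero, \<open>\<eta> j = 0\<close>.\<close>
  moreover have "S 1 + S 0 - 2 * S (1 / 2) = (\<Sum>j<D. (exp (\<eta> j / 2) - 1)\<^sup>2 * c j)"
  proof -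
    have "(exp (\<eta> j / 2) - 1)\<^sup>2 = exp (1 * \<eta> j) + exp (0 * \<eta> j) - 2 * exp (1 / 2 * \<eta> j)" for j
      by (simp add: power2_eq_square algebra_simps exp_add[symmetric])
    then show ?thesis unfolding S_def by (simp add: left_diff_distrib distrib_right sum.distrib sum_subtractf sum_distrib_left mult.assoc)
  qed
  ultimately have "(\<Sum>j<D. (exp (\<eta> j / 2) - 1)\<^sup>2 * c j) \<le> 0" by simp
  moreover have "0 \<le> (\<Sum>j<D. (exp (\<eta> j / 2) - 1)\<^sup>2 * c j)" using c0 by (intro sum_nonneg) simp
  ultimately have zero: "(exp (\<eta> j / 2) - 1)\<^sup>2 * c j = 0" if "j < D" for j
    using sum_nonneg_eq_0_iff[of "{..<D}" "\<lambda>j. (exp (\<eta> j / 2) - 1)\<^sup>2 * c j"] c0 that by simp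
  then have ec: "(\<eta> j)\<^sup>2 * c j = 0" if "j < D" for j using that by fastforce
  define Lm where "Lm = spec D Wm \<eta>"
  have Lc: "Lm \<in> carrier_mat D D" unfolding Lm_def using Wo by (rule spec_carrier)
  have "(\<Sum>i<n. (nrm (Lm *\<^sub>v z i))\<^sup>2) = 0"
  proof -
    have "(\<Sum>i<n. (nrm (Lm *\<^sub>v z i))\<^sup>2) = (\<Sum>i<n. \<Sum>j<D. (\<eta> j)\<^sup>2 * ((transpose_mat Wm *\<^sub>v z i) $ j)\<^sup>2)"
      using z by (intro sum.cong refl) (simp add: Lm_def nrm_spec[OF Wo] quad_spec[OF Wo])
    also have "\<dots> = (\<Sum>j<D. (\<eta> j)\<^sup>2 * c j)" unfolding c_def sum_distrib_left by (rule sum.swap)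
    also have "\<dots> = 0" by (rule sum.neutral) (use ec in blast)
    finally show ?thesis .
  qed
  then have Lz: "nrm (Lm *\<^sub>v z i) = 0" if "i < n" for i using that by (simp add: sum_nonneg_eq_0_iff)
  \<comment> \<open>The generator conjugated blockwise by the square root, in general not symmetric.
    Its Kronecker sum kills every sample \<open>y i\<close>, because \<open>Lm\<close> kills
    \<open>z i = KA *\<^sub>v y i\<close>; \<open>hessian\<close> for arbitrary blocks then forces
    it to vanish.\<close>
  define H where "H a = A' a * spec (d a) (W a) (h a) * A a" for a
  have Wc: "spec (d a) (W a) (h a) \<in> carrier_mat (d a) (d a)" if "a < k" for a using W that by (intro spec_carrier) blast
  have Hc: "H a \<in> carrier_mat (d a) (d a)" if "a < k" for a
    unfolding H_def using square_mult_carrier[OF square_mult_carrier[OF Ac(2)[OF that] Wc[OF that]] Ac(1)[OF that]] .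
  have G: "ksum d H xs = KA' * Lm * KA"
  proof -
    have "ksum d H xs = KA' * ksum d (\<lambda>a. spec (d a) (W a) (h a)) xs * KA"
      unfolding H_def KA_def KA'_def
      by (rule ksum_conj[symmetric]) (use Ac AA Wc in auto)
    then show ?thesis unfolding ksum_spec[OF W] Lm_def \<eta>_def Wm_def .
  qed
  have Gy: "nrm (ksum d H xs *\<^sub>v y i) = 0" if i: "i < n" for i
  proof -
    have v: "Lm *\<^sub>v z i \<in> carrier_vec D" using Lc z[OF i] by simp
    have "(KA' * Lm * KA) *\<^sub>v y i = KA' *\<^sub>v (Lm *\<^sub>v z i)"
      using assoc_mult_mat_vec[OF square_mult_carrier[OF KAc(2) Lc] KAc(1) y[OF i]] assoc_mult_mat_vec[OF KAc(2) Lc z[OF i]]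
      by (simp add: z_def)
    moreover have "Lm *\<^sub>v z i = 0\<^sub>v D"
      using Lz[OF i] scalar_prod_self_pos[OF v] by (metis less_irrefl nrm_sq power_zero_numeral)
    moreover have "KA' *\<^sub>v 0\<^sub>v D = 0\<^sub>v D" using KAc(2) by (intro eq_vecI) auto
    moreover have "nrm (0\<^sub>v D) = 0" by (simp add: nrm_def L2_set_def)
    ultimately show ?thesis unfolding G by simp
  qed
  have Gc: "ksum d H xs \<in> carrier_mat D D" unfolding D_def using Hc by (intro ksum_carrier) simp
  have "real n * frob2 (ksum d H xs) / 8 \<le> 0" using hessian[of H] Hc Gy by simp
  then have "frob2 (ksum d H xs) = 0" using n frob2_nonneg[of "ksum d H xs"] by (simp add: mult_le_0_iff)
  then have G0: "ksum d H xs = 0\<^sub>m D D" by (rule frob2_eq_0[OF Gc])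
  \<comment> \<open>Undoing the conjugation brings the vanishing back to the symmetric generator,
    whose eigenvalues are the \<open>\<eta> j\<close>.\<close>
  have "Lm = (KA * KA') * Lm * (KA * KA')" unfolding KAA using Lc by simp
  also have "\<dots> = KA * ksum d H xs * KA'"
    unfolding G using Lc KAc
    by (simp only: square_mult_carrier square_assoc[where n = D])
  also have "\<dots> = 0\<^sub>m D D" unfolding G0 using KAc by simp
  finally have "spec D Wm \<eta> = 0\<^sub>m D D" by (simp add: Lm_def)
  then have \<eta>0: "\<eta> j = 0" if "j < D" for j using spec_zero[OF Wo _ that] by blast
  have "mat_diag D (\<lambda>j. exp (1 * \<eta> j)) = mat_diag D (\<lambda>j. exp (0 * \<eta> j))"
    by (rule eq_matI) (auto simp: mat_diag_def \<eta>0)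
  then show ?thesis unfolding KV KU by simp
qed

end

section \<open>The maximum likelihood estimator\<close>

lemma mult_cancel_sandwich:
  fixes A B K :: "real mat"
  assumes c: "A \<in> carrier_mat n n" "B \<in> carrier_mat n n" "K \<in> carrier_mat n n"
    and AB: "A * B = 1\<^sub>m n" "B * A = 1\<^sub>m n"
  shows "A * (B * K * B) * A = K"
proof -
  have "A * (B * K * B) * A = (A * B) * K * (B * A)"
    using c by (simp only: square_mult_carrier square_assoc[where n = n])
  then show ?thesis unfolding AB using left_mult_one_mat[OF c(3)] right_mult_one_mat[OF c(3)] by simp
qed

locale tensor_model = tensor_dims +
  fixes n :: nat and U0 :: "nat \<Rightarrow> real mat" and l0 :: "nat \<Rightarrow> nat \<Rightarrow> real"
  assumes n: "0 < n" and U0: "\<And>a. a < k \<Longrightarrow> orth_mat (d a) (U0 a)"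
begin

sublocale G: normal_sample D n "kron_list (map U0 xs)" "lam d l0 xs"
proof
  show "orth_mat D (kron_list (map U0 xs))"
    unfolding D_def by (rule kron_list_orth) (simp add: U0)
qed

definition \<Theta> :: "nat \<Rightarrow> real mat" where "\<Theta> a = spec (d a) (U0 a) (\<lambda>i. exp (l0 a i))"
definition r :: "nat \<Rightarrow> real mat" where "r a = spec (d a) (U0 a) (\<lambda>i. exp (l0 a i / 2))"
definition r' :: "nat \<Rightarrow> real mat" where "r' a = spec (d a) (U0 a) (\<lambda>i. exp (- l0 a i / 2))"

lemma r_carrier: "a < k \<Longrightarrow> r a \<in> carrier_mat (d a) (d a)" "a < k \<Longrightarrow> r' a \<in> carrier_mat (d a) (d a)"
  unfolding r_def r'_def by (rule spec_carrier, erule U0)+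

lemma r_facts:
  assumes "a < k"
  shows "r a * r' a = 1\<^sub>m (d a)" "r' a * r a = 1\<^sub>m (d a)" "transpose_mat (r a) = r a" "transpose_mat (r' a) = r' a"
    "r a * r a = \<Theta> a"
  unfolding r_def r'_def \<Theta>_def
  by (simp_all add: spec_mult[OF U0[OF assms]] spec_transpose[OF U0[OF assms]] exp_add[symmetric] spec_one[OF U0[OF assms], simplified])

text \<open>Square roots and inverse square roots commute with Kronecker products, so whitening acts
  factor by factor.\<close>

lemma kron_model:
  "kron_list (map \<Theta> xs) = G.Th" "kron_list (map r xs) = G.R" "kron_list (map r' xs) = G.R'"
proof -
  have *: "kron_list (map (\<lambda>a. spec (d a) (U0 a) (\<lambda>i. exp (s * l0 a i))) xs) =
    spec D (kron_list (map U0 xs)) (\<lambda>j. exp (s * lam d l0 xs j))" for s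
    unfolding D_def lam_scale[symmetric] by (rule kron_list_spectral_exp) (simp add: U0)
  show "kron_list (map \<Theta> xs) = G.Th" using *[of 1] by (simp add: \<Theta>_def[abs_def] G.Th_def)
  show "kron_list (map r xs) = G.R" using *[of "1 / 2"] by (simp add: r_def[abs_def] G.R_def)
  show "kron_list (map r' xs) = G.R'" using *[of "- (1 / 2)"] by (simp add: r'_def[abs_def] G.R'_def)
qed

lemma kron_sandwich:
  assumes "\<And>a. a < k \<Longrightarrow> K a \<in> carrier_mat (d a) (d a)"
  shows "kron_list (map (\<lambda>a. r a * K a * r a) xs) = G.R * kron_list (map K xs) * G.R"
    "kron_list (map (\<lambda>a. r' a * K a * r' a) xs) = G.R' * kron_list (map K xs) * G.R'"
  unfolding kron_model[symmetric] by (rule kron_list_mult3[where d = d, symmetric]; simp add: assms r_carrier)+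

lemma PD_sandwich:
  assumes "a < k" "K \<in> PD (d a)"
  shows "r a * K * r a \<in> PD (d a)" "r' a * K * r' a \<in> PD (d a)"
  using PD_congruence[OF assms(2) r_carrier[OF assms(1)] r_facts(2)[OF assms(1)]]
    PD_congruence[OF assms(2) r_carrier(2,1)[OF assms(1)] r_facts(1)[OF assms(1)]]
  unfolding r_facts[OF assms(1)] by simp_all

lemma det_R_pos: "0 < det G.R * det G.R"
  unfolding G.det_Th(2) G.det_Th(1) by simp

text \<open>\<open>e\<close> is the deviation parameter of the nets, \<open>4 / 3 * e\<close> the resulting gradient bound.\<close>

lemma tensor_sample_event:
  assumes e: "0 < e" "40 * (4 / 3 * e) * sqrt (2 * real k * dmax) \<le> 1"
  shows "\<exists>E \<in> sets G.P. 1 - exp (18 * card idx) * (2 * exp (- (e\<^sup>2 * (real n * D) / 16)) + 2 * exp (- (real n * D / (4096 * (2 * real k * dmax))))) \<le> measure G.P E \<and>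
    (\<forall>x \<in> E. tensor_sample k d n (\<lambda>i. G.Y (x i)) (4 / 3 * e) (2 * real k * dmax))"
proof -
  have "e * sqrt (2 * real k * dmax) \<le> 2" using e by simp
  from G.good_event[OF linear_family_Lin less_imp_le[OF e(1)] this]
  obtain E where E: "E \<in> sets G.P"
    "1 - exp (18 * card idx) * (2 * exp (- (e\<^sup>2 * (real n * D) / 16)) + 2 * exp (- (real n * D / (4096 * (2 * real k * dmax))))) \<le> measure G.P E"
    and g: "\<And>x p. x \<in> E \<Longrightarrow> \<bar>G.sum_quad x (Lin p) - real n * tr (Lin p)\<bar> \<le> 4 / 3 * (e * (real n * D)) * L2_set p idx"
    and h: "\<And>x p. x \<in> E \<Longrightarrow> frob2 (Lin p) = D * (L2_set p idx)\<^sup>2 \<Longrightarrow> real n * D * (L2_set p idx)\<^sup>2 / 8 \<le> G.sum_sq x (Lin p)"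
    by blast
  have "tensor_sample k d n (\<lambda>i. G.Y (x i)) (4 / 3 * e) (2 * real k * dmax)" if x: "x \<in> E" for x
  proof
    show "0 < n" by (rule n)
    show "0 < 4 / 3 * e" using e by simp
    show "0 < 2 * real k * dmax" using k dmax_pos by simp
    show "40 * (4 / 3 * e) * sqrt (2 * real k * dmax) \<le> 1" by (rule e)
    show "G.Y (x i) \<in> carrier_vec D" for i by (rule G.Y_carrier)
    fix H :: "nat \<Rightarrow> real mat" assume H: "\<And>a. a < k \<Longrightarrow> H a \<in> carrier_mat (d a) (d a)"
    obtain p where p: "Lin p = ksum d H xs" "frob2 (Lin p) = D * (L2_set p idx)\<^sup>2" by (rule Lin_surj[OF H])
    have np: "sqrt (frob2 (ksum d H xs) / D) = L2_set p idx"
      unfolding p(1)[symmetric] p(2) using D_pos by (simp add: L2_set_nonneg)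
    show "\<bar>G.sum_quad x (ksum d H xs) - real n * tr (ksum d H xs)\<bar>
      \<le> 4 / 3 * e * (real n * D) * sqrt (frob2 (ksum d H xs) / D)"
      using g[OF x, of p] unfolding np p(1) by simp
    show "real n * frob2 (ksum d H xs) / 8 \<le> G.sum_sq x (ksum d H xs)"
      using h[OF x p(2)] unfolding p(1)[symmetric] p(2) by (simp add: mult.assoc)
    show "opb D (ksum d H xs) (sqrt (2 * real k * dmax) * sqrt (frob2 (ksum d H xs) / D))"
      unfolding np using opb_Lin[of p] unfolding p(1) .
  qed
  then show ?thesis using E by blast
qed

end

locale tensor_fit = tensor_model +
  fixes x :: "nat \<Rightarrow> nat \<Rightarrow> real" and ds :: "nat list" and \<epsilon> \<kappa> :: real
  assumes ts: "tensor_sample k d n (\<lambda>i. G.Y (x i)) \<epsilon> \<kappa>"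
    and ds: "ds = map d [0..<k]"
begin

sublocale S: tensor_sample k d n "\<lambda>i. G.Y (x i)" \<epsilon> \<kappa>
  by (rule ts)

lemma ds_facts: "length ds = k" "a < k \<Longrightarrow> ds ! a = d a" "prod_list ds = D"
  by (simp_all add: ds D_def xs_def)

text \<open>Substituting \<open>G.R * K * G.R\<close> for the parameter is the same as whitening the
  sample, up to an additive constant from the determinant of \<open>G.R\<close>.\<close>

lemma nll:
  assumes K: "K \<in> carrier_mat D D" "0 < det K"
  shows "neg_log_lik ds n x (G.R * K * G.R) = S.Phi K - ln (det G.R * det G.R) / D"
proof -
  have "det (G.R * K * G.R) = det G.R * det G.R * det K"
    using K by (simp add: det_mult[of _ D])
  then have ln: "ln (det (G.R * K * G.R)) = ln (det G.R * det G.R) + ln (det K)"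
    using det_R_pos K(2) by (simp add: ln_mult_pos)
  have "(\<Sum>i<n. vec D (x i) \<bullet> ((G.R * K * G.R) *\<^sub>v vec D (x i))) = G.sum_quad x K"
    by (simp only: G.quad_Y[OF K(1)])
  then show ?thesis
    unfolding neg_log_lik_def Let_def ds_facts(3) ln S.Phi_def by (simp add: add_divide_distrib)
qed

lemma tuple_map:
  assumes "length As = k"
  shows "As = map (\<lambda>a. As ! a) xs"
  using assms by (auto simp: xs_def intro: nth_equalityI)

text \<open>Whitening maps the parameter space into itself because the square root of the true
  parameter is a Kronecker product; minimizing over \<open>Ks\<close> therefore covers every
  competitor.\<close>

lemma param_space_Ks:
  assumes "T \<in> param_space ds"
  obtains V m where "\<forall>a<k. orth_mat (d a) (V a)" "T = G.R * S.Ks V m * G.R"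
proof -
  obtain As where As: "As \<in> PD_tuples ds" "T = kron_list As" using assms by (auto simp: param_space_def)
  have len: "length As = k" and pd: "\<And>a. a < k \<Longrightarrow> As ! a \<in> PD (d a)"
    using As(1) ds_facts by (auto simp: PD_tuples_def)
  obtain V m where V: "\<forall>a<k. orth_mat (d a) (V a)" "kron_list (map (\<lambda>a. r' a * As ! a * r' a) xs) = S.Ks V m"
    by (rule S.PD_tuple_Ks[of "\<lambda>a. r' a * As ! a * r' a", OF PD_sandwich(2)[OF _ pd]])
  have Tm: "T = kron_list (map (\<lambda>a. As ! a) xs)" using As(2) tuple_map[OF len] by simp
  have Tc: "T \<in> carrier_mat D D" unfolding Tm D_def using pd by (intro kron_list_carrier) (auto intro: PD_carrier)
  have "S.Ks V m = G.R' * T * G.R'"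
    unfolding V(2)[symmetric] Tm using pd by (intro kron_sandwich(2)) (rule PD_carrier)
  then have "T = G.R * S.Ks V m * G.R"
    using mult_cancel_sandwich[OF G.R_carrier(1,2) Tc G.R_facts(2,3)] by simp
  then show ?thesis by (rule that[OF V(1)])
qed

text \<open>The deterministic half of the theorem. The minimizer for the whitened sample is
  conjugated back by the square root of the true parameter; whitening it again returns its
  logarithmic eigenvalues, so both distance bounds are bounds on these. Equal block means make the
  factors inherit the normalization of \<open>\<Theta>\<close>.\<close>

lemma fit:
  shows "\<exists>Ts. Ts \<in> PD_tuples ds \<and> is_unique_MLE ds n x (kron_list Ts) \<and>
    (normalized_factors ds (map \<Theta> xs) \<longrightarrow> normalized_factors ds Ts) \<and>
    fisher_rao (kron_list Ts) (kron_list (map \<Theta> xs)) \<le> sqrt D * (40 * \<epsilon>) \<and>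
    (\<forall>a<k. fisher_rao (Ts ! a) (\<Theta> a) \<le> sqrt (d a) * (40 * \<epsilon>))"
proof -
  obtain U l where U: "\<forall>a<k. orth_mat (d a) (U a)" and mean: "\<And>a. a < k \<Longrightarrow> S.mean l a = (\<Sum>a<k. S.mean l a) / k"
    and msq: "S.msq l \<le> S.\<rho>\<^sup>2" and min: "\<And>V m. \<forall>a<k. orth_mat (d a) (V a) \<Longrightarrow> S.obj U l \<le> S.obj V m"
  proof (rule S.minimizer_exists, goal_cases)
    case (1 U l)
    show ?case by (rule 1(1)[OF 1(2-)])
  qed
  define K where "K a = spec (d a) (U a) (\<lambda>i. exp (l a i))" for a
  define Ts where "Ts = map (\<lambda>a. r a * K a * r a) xs"
  have Ua: "orth_mat (d a) (U a)" if "a < k" for a using U that by blast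
  have KPD: "K a \<in> PD (d a)" if "a < k" for a unfolding K_def by (rule PD_spec[OF Ua[OF that]])
  have Kc: "K a \<in> carrier_mat (d a) (d a)" if "a < k" for a by (rule PD_carrier[OF KPD[OF that]])
  have Ts_nth: "Ts ! a = r a * K a * r a" if "a < k" for a using that by (simp add: Ts_def xs_def)
  have Ts: "Ts \<in> PD_tuples ds"
    unfolding PD_tuples_def using PD_sandwich(1)[OF _ KPD] by (auto simp: ds_facts Ts_nth) (simp add: Ts_def xs_def)
  have kT: "kron_list Ts = G.R * S.Ks U l * G.R"
    unfolding Ts_def K_def by (rule kron_sandwich(1)) (rule spec_carrier[OF Ua])
  have Kfacts: "S.Ks V m \<in> carrier_mat D D" "0 < det (S.Ks V m)" if "\<forall>a<k. orth_mat (d a) (V a)" for V m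
    unfolding S.Ks_spec[OF that] using spec_carrier[OF S.Wk_orth[OF that]] det_spec_exp[OF S.Wk_orth[OF that]] by simp_all
  have nllK: "neg_log_lik ds n x (G.R * S.Ks V m * G.R) = S.obj V m - ln (det G.R * det G.R) / D" if "\<forall>a<k. orth_mat (d a) (V a)" for V m
    using nll[OF Kfacts[OF that]] S.Phi_Ks[OF that] by simp
  have mle: "is_MLE ds n x (kron_list Ts)"
    unfolding is_MLE_def
  proof (intro conjI ballI)
    show "kron_list Ts \<in> param_space ds" using Ts by (auto simp: param_space_def)
    fix T' assume "T' \<in> param_space ds"
    then obtain V m where V: "\<forall>a<k. orth_mat (d a) (V a)" "T' = G.R * S.Ks V m * G.R" by (rule param_space_Ks)
    show "neg_log_lik ds n x (kron_list Ts) \<le> neg_log_lik ds n x T'"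
      unfolding kT V(2) nllK[OF U] nllK[OF V(1)] using min[OF V(1), of m] by simp
  qed
  have uniq: "T' = kron_list Ts" if T': "is_MLE ds n x T'" for T'
  proof -
    have "T' \<in> param_space ds" using T' by (simp add: is_MLE_def)
    then obtain V m where V: "\<forall>a<k. orth_mat (d a) (V a)" "T' = G.R * S.Ks V m * G.R" by (rule param_space_Ks)
    have "kron_list Ts \<in> param_space ds" using Ts by (auto simp: param_space_def)
    then have "neg_log_lik ds n x T' \<le> neg_log_lik ds n x (kron_list Ts)" using T' by (simp add: is_MLE_def)
    then have le: "S.obj V m \<le> S.obj U l" unfolding kT V(2) nllK[OF U] nllK[OF V(1)] by simp
    have "S.Ks V m = S.Ks U l"
    proof (rule S.minimizer_unique)
      show "\<forall>a<k. orth_mat (d a) (U a)" by (rule U)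
      show "S.obj U l \<le> S.obj V' m'" if "\<forall>a<k. orth_mat (d a) (V' a)" for V' m' by (rule min[OF that])
      show "\<forall>a<k. orth_mat (d a) (V a)" by (rule V(1))
      show "S.obj V m \<le> S.obj U l" by (rule le)
    qed
    then show ?thesis unfolding kT V(2) by simp
  qed
  have \<rho>: "0 \<le> S.\<rho>" "S.\<rho> = 40 * \<epsilon>" using S.\<epsilon> by (simp_all add: S.\<rho>_def)
  \<comment> \<open>The factor \<open>1 / sqrt 2\<close> of the Fisher-Rao distance is estimated by
    1.\<close>
  have half_le: "1 / sqrt 2 * sqrt X \<le> sqrt c * (40 * \<epsilon>)" if "X \<le> c * S.\<rho>\<^sup>2" "0 \<le> X" for X c
  proof -
    have "1 / sqrt 2 * sqrt X \<le> 1 * sqrt X" using that by (intro mult_right_mono) auto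
    also have "\<dots> \<le> sqrt (c * S.\<rho>\<^sup>2)" using that by simp
    also have "\<dots> = sqrt c * (40 * \<epsilon>)" using \<rho> by (simp add: real_sqrt_mult)
    finally show ?thesis .
  qed
  have fr: "fisher_rao (kron_list Ts) (kron_list (map \<Theta> xs)) \<le> sqrt D * (40 * \<epsilon>)"
  proof -
    have sand: "G.R' * kron_list Ts * G.R' = spec D (S.Wk U) (\<lambda>j. exp (S.lm l j))"
      unfolding kT S.Ks_spec[OF U, symmetric]
      by (rule mult_cancel_sandwich[OF G.R_carrier(2,1) Kfacts(1)[OF U] G.R_facts(3,2)])
    have "fisher_rao (kron_list Ts) (kron_list (map \<Theta> xs)) = 1 / sqrt 2 * sqrt (\<Sum>j<D. (S.lm l j)\<^sup>2)"
      unfolding kron_model(1) G.Th_def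
      by (rule fisher_rao_spec[OF G.U S.Wk_orth[OF U] G.R'_def sand])
    also have "\<dots> \<le> sqrt D * (40 * \<epsilon>)"
      using msq D_pos by (intro half_le) (simp_all add: S.msq_def field_simps sum_nonneg)
    finally show ?thesis .
  qed
  have fra: "fisher_rao (Ts ! a) (\<Theta> a) \<le> sqrt (d a) * (40 * \<epsilon>)" if a: "a < k" for a
  proof -
    have sand: "r' a * Ts ! a * r' a = spec (d a) (U a) (\<lambda>i. exp (l a i))"
      unfolding Ts_nth[OF a] using mult_cancel_sandwich[OF r_carrier(2,1)[OF a] Kc[OF a] r_facts(2,1)[OF a]] by (simp add: K_def)
    have "fisher_rao (Ts ! a) (\<Theta> a) = 1 / sqrt 2 * sqrt (\<Sum>i<d a. (l a i)\<^sup>2)"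
      unfolding \<Theta>_def by (rule fisher_rao_spec[OF U0[OF a] Ua[OF a] r'_def sand])
    also have "\<dots> \<le> sqrt (d a) * (40 * \<epsilon>)"
    proof (rule half_le)
      have "(\<Sum>i<d a. (l a i)\<^sup>2) \<le> d a * S.msq l" by (rule S.normalized_sq_le[OF mean a])
      also have "\<dots> \<le> d a * S.\<rho>\<^sup>2" using msq by (intro mult_left_mono) auto
      finally show "(\<Sum>i<d a. (l a i)\<^sup>2) \<le> d a * S.\<rho>\<^sup>2" .
    qed (simp add: sum_nonneg)
    finally show ?thesis .
  qed
  have nf: "normalized_factors ds Ts" if N: "normalized_factors ds (map \<Theta> xs)"
  proof -
    \<comment> \<open>The normalized determinant changes by \<open>exp (S.mean l a)\<close>, which
      is the same for all \<open>a\<close> by the choice of the minimizer.\<close>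
    have dd: "det (Ts ! a) powr (1 / real (ds ! a)) = det (\<Theta> a) powr (1 / real (ds ! a)) * exp ((\<Sum>a<k. S.mean l a) / k)" if a: "a < k" for a
    proof -
      have "det (Ts ! a) = det (r a) * det (r a) * det (K a)"
        unfolding Ts_nth[OF a] using r_carrier[OF a] Kc[OF a] by (simp add: det_mult[of _ "d a"])
      also have "det (r a) * det (r a) = det (\<Theta> a)"
        using det_mult[OF r_carrier(1)[OF a] r_carrier(1)[OF a]] r_facts(5)[OF a] by simp
      also have "det (K a) = exp (\<Sum>i<d a. l a i)" unfolding K_def by (rule det_spec_exp[OF Ua[OF a]])
      finally have "det (Ts ! a) = det (\<Theta> a) * exp (\<Sum>i<d a. l a i)" .
      moreover have "0 < det (\<Theta> a)" unfolding \<Theta>_def by (rule PD_det_pos[OF PD_spec[OF U0[OF a]]])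
      ultimately have "det (Ts ! a) powr (1 / real (d a)) = det (\<Theta> a) powr (1 / real (d a)) * exp (S.mean l a)"
        by (simp add: powr_mult S.mean_def powr_def[of "exp _"])
      then show ?thesis unfolding mean[OF a] ds_facts(2)[OF a] .
    qed
    have th: "(map \<Theta> xs) ! a = \<Theta> a" if "a < k" for a using that by (simp add: xs_def)
    show ?thesis unfolding normalized_factors_def ds_facts(1)
    proof (intro allI impI)
      fix a b assume ab: "a < k" "b < k"
      have "det (\<Theta> a) powr (1 / real (ds ! a)) = det (\<Theta> b) powr (1 / real (ds ! b))"
        using N ab unfolding normalized_factors_def ds_facts(1) th[OF ab(1), symmetric] th[OF ab(2), symmetric] by blast
      then show "det (Ts ! a) powr (1 / real (ds ! a)) = det (Ts ! b) powr (1 / real (ds ! b))"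
        unfolding dd[OF ab(1)] dd[OF ab(2)] by (rule arg_cong)
    qed
  qed
  show ?thesis
    unfolding is_unique_MLE_def
    by (intro exI[of _ Ts] conjI allI impI Ts mle uniq fr fra nf)
qed

end

text \<open>The exponent budget with \<open>q = k * dmax\<^sup>2\<close>: the net costs
  \<open>18 * c \<le> 36 * q\<close>, the factor 4 is at most \<open>exp 3\<close> and costs
  \<open>3 \<le> 3 * q * t\<^sup>2\<close>, so tails of exponent \<open>40 * q * t\<^sup>2\<close>
  leave one unit.\<close>

lemma failure_bound:
  fixes q t X Y c :: real
  assumes q: "1 \<le> q" and t: "1 \<le> t" and c: "c \<le> 2 * q" and X: "40 * q * t\<^sup>2 \<le> X" and Y: "40 * q * t\<^sup>2 \<le> Y"
  shows "exp (18 * c) * (2 * exp (- X) + 2 * exp (- Y)) \<le> exp (- (q * t\<^sup>2))"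
proof -
  have t2: "1 \<le> t\<^sup>2" using t by simp
  then have qt: "1 \<le> q * t\<^sup>2" "q \<le> q * t\<^sup>2" using q mult_mono[of 1 q 1 "t\<^sup>2"] mult_left_mono[of 1 "t\<^sup>2" q] by auto
  have "2 * exp (- X) + 2 * exp (- Y) \<le> 2 * exp (- (40 * (q * t\<^sup>2))) + 2 * exp (- (40 * (q * t\<^sup>2)))"
    using X Y by (intro add_mono mult_left_mono) auto
  also have "\<dots> = 4 * exp (- (40 * (q * t\<^sup>2)))" by simp
  also have "\<dots> \<le> exp 3 * exp (- (40 * (q * t\<^sup>2)))"
    using exp_ge_add_one_self[of "3 :: real"] by (intro mult_right_mono) auto
  also have "\<dots> = exp (3 - 40 * (q * t\<^sup>2))" by (simp add: exp_add[symmetric])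
  finally have "exp (18 * c) * (2 * exp (- X) + 2 * exp (- Y)) \<le> exp (18 * c) * exp (3 - 40 * (q * t\<^sup>2))"
    by (rule mult_left_mono) simp
  also have "\<dots> = exp (18 * c + (3 - 40 * (q * t\<^sup>2)))" by (rule exp_add[symmetric])
  also have "\<dots> \<le> exp (- (q * t\<^sup>2))" using c qt by simp
  finally show ?thesis .
qed

theorem theorem1p10:
  shows "\<exists>C c\<^sub>1 c\<^sub>2 C' :: real. 0 < C \<and> 0 < c\<^sub>1 \<and> 0 < c\<^sub>2 \<and> 0 < C' \<and>
    (\<forall>(k::nat) (ds :: nat list) (\<Theta>s :: real mat list) (n::nat) (t::real).
      1 \<le> k \<longrightarrow> length ds = k \<longrightarrow> (\<forall>a < k. 1 \<le> ds ! a) \<longrightarrow>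
      \<Theta>s \<in> PD_tuples ds \<longrightarrow> normalized_factors ds \<Theta>s \<longrightarrow>
      (let D = prod_list ds; dmax = Max (set ds); dmin = Min (set ds); \<Theta> = kron_list \<Theta>s in
        1 \<le> t \<longrightarrow>
        C * (real k)\<^sup>2 * (real dmax ^ 3 / real D) * t\<^sup>2 \<le> real n \<longrightarrow>
        holds_with_prob_ge (iid_samples n (multivariate_normal D (inv_mat \<Theta>)))
          (\<lambda>x. \<exists>Ts. Ts \<in> PD_tuples ds \<and> normalized_factors ds Ts \<and>
             is_unique_MLE ds n x (kron_list Ts) \<and>
             fisher_rao (kron_list Ts) \<Theta> \<le> C' * (sqrt (real k) * real dmax / sqrt (real n)) * t \<and>
             (\<forall>a < k. fisher_rao (Ts ! a) (\<Theta>s ! a)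
                \<le> C' * (sqrt (real k * real (ds ! a)) * real dmax / sqrt (real n * real D)) * t))
          (1 - real k * exp (- c\<^sub>1 * t\<^sup>2 * real dmax)
             - (real k)\<^sup>2 * (sqrt (real n * real D) / (real k * real dmax)) powr (- c\<^sub>2 * real dmin))))"
\<comment> \<open>\<open>C\<close> must exceed \<open>25600 / 9 * 1352\<close>, about
  \<open>3.85\<close> million, which arises in \<open>small\<close> below. \<open>C'\<close> must
  exceed \<open>40 * 4 / 3 * 26\<close>, about 1387: the radius factor, the net factor and the
  constant in \<open>e\<close>.\<close>
proof (rule exI[of _ 4000000], rule exI[of _ 1], rule exI[of _ 1], rule exI[of _ 1400], intro conjI allI impI, goal_cases)
  case (5 k ds \<Theta>s n t)
  note k = 5(1) and len = 5(2) and pos = 5(3) and \<Theta>s = 5(4) and norm = 5(5)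
  let ?d = "\<lambda>a. ds ! a"
  interpret T: tensor_dims k ?d by unfold_locales (use k pos in auto)
  have ds: "ds = map ?d [0..<k]" using map_nth[of ds] len by simp
  have D: "prod_list ds = T.D" unfolding T.D_def T.xs_def ds[symmetric] ..
  have dm: "Max (set ds) = T.dmax" unfolding T.dmax_def by (subst ds) (simp add: atLeast0LessThan)
  have len\<Theta>: "length \<Theta>s = k" and pd: "\<And>a. a < k \<Longrightarrow> \<Theta>s ! a \<in> PD (?d a)"
    using \<Theta>s len by (auto simp: PD_tuples_def)
  have "\<exists>U l. orth_mat (?d a) U \<and> \<Theta>s ! a = spec (?d a) U (\<lambda>i. exp (l i))" if "a < k" for a
    using PD_spectral[OF pd[OF that]] by metis
  then obtain U0 l0 where Ul: "\<And>a. a < k \<Longrightarrow> orth_mat (?d a) (U0 a) \<and> \<Theta>s ! a = spec (?d a) (U0 a) (\<lambda>i. exp (l0 a i))"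
    by metis
  define M where "M = real T.dmax"
  define p where "p = real n * real T.D"
  have M: "1 \<le> M" using T.dmax_pos by (simp add: M_def)
  have Dp: "0 < real T.D" using T.D_pos by simp
  have k1: "1 \<le> real k" using k by simp
  show ?case
    unfolding Let_def D dm
  proof (intro impI, goal_cases)
    case 1
    then have t: "1 \<le> t" and "4000000 * (real k)\<^sup>2 * (real T.dmax ^ 3 / real T.D) * t\<^sup>2 \<le> real n" by auto
    then have p: "4000000 * ((real k)\<^sup>2 * M ^ 3 * t\<^sup>2) \<le> p"
      using Dp by (simp add: M_def p_def field_simps)
    have "0 < (real k)\<^sup>2 * M ^ 3 * t\<^sup>2" using k1 M t by simp
    then have p0: "0 < p" using p by linarith
    then have n: "0 < n" by (simp add: p_def zero_less_mult_iff)
    interpret F: tensor_model k ?d n U0 l0 by unfold_locales (use n Ul in auto)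
    have \<Theta>a: "F.\<Theta> a = \<Theta>s ! a" if "a < k" for a using Ul[OF that] by (simp add: F.\<Theta>_def)
    have \<Theta>m: "map F.\<Theta> T.xs = \<Theta>s" using len\<Theta> \<Theta>a by (auto simp: T.xs_def intro: nth_equalityI)
    have P: "F.G.P = iid_samples n (multivariate_normal T.D (inv_mat (kron_list \<Theta>s)))"
      unfolding F.G.P_def F.G.N_def F.kron_model(1)[symmetric] \<Theta>m ..
    \<comment> \<open>The constant satisfies \<open>26\<^sup>2 / 16 \<ge> 40\<close>, the tail
      exponent that \<open>failure_bound\<close> asks for.\<close>
    define e where "e = 26 * (sqrt k * M * t) / sqrt p"
    have e0: "0 < e" using k1 M t p0 by (simp add: e_def)
    have e2: "e\<^sup>2 * p = 676 * (real k * M\<^sup>2 * t\<^sup>2)"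
      using p0 by (simp add: e_def power_divide power_mult_distrib)
    \<comment> \<open>The only place where the full size of \<open>C\<close> is needed: the squared
      left side, multiplied by \<open>p\<close>, is a multiple of
      \<open>k\<^sup>2 * M ^ 3 * t\<^sup>2\<close>.\<close>
    have small: "40 * (4 / 3 * e) * sqrt (2 * real k * M) \<le> 1"
    proof -
      have "(40 * (4 / 3 * e) * sqrt (2 * real k * M))\<^sup>2 * p = (25600 / 9) * (e\<^sup>2 * p) * (2 * real k * M)"
        using M by (simp add: power_mult_distrib power_divide)
      also have "\<dots> = (25600 / 9 * 1352) * ((real k)\<^sup>2 * M ^ 3 * t\<^sup>2)"
        unfolding e2 by (simp add: power2_eq_square power3_eq_cube)
      also have "\<dots> \<le> 4000000 * ((real k)\<^sup>2 * M ^ 3 * t\<^sup>2)"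
        using M by (intro mult_right_mono) auto
      also have "\<dots> \<le> 1 * p" using p by simp
      finally have "(40 * (4 / 3 * e) * sqrt (2 * real k * M))\<^sup>2 \<le> 1\<^sup>2" using p0 by simp
      then show ?thesis by (rule power2_le_imp_le) simp
    qed
    obtain E where E: "E \<in> sets F.G.P"
      "1 - exp (18 * card T.idx) * (2 * exp (- (e\<^sup>2 * (real n * T.D) / 16)) + 2 * exp (- (real n * T.D / (4096 * (2 * real k * T.dmax))))) \<le> measure F.G.P E"
      "\<And>x. x \<in> E \<Longrightarrow> tensor_sample k ?d n (\<lambda>i. F.G.Y (x i)) (4 / 3 * e) (2 * real k * T.dmax)"
      using F.tensor_sample_event[OF e0 small[unfolded M_def]] by blast
    have prob: "1 - real k * exp (- 1 * t\<^sup>2 * M) \<le> measure F.G.P E"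
    proof -
      have q: "1 \<le> real k * M\<^sup>2" using k1 M mult_mono[of 1 "real k" 1 "M\<^sup>2"] by simp
      have "exp (18 * real (card T.idx)) * (2 * exp (- (e\<^sup>2 * p / 16)) + 2 * exp (- (p / (4096 * (2 * real k * M))))) \<le> exp (- ((real k * M\<^sup>2) * t\<^sup>2))"
      proof (rule failure_bound[OF q t])
        have "real (card T.idx) \<le> real (2 * k * T.dmax\<^sup>2)" using T.card_idx by (rule of_nat_mono)
        then show "real (card T.idx) \<le> 2 * (real k * M\<^sup>2)" by (simp add: M_def)
        have "0 \<le> real k * M\<^sup>2 * t\<^sup>2" using k1 by simp
        then show "40 * (real k * M\<^sup>2) * t\<^sup>2 \<le> e\<^sup>2 * p / 16" unfolding e2 by simp
        \<comment> \<open>The second-order tail has \<open>\<kappa> = 2 * k * M\<close> in its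
          exponent, so it too needs \<open>p\<close> of order
          \<open>k\<^sup>2 * M ^ 3 * t\<^sup>2\<close>, with the smaller constant
          \<open>40 * 4096 * 2\<close>.\<close>
        have "40 * (real k * M\<^sup>2) * t\<^sup>2 * (4096 * (2 * real k * M)) = 327680 * ((real k)\<^sup>2 * M ^ 3 * t\<^sup>2)"
          by (simp add: power2_eq_square power3_eq_cube)
        also have "\<dots> \<le> 4000000 * ((real k)\<^sup>2 * M ^ 3 * t\<^sup>2)" using M by (intro mult_right_mono) auto
        also have "\<dots> \<le> p" by (rule p)
        finally show "40 * (real k * M\<^sup>2) * t\<^sup>2 \<le> p / (4096 * (2 * real k * M))"
          using k1 M by (subst pos_le_divide_eq) auto
      qed
      \<comment> \<open>The nets give the exponent \<open>k * M\<^sup>2 * t\<^sup>2\<close>, which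
        dominates \<open>M * t\<^sup>2\<close>.\<close>
      also have "\<dots> \<le> exp (- 1 * t\<^sup>2 * M)"
      proof -
        have "1 * M \<le> (real k * M) * M" using k1 M mult_mono[of 1 "real k" 1 M] by (intro mult_right_mono) auto
        then have "M * t\<^sup>2 \<le> (real k * M\<^sup>2) * t\<^sup>2" by (intro mult_right_mono) (simp_all add: power2_eq_square)
        then show ?thesis by (simp add: mult.commute)
      qed
      also have "\<dots> \<le> real k * exp (- 1 * t\<^sup>2 * M)"
        using mult_right_mono[OF k1, of "exp (- 1 * t\<^sup>2 * M)"] by simp
      finally show ?thesis using E(2) unfolding p_def M_def of_nat_mult of_nat_numeral by linarith
    qed
    have rate: "40 * (4 / 3 * e) \<le> 1400 * (sqrt k * M * t / sqrt p)"
    proof -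
      have "40 * (4 / 3 * (26 * X)) \<le> 1400 * X" if "0 \<le> X" for X :: real using that by simp
      moreover have "e = 26 * (sqrt k * M * t / sqrt p)" by (simp add: e_def)
      moreover have "0 \<le> sqrt k * M * t / sqrt p" using M t p0 by simp
      ultimately show ?thesis by metis
    qed
    show ?case
      unfolding holds_with_prob_ge_def P[symmetric]
    proof (intro bexI[OF _ E(1)] conjI ballI, goal_cases)
      case (1 x)
      note x = 1
      interpret X: tensor_fit k ?d n U0 l0 x ds "4 / 3 * e" "2 * real k * T.dmax"
        by (intro tensor_fit.intro tensor_fit_axioms.intro F.tensor_model_axioms E(3)[OF x] ds)
      obtain Ts where Ts: "Ts \<in> PD_tuples ds" "is_unique_MLE ds n x (kron_list Ts)"
        "normalized_factors ds (map F.\<Theta> T.xs) \<longrightarrow> normalized_factors ds Ts"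
        "fisher_rao (kron_list Ts) (kron_list (map F.\<Theta> T.xs)) \<le> sqrt T.D * (40 * (4 / 3 * e))"
        "\<And>a. a < k \<Longrightarrow> fisher_rao (Ts ! a) (F.\<Theta> a) \<le> sqrt (?d a) * (40 * (4 / 3 * e))"
        using X.fit by blast
      have fr: "fisher_rao (kron_list Ts) (kron_list \<Theta>s) \<le> 1400 * (sqrt (real k) * real T.dmax / sqrt (real n)) * t"
      proof -
        have "fisher_rao (kron_list Ts) (kron_list \<Theta>s) \<le> sqrt T.D * (40 * (4 / 3 * e))"
          using Ts(4) unfolding \<Theta>m .
        also have "\<dots> \<le> sqrt T.D * (1400 * (sqrt k * M * t / sqrt p))" using rate by (intro mult_left_mono) auto
        also have "\<dots> = 1400 * (sqrt (real k) * real T.dmax / sqrt (real n)) * t"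
          using Dp n by (simp add: p_def M_def real_sqrt_mult field_simps)
        finally show ?thesis .
      qed
      have fra: "fisher_rao (Ts ! a) (\<Theta>s ! a) \<le> 1400 * (sqrt (real k * real (ds ! a)) * real T.dmax / sqrt (real n * real T.D)) * t" if a: "a < k" for a
      proof -
        have "fisher_rao (Ts ! a) (\<Theta>s ! a) \<le> sqrt (?d a) * (40 * (4 / 3 * e))"
          using Ts(5)[OF a] unfolding \<Theta>a[OF a] .
        also have "\<dots> \<le> sqrt (?d a) * (1400 * (sqrt k * M * t / sqrt p))" using rate by (intro mult_left_mono) auto
        also have "\<dots> = 1400 * (sqrt (real k * real (ds ! a)) * real T.dmax / sqrt (real n * real T.D)) * t"
          by (simp add: p_def M_def real_sqrt_mult)
        finally show ?thesis .
      qed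
      show ?case
        using Ts(1,2) mp[OF Ts(3)[unfolded \<Theta>m] norm] fr fra by blast
    next
      case 2
      have "0 \<le> (real k)\<^sup>2 * (sqrt (real n * real T.D) / (real k * real T.dmax)) powr (- 1 * real (Min (set ds)))" by simp
      then show ?case using prob unfolding M_def by linarith
    qed
  qed
qed simp_all

end
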